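(* Let $\mathscr{Z}\subset S^1$ be an admissible subset, let $k$ be an algebraically closed field, and let $\mathscr{C}(\mathscr{Z})$ be the associated Igusa--Todorov cluster category of Dynkin type $A_\infty$. Let $\mathscr{X}$ be a set of diagonals of $\mathscr{Z}$. Then $\operatorname{add} E(\mathscr{X})$ is a cluster tilting subcategory of $\mathscr{C}(\mathscr{Z})$ if and only if $\mathscr{X}$ is a maximal set of pairwise non-crossing diagonals of $\mathscr{Z}$ such that for each $a\in L(\mathscr{Z})$, the set $\mathscr{X}$ has a fountain or a leapfrog converging to $a$.
   Context: Cyclic order. The circle $S^1$ has its usual topology and the anticlockwise cyclic order: $x_0<x_1<\dots<x_n$ means that, moving anticlockwise around the circle, after encountering $x_{i-1}$ the next element of $\{x_0,\dots,x_n\}$ encountered is $x_i$, for $i=1,\dots,n$. Weak inequalities are defined analogously. Intervals such as $[a,b]$ are taken anticlockwise from $a$ to $b$ and carry the induced linear order. Admissible subsets. A subset $\mathscr{Z}\subset S^1$ is admissible if (1) it is infinite; (2) it is discrete, i.e. each $z\in\mathscr{Z}$ has an open neighbourhood in $S^1$ containing no other element of $\mathscr{Z}$; (3) it satisfies the two-sided limit condition: each $x\in S^1$ which is the limit of a sequence from $\mathscr{Z}$ is a limit of both an increasing and a decreasing sequence from $\mathscr{Z}$ with respect to the cyclic order. Each $z\in\mathscr{Z}$ then has a unique predecessor $z^-\in\mathscr{Z}$ with $(z^-,z)\cap\mathscr{Z}=\varnothing$ and a unique successor $z^+\in\mathscr{Z}$ with $(z,z^+)\cap\mathscr{Z}=\varnothing$;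 write $z^{--}=(z^-)^-$. Put $\overline{\mathscr{Z}}$ = closure of $\mathscr{Z}$ in $S^1$ and $L(\mathscr{Z})=\overline{\mathscr{Z}}\setminus\mathscr{Z}$ (the proper limit points). Diagonals. A diagonal of $\mathscr{Z}$ is a subset $\{x_0,x_1\}\subset\mathscr{Z}$ with $x_1\notin\{x_0^-,x_0,x_0^+\}$. Diagonals $\{x_0,x_1\}$ and $\{y_0,y_1\}$ cross if $x_0<y_0<x_1<y_1$ or $x_0<y_1<x_1<y_0$. "Maximal" means maximal under inclusion. Convergence. For a sequence $(z_i)_{i\ge 0}$ from $\mathscr{Z}$ converging to $p\in\overline{\mathscr{Z}}$: $z_i\to p$ from below if there is $\mu\in S^1\setminus\{p\}$ with $z_i\in[\mu,p]$ from some step; $z_i\to p$ from above if there is $\nu\in S^1\setminus\{p\}$ with $z_i\in[p,\nu]$ from some step. Leapfrogs and fountains. Let $\mathscr{X}$ be a set of diagonals and $a\in L(\mathscr{Z})$. $\mathscr{X}$ has a leapfrog converging to $a$ if there is a sequence $\{x_i,y_i\}_{i\ge 0}$ of diagonals from $\mathscr{X}$ with $x_i\to a$ from below and $y_i\to a$ from above. $\mathscr{X}$ has a right (resp. left) fountain at $z\in\mathscr{Z}$ converging to $a$ if there is a sequence $\{z,x_i\}_{i\ge 0}$ from $\mathscr{X}$ with $x_i\to a$ from below (resp. from above). $\mathscr{X}$ has a fountain at $z$ converging to $a$ if it has both a right and a left fountain at $z$ converging to $a$; $\mathscr{X}$ has a fountain converging to $a$ if it has one at some $z\in\mathscr{Z}$.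 The category. $\mathscr{C}(\mathscr{Z})$ is the cluster category constructed from $\mathscr{Z}$ and $k$ by Igusa and Todorov ("Cluster categories coming from cyclic posets", Comm. Algebra 43 (2015), 4367--4402). It has the following properties. (i) It is a $k$-linear Hom-finite Krull--Schmidt triangulated category, with suspension $\Sigma$. (ii) It is 2-Calabi--Yau: there are natural isomorphisms $\operatorname{Ext}^1(A,B)\cong\operatorname{Hom}_k(\operatorname{Ext}^1(B,A),k)$. (iii) To each diagonal $X=\{x_0,x_1\}$ there is an indecomposable object $E(X)=E(x_0,x_1)$, giving a bijection from diagonals of $\mathscr{Z}$ to isomorphism classes of indecomposable objects. (iv) $\Sigma E(x_0,x_1)=E(x_0^-,x_1^-)$. (v) $\operatorname{Ext}^1(E(X),E(Y))\cong k$ if $X$ and $Y$ cross, and $0$ otherwise. (vi) $\operatorname{Hom}(E(X),E(Y))\cong k$ if one can write $X=\{x_0,x_1\}$, $Y=\{y_0,y_1\}$ with $x_0\le y_0\le x_1^{--}<x_1\le y_1\le x_0^{--}$, and $0$ otherwise. (vii) In the situation of (vi) with $x_0\le y_0\le x_1^{--}<x_1\le y_1\le x_0^{--}$, a nonzero morphism $E(X)\to E(Y)$ factors through $E(S)$ if and only if one can write $S=\{s_0,s_1\}$ with $x_0\le s_0\le y_0$ and $x_1\le s_1\le y_1$. For a set $\mathscr{X}$ of diagonals, $E(\mathscr{X})=\{E(X)\mid X\in\mathscr{X}\}$ and $\operatorname{add}E(\mathscr{X})$ is the full subcategory of all objects isomorphic to direct summands of finite direct sums of objects of $E(\mathscr{X})$.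 Cluster tilting. For a full subcategory $Y$ of a triangulated category $\mathscr{T}$, put $Y^\perp=\{t\mid \operatorname{Hom}(y,t)=0\ \forall y\in Y\}$ and ${}^\perp Y=\{t\mid\operatorname{Hom}(t,y)=0\ \forall y\in Y\}$. $Y$ is weakly cluster tilting if $Y=(\Sigma^{-1}Y)^\perp={}^\perp(\Sigma Y)$. $Y$ is cluster tilting if it is weakly cluster tilting and functorially finite, i.e. precovering (for each $t\in\mathscr{T}$ there is a morphism $f:y\to t$ with $y\in Y$ such that each morphism $y'\to t$ with $y'\in Y$ factors through $f$) and preenveloping (the dual: for each $t$ there is $f:t\to y$ with $y\in Y$ such that each $t\to y'$ with $y'\in Y$ factors through $f$). *)

theory Defs
  imports "HOL-Analysis.Analysis" "HOL-Algebra.Algebraic_Closure"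
begin

section \<open>The circle with its cyclic order\<close>

abbreviation circle :: "complex set" where
  "circle \<equiv> sphere 0 1"

text \<open>The anticlockwise angle in \<open>[0, 2\<pi>)\<close> from \<open>a\<close> to \<open>x\<close>, for \<open>a\<close> and \<open>x\<close> on the circle.\<close>

definition angle_from :: "complex \<Rightarrow> complex \<Rightarrow> real" where
  "angle_from a x = Arg2pi (x / a)"

text \<open>Chains \<open>x\<^sub>0 < \<dots> < x\<^sub>n\<close> and \<open>x\<^sub>0 \<le> \<dots> \<le> x\<^sub>n\<close>, written as lists. All the points are met
  in the given order within one turn which starts at \<open>x\<^sub>0\<close> and does not come back to \<open>x\<^sub>0\<close>; thus
  the members of a strict chain are distinct, and \<open>a \<le> b \<le> a\<close> forces \<open>b = a\<close>.\<close>

definition cyc_less :: "complex list \<Rightarrow> bool" where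
  "cyc_less xs \<longleftrightarrow> set xs \<subseteq> circle \<and> sorted_wrt (<) (map (angle_from (hd xs)) xs)"

definition cyc_le :: "complex list \<Rightarrow> bool" where
  "cyc_le xs \<longleftrightarrow> set xs \<subseteq> circle \<and> sorted_wrt (\<le>) (map (angle_from (hd xs)) xs)"

definition cyc_open_interval :: "complex \<Rightarrow> complex \<Rightarrow> complex set" where
  "cyc_open_interval a b = {x. cyc_less [a, x, b]}"

definition cyc_closed_interval :: "complex \<Rightarrow> complex \<Rightarrow> complex set" where
  "cyc_closed_interval a b = {x. cyc_le [a, x, b]}"

definition cyc_increasing :: "(nat \<Rightarrow> complex) \<Rightarrow> bool" where
  "cyc_increasing z \<longleftrightarrow> (\<forall>n. cyc_le (map z [0..<Suc n]))"

definition cyc_decreasing :: "(nat \<Rightarrow> complex) \<Rightarrow> bool" where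
  "cyc_decreasing z \<longleftrightarrow> (\<forall>n. cyc_le (rev (map z [0..<Suc n])))"


section \<open>Admissible subsets, diagonals, fountains and leapfrogs\<close>

text \<open>Monotone sequences are understood in the weak sense: a point of the discrete set \<open>Z\<close> itself
  is a limit of eventually constant sequences only, so the condition has content exactly at the limit points
  outside \<open>Z\<close>.\<close>

definition two_sided_limits :: "complex set \<Rightarrow> bool" where
  "two_sided_limits Z \<longleftrightarrow>
    (\<forall>x\<in>circle. (\<exists>z. range z \<subseteq> Z \<and> z \<longlonglongrightarrow> x) \<longrightarrow>
      (\<exists>z. range z \<subseteq> Z \<and> cyc_increasing z \<and> z \<longlonglongrightarrow> x) \<and>
      (\<exists>z. range z \<subseteq> Z \<and> cyc_decreasing z \<and> z \<longlonglongrightarrow> x))"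

definition admissible :: "complex set \<Rightarrow> bool" where
  "admissible Z \<longleftrightarrow> Z \<subseteq> circle \<and> infinite Z \<and> discrete Z \<and> two_sided_limits Z"

text \<open>The clause \<open>w \<noteq> z\<close> is needed because the open interval from \<open>z\<close> to \<open>z\<close> is empty.\<close>

definition pre :: "complex set \<Rightarrow> complex \<Rightarrow> complex" where
  "pre Z z = (THE w. w \<in> Z \<and> w \<noteq> z \<and> cyc_open_interval w z \<inter> Z = {})"

definition suc :: "complex set \<Rightarrow> complex \<Rightarrow> complex" where
  "suc Z z = (THE w. w \<in> Z \<and> w \<noteq> z \<and> cyc_open_interval z w \<inter> Z = {})"

definition proper_limit_points :: "complex set \<Rightarrow> complex set" where
  "proper_limit_points Z = closure Z - Z"

definition diagonals :: "complex set \<Rightarrow> complex set set" where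
  "diagonals Z = {{x0, x1} | x0 x1. x0 \<in> Z \<and> x1 \<in> Z \<and> x1 \<notin> {pre Z x0, x0, suc Z x0}}"

definition cross :: "complex set \<Rightarrow> complex set \<Rightarrow> bool" where
  "cross U V \<longleftrightarrow> (\<exists>x0 x1 y0 y1. U = {x0, x1} \<and> V = {y0, y1} \<and>
    (cyc_less [x0, y0, x1, y1] \<or> cyc_less [x0, y1, x1, y0]))"

definition noncrossing :: "complex set set \<Rightarrow> bool" where
  "noncrossing \<D> \<longleftrightarrow> (\<forall>U\<in>\<D>. \<forall>V\<in>\<D>. \<not> cross U V)"

definition maximal_noncrossing :: "complex set \<Rightarrow> complex set set \<Rightarrow> bool" where
  "maximal_noncrossing Z \<D> \<longleftrightarrow> \<D> \<subseteq> diagonals Z \<and> noncrossing \<D> \<and>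
    (\<forall>\<D>'. \<D>' \<subseteq> diagonals Z \<and> noncrossing \<D>' \<and> \<D> \<subseteq> \<D>' \<longrightarrow> \<D>' = \<D>)"

definition tends_from_below :: "complex set \<Rightarrow> (nat \<Rightarrow> complex) \<Rightarrow> complex \<Rightarrow> bool" where
  "tends_from_below Z z p \<longleftrightarrow> range z \<subseteq> Z \<and> z \<longlonglongrightarrow> p \<and>
    (\<exists>\<mu>\<in>circle - {p}. \<forall>\<^sub>F i in sequentially. z i \<in> cyc_closed_interval \<mu> p)"

definition tends_from_above :: "complex set \<Rightarrow> (nat \<Rightarrow> complex) \<Rightarrow> complex \<Rightarrow> bool" where
  "tends_from_above Z z p \<longleftrightarrow> range z \<subseteq> Z \<and> z \<longlonglongrightarrow> p \<and>
    (\<exists>\<nu>\<in>circle - {p}. \<forall>\<^sub>F i in sequentially. z i \<in> cyc_closed_interval p \<nu>)"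

definition has_leapfrog :: "complex set \<Rightarrow> complex set set \<Rightarrow> complex \<Rightarrow> bool" where
  "has_leapfrog Z \<D> a \<longleftrightarrow>
    (\<exists>x y. (\<forall>i. {x i, y i} \<in> \<D>) \<and> tends_from_below Z x a \<and> tends_from_above Z y a)"

definition right_fountain_at ::
    "complex set \<Rightarrow> complex set set \<Rightarrow> complex \<Rightarrow> complex \<Rightarrow> bool" where
  "right_fountain_at Z \<D> z a \<longleftrightarrow> (\<exists>x. (\<forall>i. {z, x i} \<in> \<D>) \<and> tends_from_below Z x a)"

definition left_fountain_at ::
    "complex set \<Rightarrow> complex set set \<Rightarrow> complex \<Rightarrow> complex \<Rightarrow> bool" where
  "left_fountain_at Z \<D> z a \<longleftrightarrow> (\<exists>x. (\<forall>i. {z, x i} \<in> \<D>) \<and> tends_from_above Z x a)"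

definition has_fountain :: "complex set \<Rightarrow> complex set set \<Rightarrow> complex \<Rightarrow> bool" where
  "has_fountain Z \<D> a \<longleftrightarrow>
    (\<exists>z\<in>Z. right_fountain_at Z \<D> z a \<and> left_fountain_at Z \<D> z a)"


section \<open>Linear maps between modules\<close>

text \<open>Linear maps are extensional functions, so that each is determined by its values on the carrier.\<close>

definition linear_maps ::
    "('k, 'x) ring_scheme \<Rightarrow> ('k, 'm, 'y) module_scheme \<Rightarrow> ('k, 'n, 'z) module_scheme \<Rightarrow> ('m \<Rightarrow> 'n) set"
  where "linear_maps k M N = {\<phi> \<in> carrier M \<rightarrow>\<^sub>E carrier N.
    (\<forall>x\<in>carrier M. \<forall>y\<in>carrier M. \<phi> (x \<oplus>\<^bsub>M\<^esub> y) = \<phi> x \<oplus>\<^bsub>N\<^esub> \<phi> y) \<and>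
    (\<forall>c\<in>carrier k. \<forall>x\<in>carrier M. \<phi> (c \<odot>\<^bsub>M\<^esub> x) = c \<odot>\<^bsub>N\<^esub> \<phi> x)}"

definition linear_isos ::
    "('k, 'x) ring_scheme \<Rightarrow> ('k, 'm, 'y) module_scheme \<Rightarrow> ('k, 'n, 'z) module_scheme \<Rightarrow> ('m \<Rightarrow> 'n) set"
  where "linear_isos k M N = {\<phi> \<in> linear_maps k M N. bij_betw \<phi> (carrier M) (carrier N)}"

definition regular_module :: "('k, 'x) ring_scheme \<Rightarrow> ('k, 'k) module" where
  "regular_module k = \<lparr>carrier = carrier k, mult = mult k, one = \<one>\<^bsub>k\<^esub>, zero = \<zero>\<^bsub>k\<^esub>, add = add k,
    smult = mult k\<rparr>"

text \<open>A module record also has the fields \<open>mult\<close> and \<open>one\<close>, which play no role for modules.\<close>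

definition dual_module ::
    "('k, 'x) ring_scheme \<Rightarrow> ('k, 'm, 'y) module_scheme \<Rightarrow> ('k, 'm \<Rightarrow> 'k) module" where
  "dual_module k M = \<lparr>carrier = linear_maps k M (regular_module k), mult = undefined, one = undefined,
    zero = (\<lambda>x\<in>carrier M. \<zero>\<^bsub>k\<^esub>),
    add = (\<lambda>\<phi> \<psi>. \<lambda>x\<in>carrier M. \<phi> x \<oplus>\<^bsub>k\<^esub> \<psi> x),
    smult = (\<lambda>c \<phi>. \<lambda>x\<in>carrier M. c \<otimes>\<^bsub>k\<^esub> \<phi> x)\<rparr>"

definition finite_dimensional :: "('k, 'x) ring_scheme \<Rightarrow> ('k, 'm, 'y) module_scheme \<Rightarrow> bool" where
  "finite_dimensional k M \<longleftrightarrow> (\<exists>B. finite B \<and> B \<subseteq> carrier M \<and>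
    (\<forall>x\<in>carrier M. \<exists>c\<in>B \<rightarrow> carrier k. x = (\<Oplus>\<^bsub>M\<^esub>b\<in>B. c b \<odot>\<^bsub>M\<^esub> b)))"

definition zero_module :: "('k, 'm, 'y) module_scheme \<Rightarrow> bool" where
  "zero_module M \<longleftrightarrow> carrier M = {\<zero>\<^bsub>M\<^esub>}"


section \<open>Linear categories\<close>

text \<open>A \<open>k\<close>-linear category with object set \<open>Obj\<close>, in which \<open>Hom A B\<close> is a \<open>k\<close>-module.
  Composition is written in the usual order, \<open>g \<cdot> f\<close> being \<open>f\<close> followed by \<open>g\<close>. Hom sets need not be
  disjoint; letting each morphism record its source and target brings any category into this form.\<close>

record ('k, 'o, 'm) lincat =
  Obj :: "'o set"
  Hom :: "'o \<Rightarrow> 'o \<Rightarrow> ('k, 'm) module"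
  Ident :: "'o \<Rightarrow> 'm"
  Comp :: "'m \<Rightarrow> 'm \<Rightarrow> 'm" (infixr \<open>\<cdot>\<index>\<close> 72)

abbreviation arrows :: "('k, 'o, 'm, 'y) lincat_scheme \<Rightarrow> 'o \<Rightarrow> 'o \<Rightarrow> 'm set" where
  "arrows C A B \<equiv> carrier (Hom C A B)"

locale linear_category = k: Ring.field k
  for k :: "('k, 'x) ring_scheme" +
  fixes C :: "('k, 'o, 'm, 'y) lincat_scheme" (structure)
  assumes hom_module: "\<lbrakk>A \<in> Obj C; B \<in> Obj C\<rbrakk> \<Longrightarrow> Module.module k (Hom C A B)"
    and ident_closed: "A \<in> Obj C \<Longrightarrow> Ident C A \<in> arrows C A A"
    and comp_closed: "\<lbrakk>A \<in> Obj C; B \<in> Obj C; D \<in> Obj C; f \<in> arrows C A B; g \<in> arrows C B D\<rbrakk>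
      \<Longrightarrow> g \<cdot> f \<in> arrows C A D"
    and ident_left: "\<lbrakk>A \<in> Obj C; B \<in> Obj C; f \<in> arrows C A B\<rbrakk> \<Longrightarrow> Ident C B \<cdot> f = f"
    and ident_right: "\<lbrakk>A \<in> Obj C; B \<in> Obj C; f \<in> arrows C A B\<rbrakk> \<Longrightarrow> f \<cdot> Ident C A = f"
    and comp_assoc: "\<lbrakk>A \<in> Obj C; B \<in> Obj C; D \<in> Obj C; F \<in> Obj C;
        f \<in> arrows C A B; g \<in> arrows C B D; h \<in> arrows C D F\<rbrakk>
      \<Longrightarrow> (h \<cdot> g) \<cdot> f = h \<cdot> (g \<cdot> f)"
    and comp_add_left: "\<lbrakk>A \<in> Obj C; B \<in> Obj C; D \<in> Obj C;
        f \<in> arrows C A B; g \<in> arrows C B D; g' \<in> arrows C B D\<rbrakk>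
      \<Longrightarrow> (g \<oplus>\<^bsub>Hom C B D\<^esub> g') \<cdot> f = (g \<cdot> f) \<oplus>\<^bsub>Hom C A D\<^esub> (g' \<cdot> f)"
    and comp_add_right: "\<lbrakk>A \<in> Obj C; B \<in> Obj C; D \<in> Obj C;
        f \<in> arrows C A B; f' \<in> arrows C A B; g \<in> arrows C B D\<rbrakk>
      \<Longrightarrow> g \<cdot> (f \<oplus>\<^bsub>Hom C A B\<^esub> f') = (g \<cdot> f) \<oplus>\<^bsub>Hom C A D\<^esub> (g \<cdot> f')"
    and comp_smult_left: "\<lbrakk>A \<in> Obj C; B \<in> Obj C; D \<in> Obj C;
        f \<in> arrows C A B; g \<in> arrows C B D; c \<in> carrier k\<rbrakk>
      \<Longrightarrow> (c \<odot>\<^bsub>Hom C B D\<^esub> g) \<cdot> f = c \<odot>\<^bsub>Hom C A D\<^esub> (g \<cdot> f)"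
    and comp_smult_right: "\<lbrakk>A \<in> Obj C; B \<in> Obj C; D \<in> Obj C;
        f \<in> arrows C A B; g \<in> arrows C B D; c \<in> carrier k\<rbrakk>
      \<Longrightarrow> g \<cdot> (c \<odot>\<^bsub>Hom C A B\<^esub> f) = c \<odot>\<^bsub>Hom C A D\<^esub> (g \<cdot> f)"

definition iso_arrows :: "('k, 'o, 'm, 'y) lincat_scheme \<Rightarrow> 'o \<Rightarrow> 'o \<Rightarrow> 'm set" where
  "iso_arrows C A B =
    {f \<in> arrows C A B. \<exists>g\<in>arrows C B A. g \<cdot>\<^bsub>C\<^esub> f = Ident C A \<and> f \<cdot>\<^bsub>C\<^esub> g = Ident C B}"

definition isomorphic :: "('k, 'o, 'm, 'y) lincat_scheme \<Rightarrow> 'o \<Rightarrow> 'o \<Rightarrow> bool" where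
  "isomorphic C A B \<longleftrightarrow> iso_arrows C A B \<noteq> {}"

definition zero_object :: "('k, 'o, 'm, 'y) lincat_scheme \<Rightarrow> 'o \<Rightarrow> bool" where
  "zero_object C A \<longleftrightarrow> A \<in> Obj C \<and>
    (\<forall>B\<in>Obj C. zero_module (Hom C A B) \<and> zero_module (Hom C B A))"

text \<open>\<open>S\<close> is a direct sum of the finite list \<open>As\<close> of objects; the direct sums of the empty list are
  the zero objects.\<close>

definition direct_sum :: "('k, 'o, 'm, 'y) lincat_scheme \<Rightarrow> 'o list \<Rightarrow> 'o \<Rightarrow> bool" where
  "direct_sum C As S \<longleftrightarrow> set As \<subseteq> Obj C \<and> S \<in> Obj C \<and>
    (\<exists>\<iota> \<pi>.
      (\<forall>i<length As. \<iota> i \<in> arrows C (As ! i) S \<and> \<pi> i \<in> arrows C S (As ! i)) \<and>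
      (\<forall>i<length As. \<forall>j<length As. \<pi> i \<cdot>\<^bsub>C\<^esub> \<iota> j =
        (if i = j then Ident C (As ! i) else \<zero>\<^bsub>Hom C (As ! j) (As ! i)\<^esub>)) \<and>
      (\<Oplus>\<^bsub>Hom C S S\<^esub>i\<in>{..<length As}. \<iota> i \<cdot>\<^bsub>C\<^esub> \<pi> i) = Ident C S)"

definition direct_summand :: "('k, 'o, 'm, 'y) lincat_scheme \<Rightarrow> 'o \<Rightarrow> 'o \<Rightarrow> bool" where
  "direct_summand C A S \<longleftrightarrow> (\<exists>B. direct_sum C [A, B] S)"

definition indecomposable :: "('k, 'o, 'm, 'y) lincat_scheme \<Rightarrow> 'o \<Rightarrow> bool" where
  "indecomposable C A \<longleftrightarrow> A \<in> Obj C \<and> \<not> zero_object C A \<and>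
    (\<forall>B D. direct_sum C [B, D] A \<longrightarrow> zero_object C B \<or> zero_object C D)"

definition local_endomorphism_ring :: "('k, 'o, 'm, 'y) lincat_scheme \<Rightarrow> 'o \<Rightarrow> bool" where
  "local_endomorphism_ring C A \<longleftrightarrow> Ident C A \<noteq> \<zero>\<^bsub>Hom C A A\<^esub> \<and>
    (\<forall>f\<in>arrows C A A. \<forall>g\<in>arrows C A A.
      f \<oplus>\<^bsub>Hom C A A\<^esub> g \<in> iso_arrows C A A \<longrightarrow> f \<in> iso_arrows C A A \<or> g \<in> iso_arrows C A A)"

definition krull_schmidt :: "('k, 'o, 'm, 'y) lincat_scheme \<Rightarrow> bool" where
  "krull_schmidt C \<longleftrightarrow> (\<forall>A\<in>Obj C. \<exists>As. direct_sum C As A \<and>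
    (\<forall>B\<in>set As. local_endomorphism_ring C B))"

definition hom_finite ::
    "('k, 'x) ring_scheme \<Rightarrow> ('k, 'o, 'm, 'y) lincat_scheme \<Rightarrow> bool" where
  "hom_finite k C \<longleftrightarrow> (\<forall>A\<in>Obj C. \<forall>B\<in>Obj C. finite_dimensional k (Hom C A B))"

definition factors_through ::
    "('k, 'o, 'm, 'y) lincat_scheme \<Rightarrow> 'o \<Rightarrow> 'o \<Rightarrow> 'o \<Rightarrow> 'm \<Rightarrow> bool" where
  "factors_through C A B S f \<longleftrightarrow> (\<exists>g\<in>arrows C A S. \<exists>h\<in>arrows C S B. f = h \<cdot>\<^bsub>C\<^esub> g)"

definition add_closure :: "('k, 'o, 'm, 'y) lincat_scheme \<Rightarrow> 'o set \<Rightarrow> 'o set" where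
  "add_closure C \<E> = {A \<in> Obj C. \<exists>As S B. set As \<subseteq> \<E> \<and> direct_sum C As S \<and>
    direct_summand C B S \<and> isomorphic C A B}"


section \<open>Triangulated categories\<close>

text \<open>\<open>Sus\<close> and \<open>Susm\<close> are the suspension functor on objects and on morphisms, and \<open>Tri\<close> is the
  class of distinguished triangles \<open>A \<rightarrow> B \<rightarrow> D \<rightarrow> Sus A\<close>, listed as \<open>(A, B, D, f, g, h)\<close>.\<close>

record ('k, 'o, 'm) tricat = "('k, 'o, 'm) lincat" +
  Sus :: "'o \<Rightarrow> 'o"
  Susm :: "'m \<Rightarrow> 'm"
  Tri :: "('o \<times> 'o \<times> 'o \<times> 'm \<times> 'm \<times> 'm) set"

text \<open>The suspension is only required to be an autoequivalence, which includes the case of an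
  automorphism.\<close>

locale triangulated_category = linear_category k C
  for k :: "('k, 'x) ring_scheme" and C :: "('k, 'o, 'm, 'y) tricat_scheme" (structure) +
  assumes direct_sums: "set As \<subseteq> Obj C \<Longrightarrow> \<exists>S. direct_sum C As S"
    and sus_closed: "A \<in> Obj C \<Longrightarrow> Sus C A \<in> Obj C"
    and sus_ident: "A \<in> Obj C \<Longrightarrow> Susm C (Ident C A) = Ident C (Sus C A)"
    and sus_comp: "\<lbrakk>A \<in> Obj C; B \<in> Obj C; D \<in> Obj C; f \<in> arrows C A B; g \<in> arrows C B D\<rbrakk>
      \<Longrightarrow> Susm C (g \<cdot> f) = Susm C g \<cdot> Susm C f"
    and sus_linear_fully_faithful: "\<lbrakk>A \<in> Obj C; B \<in> Obj C\<rbrakk> \<Longrightarrow>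
      restrict (Susm C) (arrows C A B) \<in> linear_isos k (Hom C A B) (Hom C (Sus C A) (Sus C B))"
    and sus_essentially_surjective: "B \<in> Obj C \<Longrightarrow> \<exists>A\<in>Obj C. isomorphic C (Sus C A) B"
    and tri_typed: "(A, B, D, f, g, h) \<in> Tri C \<Longrightarrow> A \<in> Obj C \<and> B \<in> Obj C \<and> D \<in> Obj C \<and>
      f \<in> arrows C A B \<and> g \<in> arrows C B D \<and> h \<in> arrows C D (Sus C A)"
    and TR1_iso: "\<lbrakk>(A, B, D, f, g, h) \<in> Tri C; A' \<in> Obj C; B' \<in> Obj C; D' \<in> Obj C;
        f' \<in> arrows C A' B'; g' \<in> arrows C B' D'; h' \<in> arrows C D' (Sus C A');
        u \<in> iso_arrows C A A'; v \<in> iso_arrows C B B'; w \<in> iso_arrows C D D';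
        v \<cdot> f = f' \<cdot> u; w \<cdot> g = g' \<cdot> v; Susm C u \<cdot> h = h' \<cdot> w\<rbrakk>
      \<Longrightarrow> (A', B', D', f', g', h') \<in> Tri C"
    and TR1_ident: "\<lbrakk>A \<in> Obj C; zero_object C N\<rbrakk>
      \<Longrightarrow> (A, A, N, Ident C A, \<zero>\<^bsub>Hom C A N\<^esub>, \<zero>\<^bsub>Hom C N (Sus C A)\<^esub>) \<in> Tri C"
    and TR1_cone: "\<lbrakk>A \<in> Obj C; B \<in> Obj C; f \<in> arrows C A B\<rbrakk>
      \<Longrightarrow> \<exists>D g h. (A, B, D, f, g, h) \<in> Tri C"
    and TR2: "\<lbrakk>A \<in> Obj C; B \<in> Obj C; D \<in> Obj C;
        f \<in> arrows C A B; g \<in> arrows C B D; h \<in> arrows C D (Sus C A)\<rbrakk>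
      \<Longrightarrow> (A, B, D, f, g, h) \<in> Tri C \<longleftrightarrow>
        (B, D, Sus C A, g, h, \<ominus>\<^bsub>Hom C (Sus C A) (Sus C B)\<^esub> (Susm C f)) \<in> Tri C"
    and TR3: "\<lbrakk>(A, B, D, f, g, h) \<in> Tri C; (A', B', D', f', g', h') \<in> Tri C;
        u \<in> arrows C A A'; v \<in> arrows C B B'; v \<cdot> f = f' \<cdot> u\<rbrakk>
      \<Longrightarrow> \<exists>w\<in>arrows C D D'. w \<cdot> g = g' \<cdot> v \<and> Susm C u \<cdot> h = h' \<cdot> w"
    and TR4: "\<lbrakk>(A, B, P, f, f1, f2) \<in> Tri C; (B, D, Q, g, g1, g2) \<in> Tri C;
        (A, D, R, g \<cdot> f, c1, c2) \<in> Tri C\<rbrakk>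
      \<Longrightarrow> \<exists>u\<in>arrows C P R. \<exists>v\<in>arrows C R Q. (P, R, Q, u, v, Susm C f1 \<cdot> g2) \<in> Tri C \<and>
        u \<cdot> f1 = c1 \<cdot> g \<and> c2 \<cdot> u = f2 \<and> v \<cdot> c1 = g1 \<and> g2 \<cdot> v = Susm C f \<cdot> c2"

definition Ext1 :: "('k, 'o, 'm, 'y) tricat_scheme \<Rightarrow> 'o \<Rightarrow> 'o \<Rightarrow> ('k, 'm) module" where
  "Ext1 C A B = Hom C A (Sus C B)"

text \<open>The last two clauses say that the isomorphisms \<open>\<theta> A B\<close> are natural in \<open>A\<close> and in \<open>B\<close>.\<close>

definition two_calabi_yau ::
    "('k, 'x) ring_scheme \<Rightarrow> ('k, 'o, 'm, 'y) tricat_scheme \<Rightarrow> bool" where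
  "two_calabi_yau k C \<longleftrightarrow> (\<exists>\<theta>.
    (\<forall>A\<in>Obj C. \<forall>B\<in>Obj C. \<theta> A B \<in> linear_isos k (Ext1 C A B) (dual_module k (Ext1 C B A))) \<and>
    (\<forall>A\<in>Obj C. \<forall>A'\<in>Obj C. \<forall>B\<in>Obj C. \<forall>f\<in>arrows C A' A.
      \<forall>\<epsilon>\<in>carrier (Ext1 C A B). \<forall>\<eta>\<in>carrier (Ext1 C B A').
        \<theta> A' B (\<epsilon> \<cdot>\<^bsub>C\<^esub> f) \<eta> = \<theta> A B \<epsilon> (Susm C f \<cdot>\<^bsub>C\<^esub> \<eta>)) \<and>
    (\<forall>A\<in>Obj C. \<forall>B\<in>Obj C. \<forall>B'\<in>Obj C. \<forall>g\<in>arrows C B B'.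
      \<forall>\<epsilon>\<in>carrier (Ext1 C A B). \<forall>\<eta>\<in>carrier (Ext1 C B' A).
        \<theta> A B' (Susm C g \<cdot>\<^bsub>C\<^esub> \<epsilon>) \<eta> = \<theta> A B \<epsilon> (\<eta> \<cdot>\<^bsub>C\<^esub> g)))"


section \<open>Cluster tilting subcategories\<close>

text \<open>A full subcategory is given by its set of objects.\<close>

definition right_perp :: "('k, 'o, 'm, 'y) lincat_scheme \<Rightarrow> 'o set \<Rightarrow> 'o set" where
  "right_perp C Y = {t \<in> Obj C. \<forall>y\<in>Y. zero_module (Hom C y t)}"

definition left_perp :: "('k, 'o, 'm, 'y) lincat_scheme \<Rightarrow> 'o set \<Rightarrow> 'o set" where
  "left_perp C Y = {t \<in> Obj C. \<forall>y\<in>Y. zero_module (Hom C t y)}"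

text \<open>Since the suspension is an autoequivalence, its inverse is defined up to isomorphism.\<close>

definition desuspension :: "('k, 'o, 'm, 'y) tricat_scheme \<Rightarrow> 'o set \<Rightarrow> 'o set" where
  "desuspension C Y = {t \<in> Obj C. \<exists>y\<in>Y. isomorphic C (Sus C t) y}"

definition weakly_cluster_tilting :: "('k, 'o, 'm, 'y) tricat_scheme \<Rightarrow> 'o set \<Rightarrow> bool" where
  "weakly_cluster_tilting C Y \<longleftrightarrow>
    Y = right_perp C (desuspension C Y) \<and> Y = left_perp C (Sus C ` Y)"

definition precovering :: "('k, 'o, 'm, 'y) lincat_scheme \<Rightarrow> 'o set \<Rightarrow> bool" where
  "precovering C Y \<longleftrightarrow> (\<forall>t\<in>Obj C. \<exists>y\<in>Y. \<exists>f\<in>arrows C y t.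
    \<forall>y'\<in>Y. \<forall>f'\<in>arrows C y' t. \<exists>g\<in>arrows C y' y. f' = f \<cdot>\<^bsub>C\<^esub> g)"

definition preenveloping :: "('k, 'o, 'm, 'y) lincat_scheme \<Rightarrow> 'o set \<Rightarrow> bool" where
  "preenveloping C Y \<longleftrightarrow> (\<forall>t\<in>Obj C. \<exists>y\<in>Y. \<exists>f\<in>arrows C t y.
    \<forall>y'\<in>Y. \<forall>f'\<in>arrows C t y'. \<exists>g\<in>arrows C y y'. f' = g \<cdot>\<^bsub>C\<^esub> f)"

definition cluster_tilting :: "('k, 'o, 'm, 'y) tricat_scheme \<Rightarrow> 'o set \<Rightarrow> bool" where
  "cluster_tilting C Y \<longleftrightarrow> weakly_cluster_tilting C Y \<and> precovering C Y \<and> preenveloping C Y"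


section \<open>Igusa--Todorov cluster categories\<close>

text \<open>The chain \<open>x\<^sub>0 \<le> y\<^sub>0 \<le> x\<^sub>1\<^sup>-\<^sup>- < x\<^sub>1 \<le> y\<^sub>1 \<le> x\<^sub>0\<^sup>-\<^sup>-\<close>; the angle is injective on the circle, so the
  inequality clause makes the middle step strict.\<close>

definition hom_configuration ::
    "complex set \<Rightarrow> complex \<Rightarrow> complex \<Rightarrow> complex \<Rightarrow> complex \<Rightarrow> bool" where
  "hom_configuration Z x0 x1 y0 y1 \<longleftrightarrow> pre Z (pre Z x1) \<noteq> x1 \<and>
    cyc_le [x0, y0, pre Z (pre Z x1), x1, y1, pre Z (pre Z x0)]"

text \<open>The category constructed by Igusa and Todorov from \<open>Z\<close> and \<open>k\<close> enters through its structure and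
  the following properties: \<open>C\<close> is any category, with a parametrisation \<open>E\<close> of its indecomposable
  objects by the diagonals of \<open>Z\<close>, which has them.\<close>

locale igusa_todorov_category = triangulated_category k C
  for k :: "('k, 'x) ring_scheme" and Z :: "complex set"
    and C :: "('k, 'o, 'm, 'y) tricat_scheme" (structure) and E :: "complex set \<Rightarrow> 'o" +
  assumes hom_finite: "hom_finite k C"
    and krull_schmidt: "krull_schmidt C"
    and two_calabi_yau: "two_calabi_yau k C"
    and E_indecomposable: "U \<in> diagonals Z \<Longrightarrow> indecomposable C (E U)"
    and E_injective: "\<lbrakk>U \<in> diagonals Z; V \<in> diagonals Z; isomorphic C (E U) (E V)\<rbrakk> \<Longrightarrow> U = V"
    and E_surjective: "indecomposable C A \<Longrightarrow> \<exists>U\<in>diagonals Z. isomorphic C A (E U)"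
    and sus_E: "{x0, x1} \<in> diagonals Z \<Longrightarrow>
      isomorphic C (Sus C (E {x0, x1})) (E {pre Z x0, pre Z x1})"
    and ext_cross: "\<lbrakk>U \<in> diagonals Z; V \<in> diagonals Z; cross U V\<rbrakk>
      \<Longrightarrow> linear_isos k (Ext1 C (E U) (E V)) (regular_module k) \<noteq> {}"
    and ext_not_cross: "\<lbrakk>U \<in> diagonals Z; V \<in> diagonals Z; \<not> cross U V\<rbrakk>
      \<Longrightarrow> zero_module (Ext1 C (E U) (E V))"
    and hom_nonzero: "\<lbrakk>{x0, x1} \<in> diagonals Z; {y0, y1} \<in> diagonals Z; hom_configuration Z x0 x1 y0 y1\<rbrakk>
      \<Longrightarrow> linear_isos k (Hom C (E {x0, x1}) (E {y0, y1})) (regular_module k) \<noteq> {}"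
    and hom_zero: "\<lbrakk>U \<in> diagonals Z; V \<in> diagonals Z;
        \<nexists>x0 x1 y0 y1. U = {x0, x1} \<and> V = {y0, y1} \<and> hom_configuration Z x0 x1 y0 y1\<rbrakk>
      \<Longrightarrow> zero_module (Hom C (E U) (E V))"
    and factorization: "\<lbrakk>{x0, x1} \<in> diagonals Z; {y0, y1} \<in> diagonals Z; S \<in> diagonals Z;
        hom_configuration Z x0 x1 y0 y1;
        f \<in> arrows C (E {x0, x1}) (E {y0, y1}); f \<noteq> \<zero>\<^bsub>Hom C (E {x0, x1}) (E {y0, y1})\<^esub>\<rbrakk>
      \<Longrightarrow> factors_through C (E {x0, x1}) (E {y0, y1}) (E S) f \<longleftrightarrow>
        (\<exists>s0 s1. S = {s0, s1} \<and> cyc_le [x0, s0, y0] \<and> cyc_le [x1, s1, y1])"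

end

theory Submission
  imports Defs
begin

text \<open>The proof has a categorical half, which turns cluster tilting into combinatorics of diagonals, and
  a combinatorial half.

  Categories. By Krull--Schmidt every object is a finite direct sum of objects \<open>E U\<close>, and a nonzero map
  between two of these is unique up to a scalar. So \<open>add E(\<D>)\<close> consists of the finite direct sums of
  the \<open>E U\<close> with \<open>U\<close> in \<open>\<D>\<close> (\<open>add_closure_eq_finite_sums\<close>). Both perpendicular categories in the
  definition of a weakly cluster tilting subcategory consist of the sums of the \<open>E U\<close> with \<open>U\<close>
  crossing no member of \<open>\<D>\<close>; hence the weak condition means that \<open>\<D>\<close> is maximal noncrossing
  (\<open>weakly_cluster_tilting_iff\<close>, \<open>maximal_noncrossing_iff\<close>). The subcategory is precovering if and only
  if for each diagonal \<open>Y\<close> there are finitely many members \<open>S\<close> of \<open>\<D>\<close> such that each nonzero map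
  \<open>E X \<rightarrow> E Y\<close> with \<open>X\<close> in \<open>\<D>\<close> factors through one of the \<open>E S\<close> (\<open>precovering_finite_sums_iff\<close>); the
  opposite category yields the dual statement for preenveloping. In terms of the ends, the relevant
  \<open>X = {x0, x1}\<close> have \<open>x0\<close> and \<open>x1\<close> in the two arcs cut out by \<open>Y = {y0, y1}\<close>, and \<open>S = {s0, s1}\<close>
  dominates \<open>X\<close> if it is closer to \<open>Y\<close> in both ends.

  From fountains and leapfrogs to domination. The pairs \<open>(x0, x1)\<close> lie in a compact product of two arcs.
  Near a limit point \<open>a\<close> in one of the arcs, the members of a leapfrog cross all such pairs, as do
  the arms of a fountain, except for pairs with \<open>x0\<close> or \<open>x1\<close> at the centre of the fountain; and these
  are dominated by a single arm that ends beyond \<open>a\<close>. Pairs near which neither coordinate is a limit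
  point are isolated. By compactness finitely many members suffice
  (\<open>dominated_of_fountains_and_leapfrogs\<close>).

  From domination to fountains and leapfrogs. Let \<open>a\<close> be a limit point without a leapfrog. If the
  members of \<open>\<D>\<close> with one end tending to \<open>a\<close> from below have other ends which stay away from \<open>a\<close>, then
  domination of these members by finitely many others forces infinitely many of them to share an end, and the
  dominating members show that a fountain at this end converges to \<open>a\<close>
  (\<open>fountain_of_far_reaching\<close>). The mirror image of the argument handles ends tending to \<open>a\<close> from above; it
  uses preenvelopes. In the remaining case there are points just below and just above \<open>a\<close> over which no
  member of \<open>\<D>\<close> jumps (\<open>unlinked_vertex\<close>). Two such points form a diagonal that crosses no
  member of \<open>\<D>\<close>, so it belongs to \<open>\<D>\<close>, and there is a leapfrog after all
  (\<open>fountain_or_leapfrog_of_dominated\<close>).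

  The combinatorial half is carried out for an abstract circle with an angle function for each base
  point. Only at the end is it applied to the unit circle, where convergence from below and above
  becomes convergence of angles to \<open>2\<pi>\<close> and \<open>0\<close>.\<close>

section \<open>Linear categories and finite direct sums\<close>

text \<open>Every nonzero vector spans the space. In this form a Hom space isomorphic to \<open>k\<close> can be used
  inside composites: a nonzero map is unique up to a scalar.\<close>

definition one_dimensional ::
    "('k, 'x) ring_scheme \<Rightarrow> ('k, 'm, 'y) module_scheme \<Rightarrow> bool" where
  "one_dimensional k M \<longleftrightarrow> (\<exists>x\<in>carrier M. x \<noteq> \<zero>\<^bsub>M\<^esub>) \<and>
    (\<forall>x\<in>carrier M. \<forall>y\<in>carrier M. x \<noteq> \<zero>\<^bsub>M\<^esub> \<longrightarrow> (\<exists>c\<in>carrier k. y = c \<odot>\<^bsub>M\<^esub> x))"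

lemma one_dimensionalI:
  assumes "Ring.field k" "Module.module k M"
    and "linear_isos k M (regular_module k) \<noteq> {}"
  shows "one_dimensional k M"
proof -
  interpret k: Ring.field k by fact
  interpret M: Module.module k M by fact
  obtain \<phi> where \<phi>: "\<phi> \<in> carrier M \<rightarrow>\<^sub>E carrier k" "bij_betw \<phi> (carrier M) (carrier k)"
    "\<And>c x. c \<in> carrier k \<Longrightarrow> x \<in> carrier M \<Longrightarrow> \<phi> (c \<odot>\<^bsub>M\<^esub> x) = c \<otimes>\<^bsub>k\<^esub> \<phi> x"
    using assms(3) by (auto simp: linear_isos_def linear_maps_def regular_module_def)
  have closed: "\<phi> x \<in> carrier k" if "x \<in> carrier M" for x
    using \<phi>(1) that by auto
  have zero: "\<phi> \<zero>\<^bsub>M\<^esub> = \<zero>\<^bsub>k\<^esub>"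
    using \<phi>(3)[of "\<zero>\<^bsub>k\<^esub>" "\<zero>\<^bsub>M\<^esub>"] closed[of "\<zero>\<^bsub>M\<^esub>"] by simp
  have inj: "x = y" if "x \<in> carrier M" "y \<in> carrier M" "\<phi> x = \<phi> y" for x y
    using \<phi>(2) that by (auto simp: bij_betw_def inj_on_def)
  obtain x1 where x1: "x1 \<in> carrier M" "\<phi> x1 = \<one>\<^bsub>k\<^esub>"
    using \<phi>(2) k.one_closed by (metis bij_betw_iff_bijections)
  have "x1 \<noteq> \<zero>\<^bsub>M\<^esub>"
    using x1 zero by auto
  moreover have "\<exists>c\<in>carrier k. y = c \<odot>\<^bsub>M\<^esub> x"
    if "x \<in> carrier M" "y \<in> carrier M" "x \<noteq> \<zero>\<^bsub>M\<^esub>" for x y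
  proof
    have "\<phi> x \<noteq> \<zero>\<^bsub>k\<^esub>"
      using inj[of x "\<zero>\<^bsub>M\<^esub>"] that zero by auto
    then have unit: "\<phi> x \<in> Units k"
      using closed that k.field_Units by auto
    show c: "\<phi> y \<otimes>\<^bsub>k\<^esub> inv\<^bsub>k\<^esub> (\<phi> x) \<in> carrier k"
      using unit closed that by auto
    show "y = (\<phi> y \<otimes>\<^bsub>k\<^esub> inv\<^bsub>k\<^esub> (\<phi> x)) \<odot>\<^bsub>M\<^esub> x"
    proof (rule inj)
      show "\<phi> y = \<phi> ((\<phi> y \<otimes>\<^bsub>k\<^esub> inv\<^bsub>k\<^esub> (\<phi> x)) \<odot>\<^bsub>M\<^esub> x)"
        using \<phi>(3)[OF c] that unit closed by (simp add: k.m_assoc)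
    qed (use c that in auto)
  qed
  ultimately show ?thesis
    using x1 by (auto simp: one_dimensional_def)
qed

text \<open>The inclusions \<open>\<iota>\<close> and projections \<open>\<pi>\<close> are explicit arguments because arrows into and out of
  \<open>S\<close> are expanded along them.\<close>

definition sum_maps ::
    "('k, 'o, 'm, 'y) lincat_scheme \<Rightarrow> 'o list \<Rightarrow> 'o \<Rightarrow> (nat \<Rightarrow> 'm) \<Rightarrow> (nat \<Rightarrow> 'm) \<Rightarrow> bool" where
  "sum_maps C As S \<iota> \<pi> \<longleftrightarrow> set As \<subseteq> Obj C \<and> S \<in> Obj C \<and>
    (\<forall>i<length As. \<iota> i \<in> arrows C (As ! i) S \<and> \<pi> i \<in> arrows C S (As ! i)) \<and>
    (\<forall>i<length As. \<forall>j<length As. \<pi> i \<cdot>\<^bsub>C\<^esub> \<iota> j =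
      (if i = j then Ident C (As ! i) else \<zero>\<^bsub>Hom C (As ! j) (As ! i)\<^esub>)) \<and>
    (\<Oplus>\<^bsub>Hom C S S\<^esub>i\<in>{..<length As}. \<iota> i \<cdot>\<^bsub>C\<^esub> \<pi> i) = Ident C S"

text \<open>Reversing the arrows keeps direct sums and exchanges their inclusions with their projections. So
  each statement about arrows out of a direct sum, or about precovers, has a dual.\<close>

definition opposite :: "('k, 'o, 'm, 'y) lincat_scheme \<Rightarrow> ('k, 'o, 'm) lincat" where
  "opposite C = \<lparr>Obj = Obj C, Hom = (\<lambda>A B. Hom C B A), Ident = Ident C, Comp = (\<lambda>g f. f \<cdot>\<^bsub>C\<^esub> g)\<rparr>"

lemma opposite_simps [simp]:
  "Obj (opposite C) = Obj C" "Hom (opposite C) A B = Hom C B A" "Ident (opposite C) = Ident C"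
  "Comp (opposite C) g f = Comp C f g"
  by (simp_all add: opposite_def)

lemma sum_maps_opposite: "sum_maps (opposite C) As S \<iota> \<pi> \<longleftrightarrow> sum_maps C As S \<pi> \<iota>"
proof -
  have swap: "(\<forall>i<n. \<forall>j<n. P i j) \<longleftrightarrow> (\<forall>i<n. \<forall>j<n. P j i)" for n :: nat and P
    by blast
  have "(\<forall>i<length As. \<forall>j<length As. \<iota> j \<cdot>\<^bsub>C\<^esub> \<pi> i =
        (if i = j then Ident C (As ! i) else \<zero>\<^bsub>Hom C (As ! i) (As ! j)\<^esub>)) \<longleftrightarrow>
      (\<forall>i<length As. \<forall>j<length As. \<iota> i \<cdot>\<^bsub>C\<^esub> \<pi> j =
        (if i = j then Ident C (As ! i) else \<zero>\<^bsub>Hom C (As ! j) (As ! i)\<^esub>))"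
    by (subst swap) (simp cong: if_cong add: eq_commute)
  then show ?thesis
    unfolding sum_maps_def opposite_simps by (simp only: conj_commute)
qed

context linear_category
begin

lemma linear_category_opposite: "linear_category k (opposite C)"
proof (intro linear_category.intro k.field_axioms linear_category_axioms.intro, goal_cases)
  case (1 A B) then show ?case using hom_module by simp
next
  case (2 A) then show ?case using ident_closed by simp
next
  case (3 A B D f g) then show ?case using comp_closed[of D B A] by simp
next
  case (4 A B f) then show ?case using ident_right[of B A] by simp
next
  case (5 A B f) then show ?case using ident_left[of B A] by simp
next
  case (6 A B D F f g h) then show ?case using comp_assoc[of F D B A] by simp
next
  case (7 A B D f g g') then show ?case using comp_add_right[of D B A] by simp
next
  case (8 A B D f f' g) then show ?case using comp_add_left[of D B A] by simp
next
  case (9 A B D f g c) then show ?case using comp_smult_right[of D B A] by simp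
next
  case (10 A B D f g c) then show ?case using comp_smult_left[of D B A] by simp
qed

lemma hom_abelian_group: "\<lbrakk>A \<in> Obj C; B \<in> Obj C\<rbrakk> \<Longrightarrow> abelian_group (Hom C A B)"
  using hom_module by (rule Module.module.axioms(2))

lemma zero_closed: "\<lbrakk>A \<in> Obj C; B \<in> Obj C\<rbrakk> \<Longrightarrow> \<zero>\<^bsub>Hom C A B\<^esub> \<in> arrows C A B"
  by (meson hom_abelian_group abelian_groupE(2))

lemma smult_arrow_closed:
  "\<lbrakk>A \<in> Obj C; B \<in> Obj C; c \<in> carrier k; f \<in> arrows C A B\<rbrakk> \<Longrightarrow> c \<odot>\<^bsub>Hom C A B\<^esub> f \<in> arrows C A B"
  by (rule Module.module.smult_closed[OF hom_module])

lemma comp_zero_left: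
  assumes "A \<in> Obj C" "B \<in> Obj C" "D \<in> Obj C" "f \<in> arrows C A B"
  shows "\<zero>\<^bsub>Hom C B D\<^esub> \<cdot> f = \<zero>\<^bsub>Hom C A D\<^esub>"
proof -
  interpret BD: Module.module k "Hom C B D" by (rule hom_module) fact+
  interpret AD: Module.module k "Hom C A D" by (rule hom_module) fact+
  have "\<zero>\<^bsub>Hom C B D\<^esub> \<cdot> f = (\<zero>\<^bsub>k\<^esub> \<odot>\<^bsub>Hom C B D\<^esub> \<zero>\<^bsub>Hom C B D\<^esub>) \<cdot> f" by simp
  also have "\<dots> = \<zero>\<^bsub>k\<^esub> \<odot>\<^bsub>Hom C A D\<^esub> (\<zero>\<^bsub>Hom C B D\<^esub> \<cdot> f)"
    by (rule comp_smult_left) (use assms in auto)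
  also have "\<dots> = \<zero>\<^bsub>Hom C A D\<^esub>"
    by (rule AD.smult_l_null) (use assms comp_closed in auto)
  finally show ?thesis .
qed

lemma comp_zero_right:
  assumes "A \<in> Obj C" "B \<in> Obj C" "D \<in> Obj C" "g \<in> arrows C B D"
  shows "g \<cdot> \<zero>\<^bsub>Hom C A B\<^esub> = \<zero>\<^bsub>Hom C A D\<^esub>"
  using linear_category.comp_zero_left[OF linear_category_opposite, of D B A g] assms by simp

lemma finsum_arrows_closed:
  assumes "A \<in> Obj C" "B \<in> Obj C" "\<And>j. j \<in> J \<Longrightarrow> f j \<in> arrows C A B"
  shows "finsum (Hom C A B) f J \<in> arrows C A B"
proof -
  interpret AB: abelian_group "Hom C A B" by (rule hom_abelian_group) fact+
  show ?thesis using assms by (intro AB.finsum_closed) auto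
qed

lemma comp_finsum_left:
  assumes obj: "A \<in> Obj C" "B \<in> Obj C" "D \<in> Obj C" and f: "f \<in> arrows C A B"
    and "finite J" and g: "\<And>j. j \<in> J \<Longrightarrow> g j \<in> arrows C B D"
  shows "finsum (Hom C B D) g J \<cdot> f = finsum (Hom C A D) (\<lambda>j. g j \<cdot> f) J"
  using \<open>finite J\<close> g
proof (induction J)
  case empty
  interpret BD: abelian_group "Hom C B D" by (rule hom_abelian_group) fact+
  interpret AD: abelian_group "Hom C A D" by (rule hom_abelian_group) fact+
  show ?case using comp_zero_left obj f by simp
next
  case (insert j J)
  interpret BD: abelian_group "Hom C B D" by (rule hom_abelian_group) fact+
  interpret AD: abelian_group "Hom C A D" by (rule hom_abelian_group) fact+
  have fs: "finsum (Hom C B D) g J \<in> arrows C B D" using insert by (intro BD.finsum_closed) auto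
  have gf: "\<And>j'. j' \<in> insert j J \<Longrightarrow> g j' \<cdot> f \<in> arrows C A D"
    using insert.prems obj f comp_closed by blast
  have "finsum (Hom C B D) g (insert j J) = g j \<oplus>\<^bsub>Hom C B D\<^esub> finsum (Hom C B D) g J"
    using insert by (intro BD.finsum_insert) auto
  moreover have "finsum (Hom C A D) (\<lambda>j. g j \<cdot> f) (insert j J)
      = g j \<cdot> f \<oplus>\<^bsub>Hom C A D\<^esub> finsum (Hom C A D) (\<lambda>j. g j \<cdot> f) J"
    using insert gf by (intro AD.finsum_insert) auto
  ultimately show ?case
    using insert comp_add_left[OF obj f _ fs, of "g j"] by simp
qed

lemma comp_finsum_right:
  assumes "A \<in> Obj C" "B \<in> Obj C" "D \<in> Obj C" "g \<in> arrows C B D"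
    and "finite J" "\<And>j. j \<in> J \<Longrightarrow> f j \<in> arrows C A B"
  shows "g \<cdot> finsum (Hom C A B) f J = finsum (Hom C A D) (\<lambda>j. g \<cdot> f j) J"
  using linear_category.comp_finsum_left[OF linear_category_opposite, of D B A g J f] assms by simp

lemma finsum_arrows_nonzero:
  assumes "A \<in> Obj C" "B \<in> Obj C" "finsum (Hom C A B) f J \<noteq> \<zero>\<^bsub>Hom C A B\<^esub>"
  obtains j where "j \<in> J" "f j \<noteq> \<zero>\<^bsub>Hom C A B\<^esub>"
proof -
  interpret AB: abelian_group "Hom C A B" by (rule hom_abelian_group) fact+
  have "finsum (Hom C A B) f J = finsum (Hom C A B) (\<lambda>j. \<zero>\<^bsub>Hom C A B\<^esub>) J"
    if "\<And>j. j \<in> J \<Longrightarrow> f j = \<zero>\<^bsub>Hom C A B\<^esub>"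
    by (rule AB.finsum_cong') (use that in auto)
  then show ?thesis using assms that by (metis AB.finsum_zero)
qed

lemma zero_moduleD: "zero_module (Hom C A B) \<Longrightarrow> f \<in> arrows C A B \<Longrightarrow> f = \<zero>\<^bsub>Hom C A B\<^esub>"
  by (auto simp: zero_module_def)

lemma zero_moduleI:
  "\<lbrakk>A \<in> Obj C; B \<in> Obj C; \<And>f. f \<in> arrows C A B \<Longrightarrow> f = \<zero>\<^bsub>Hom C A B\<^esub>\<rbrakk> \<Longrightarrow> zero_module (Hom C A B)"
  using zero_closed by (auto simp: zero_module_def)

lemma zero_object_iff_ident:
  assumes A: "A \<in> Obj C"
  shows "zero_object C A \<longleftrightarrow> Ident C A = \<zero>\<^bsub>Hom C A A\<^esub>"
proof
  assume "zero_object C A"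
  then show "Ident C A = \<zero>\<^bsub>Hom C A A\<^esub>"
    using A ident_closed by (auto simp: zero_object_def intro: zero_moduleD)
next
  assume *: "Ident C A = \<zero>\<^bsub>Hom C A A\<^esub>"
  show "zero_object C A"
    unfolding zero_object_def
  proof (intro conjI ballI zero_moduleI)
    fix B f assume B: "B \<in> Obj C" and f: "f \<in> arrows C A B"
    show "f = \<zero>\<^bsub>Hom C A B\<^esub>"
      using ident_right[OF A B f] comp_zero_right[OF A A B f] * by simp
  next
    fix B f assume B: "B \<in> Obj C" and f: "f \<in> arrows C B A"
    show "f = \<zero>\<^bsub>Hom C B A\<^esub>"
      using ident_left[OF B A f] comp_zero_left[OF B A A f] * by simp
  qed (use A in auto)
qed

lemma direct_sum_iff_sum_maps: "direct_sum C As S \<longleftrightarrow> (\<exists>\<iota> \<pi>. sum_maps C As S \<iota> \<pi>)"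
  unfolding direct_sum_def sum_maps_def by blast

lemma sum_mapsD:
  assumes "sum_maps C As S \<iota> \<pi>"
  shows "S \<in> Obj C"
    and "i < length As \<Longrightarrow> As ! i \<in> Obj C"
    and "i < length As \<Longrightarrow> \<iota> i \<in> arrows C (As ! i) S"
    and "i < length As \<Longrightarrow> \<pi> i \<in> arrows C S (As ! i)"
    and "i < length As \<Longrightarrow> \<pi> i \<cdot> \<iota> i = Ident C (As ! i)"
    and "i < length As \<Longrightarrow> j < length As \<Longrightarrow> i \<noteq> j \<Longrightarrow>
      \<pi> i \<cdot> \<iota> j = \<zero>\<^bsub>Hom C (As ! j) (As ! i)\<^esub>"
    and "Ident C S = (\<Oplus>\<^bsub>Hom C S S\<^esub>i\<in>{..<length As}. \<iota> i \<cdot> \<pi> i)"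
  using assms unfolding sum_maps_def by auto

lemma sum_maps_comp:
  assumes s: "sum_maps C As S \<iota> \<pi>" and i: "i < length As"
  shows "\<iota> i \<cdot> \<pi> i \<in> arrows C S S"
  by (rule comp_closed[OF sum_mapsD(1)[OF s] sum_mapsD(2)[OF s i] sum_mapsD(1)[OF s]
    sum_mapsD(4,3)[OF s i]])

lemma arrow_from_sum:
  assumes s: "sum_maps C As S \<iota> \<pi>" and B: "B \<in> Obj C" and f: "f \<in> arrows C S B"
  shows "f = (\<Oplus>\<^bsub>Hom C S B\<^esub>i\<in>{..<length As}. (f \<cdot> \<iota> i) \<cdot> \<pi> i)"
proof -
  note S = sum_mapsD(1)[OF s]
  interpret SB: abelian_group "Hom C S B" by (rule hom_abelian_group) fact+
  have "f = f \<cdot> Ident C S" using ident_right[OF S B f] by simp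
  also have "\<dots> = (\<Oplus>\<^bsub>Hom C S B\<^esub>i\<in>{..<length As}. f \<cdot> (\<iota> i \<cdot> \<pi> i))"
    unfolding sum_mapsD(7)[OF s]
    by (rule comp_finsum_right) (use S B f sum_maps_comp[OF s] in auto)
  also have "\<dots> = (\<Oplus>\<^bsub>Hom C S B\<^esub>i\<in>{..<length As}. (f \<cdot> \<iota> i) \<cdot> \<pi> i)"
  proof (rule SB.finsum_cong')
    fix i assume "i \<in> {..<length As}"
    then have i: "i < length As" by simp
    show "f \<cdot> (\<iota> i \<cdot> \<pi> i) = (f \<cdot> \<iota> i) \<cdot> \<pi> i"
      using comp_assoc[OF S sum_mapsD(2)[OF s i] S B sum_mapsD(4,3)[OF s i] f] by simp
  next
    show "(\<lambda>i. (f \<cdot> \<iota> i) \<cdot> \<pi> i) \<in> {..<length As} \<rightarrow> arrows C S B"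
      using comp_closed[OF S sum_mapsD(2)[OF s] B sum_mapsD(4)[OF s]
          comp_closed[OF sum_mapsD(2)[OF s] S B sum_mapsD(3)[OF s] f]] by auto
  qed auto
  finally show ?thesis .
qed

lemma arrow_to_sum:
  assumes "sum_maps C As S \<iota> \<pi>" "B \<in> Obj C" "f \<in> arrows C B S"
  shows "f = (\<Oplus>\<^bsub>Hom C B S\<^esub>i\<in>{..<length As}. \<iota> i \<cdot> (\<pi> i \<cdot> f))"
  using linear_category.arrow_from_sum[OF linear_category_opposite, of As S \<pi> \<iota> B f] assms
  by (simp add: sum_maps_opposite)

lemma iso_arrowsE:
  assumes "u \<in> iso_arrows C A B"
  obtains v where "u \<in> arrows C A B" "v \<in> arrows C B A" "v \<cdot> u = Ident C A" "u \<cdot> v = Ident C B"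
  using assms by (auto simp: iso_arrows_def)

lemma ident_iso: "A \<in> Obj C \<Longrightarrow> Ident C A \<in> iso_arrows C A A"
  using ident_closed ident_left unfolding iso_arrows_def by auto

lemma isomorphic_sym: "isomorphic C A B \<Longrightarrow> isomorphic C B A"
  unfolding isomorphic_def iso_arrows_def by blast

lemma comp_cancel_middle:
  assumes obj: "A \<in> Obj C" "B \<in> Obj C" "D \<in> Obj C" "B' \<in> Obj C"
    and "f \<in> arrows C A B" "u \<in> arrows C B B'" "v \<in> arrows C B' B" "g \<in> arrows C B D"
    and "v \<cdot> u = Ident C B"
  shows "(g \<cdot> v) \<cdot> (u \<cdot> f) = g \<cdot> f"
proof -
  have "(g \<cdot> v) \<cdot> (u \<cdot> f) = g \<cdot> (v \<cdot> (u \<cdot> f))"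
    using assms comp_closed[of A B B' f u] by (intro comp_assoc[of A B' B D]) auto
  also have "v \<cdot> (u \<cdot> f) = (v \<cdot> u) \<cdot> f"
    using assms by (intro comp_assoc[symmetric, of A B B' B]) auto
  finally show ?thesis using assms ident_left[of A B f] by simp
qed

lemma direct_sum_iso_components:
  assumes sum: "direct_sum C As S" and len: "length Bs = length As" and Bs: "set Bs \<subseteq> Obj C"
    and iso: "\<And>i. i < length As \<Longrightarrow> isomorphic C (As ! i) (Bs ! i)"
  shows "direct_sum C Bs S"
proof -
  obtain \<iota> \<pi> where s: "sum_maps C As S \<iota> \<pi>" using sum direct_sum_iff_sum_maps by blast
  note S = sum_mapsD(1)[OF s] and A = sum_mapsD(2)[OF s]
    and \<iota> = sum_mapsD(3)[OF s] and \<pi> = sum_mapsD(4)[OF s]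
  have B: "Bs ! i \<in> Obj C" if "i < length As" for i using Bs len that by (metis nth_mem subsetD)
  have "\<exists>u v. u \<in> arrows C (As ! i) (Bs ! i) \<and> v \<in> arrows C (Bs ! i) (As ! i) \<and>
      v \<cdot> u = Ident C (As ! i) \<and> u \<cdot> v = Ident C (Bs ! i)" if "i < length As" for i
    using iso[OF that] unfolding isomorphic_def iso_arrows_def by blast
  then obtain u v where u: "\<And>i. i < length As \<Longrightarrow> u i \<in> arrows C (As ! i) (Bs ! i)"
    and v: "\<And>i. i < length As \<Longrightarrow> v i \<in> arrows C (Bs ! i) (As ! i)"
    and vu: "\<And>i. i < length As \<Longrightarrow> v i \<cdot> u i = Ident C (As ! i)"
    and uv: "\<And>i. i < length As \<Longrightarrow> u i \<cdot> v i = Ident C (Bs ! i)"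
    by metis
  have "sum_maps C Bs S (\<lambda>i. \<iota> i \<cdot> v i) (\<lambda>i. u i \<cdot> \<pi> i)"
    unfolding sum_maps_def len
  proof (intro conjI allI impI)
    fix i assume i: "i < length As"
    show "\<iota> i \<cdot> v i \<in> arrows C (Bs ! i) S" by (rule comp_closed[OF B[OF i] A[OF i] S v[OF i] \<iota>[OF i]])
    show "u i \<cdot> \<pi> i \<in> arrows C S (Bs ! i)" by (rule comp_closed[OF S A[OF i] B[OF i] \<pi>[OF i] u[OF i]])
    fix j assume j: "j < length As"
    have \<iota>v: "\<iota> j \<cdot> v j \<in> arrows C (Bs ! j) S" by (rule comp_closed[OF B[OF j] A[OF j] S v[OF j] \<iota>[OF j]])
    have "(u i \<cdot> \<pi> i) \<cdot> (\<iota> j \<cdot> v j) = u i \<cdot> (\<pi> i \<cdot> (\<iota> j \<cdot> v j))"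
      by (rule comp_assoc[OF B[OF j] S A[OF i] B[OF i] \<iota>v \<pi>[OF i] u[OF i]])
    also have "\<pi> i \<cdot> (\<iota> j \<cdot> v j) = (\<pi> i \<cdot> \<iota> j) \<cdot> v j"
      by (rule comp_assoc[OF B[OF j] A[OF j] S A[OF i] v[OF j] \<iota>[OF j] \<pi>[OF i], symmetric])
    finally show "(u i \<cdot> \<pi> i) \<cdot> (\<iota> j \<cdot> v j) =
        (if i = j then Ident C (Bs ! i) else \<zero>\<^bsub>Hom C (Bs ! j) (Bs ! i)\<^esub>)"
      using sum_mapsD(5)[OF s i] sum_mapsD(6)[OF s i j] uv[OF i] ident_left[OF B[OF i] A[OF i] v[OF i]]
        comp_zero_left[OF B[OF j] A[OF j] A[OF i] v[OF j]]
        comp_zero_right[OF B[OF j] A[OF i] B[OF i] u[OF i]] by auto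
  next
    interpret SS: abelian_group "Hom C S S" by (rule hom_abelian_group) fact+
    have "(\<Oplus>\<^bsub>Hom C S S\<^esub>i\<in>{..<length As}. (\<iota> i \<cdot> v i) \<cdot> (u i \<cdot> \<pi> i)) =
        (\<Oplus>\<^bsub>Hom C S S\<^esub>i\<in>{..<length As}. \<iota> i \<cdot> \<pi> i)"
    proof (rule SS.finsum_cong')
      fix i assume "i \<in> {..<length As}"
      then have i: "i < length As" by simp
      show "(\<iota> i \<cdot> v i) \<cdot> (u i \<cdot> \<pi> i) = \<iota> i \<cdot> \<pi> i"
        by (rule comp_cancel_middle[OF S A[OF i] S B[OF i] \<pi>[OF i] u[OF i] v[OF i] \<iota>[OF i] vu[OF i]])
    qed (use comp_closed[OF S A S \<pi> \<iota>] in auto)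
    then show "(\<Oplus>\<^bsub>Hom C S S\<^esub>i\<in>{..<length As}. (\<iota> i \<cdot> v i) \<cdot> (u i \<cdot> \<pi> i)) = Ident C S"
      using sum_mapsD(7)[OF s] by simp
  qed (use Bs S in auto)
  then show ?thesis using direct_sum_iff_sum_maps by blast
qed

lemma direct_sum_self_zero:
  assumes A: "A \<in> Obj C" and N: "zero_object C N"
  shows "direct_sum C [A, N] A"
proof -
  have N': "N \<in> Obj C" and idN: "Ident C N = \<zero>\<^bsub>Hom C N N\<^esub>"
    using N zero_object_iff_ident by (auto simp: zero_object_def)
  interpret AA: abelian_group "Hom C A A" by (rule hom_abelian_group) fact+
  define \<iota> where "\<iota> = (\<lambda>i::nat. if i = 0 then Ident C A else \<zero>\<^bsub>Hom C N A\<^esub>)"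
  define \<pi> where "\<pi> = (\<lambda>i::nat. if i = 0 then Ident C A else \<zero>\<^bsub>Hom C A N\<^esub>)"
  have z: "\<zero>\<^bsub>Hom C N A\<^esub> \<in> arrows C N A" "\<zero>\<^bsub>Hom C A N\<^esub> \<in> arrows C A N" "Ident C A \<in> arrows C A A"
    using A N' zero_closed ident_closed by auto
  have two: "{..<length [A, N]} = {0, Suc 0}" by auto
  have "sum_maps C [A, N] A \<iota> \<pi>"
    unfolding sum_maps_def
  proof (intro conjI allI impI)
    fix i j assume i: "i < length [A, N]" and j: "j < length [A, N]"
    show "\<pi> i \<cdot> \<iota> j = (if i = j then Ident C ([A, N] ! i) else \<zero>\<^bsub>Hom C ([A, N] ! j) ([A, N] ! i)\<^esub>)"
      using i j z A N' idN by (auto simp: \<pi>_def \<iota>_def less_Suc_eq ident_left[OF A A] ident_left[OF N' A]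
        ident_right[OF A N'] comp_zero_right)
  next
    show "(\<Oplus>\<^bsub>Hom C A A\<^esub>i\<in>{..<length [A, N]}. \<iota> i \<cdot> \<pi> i) = Ident C A"
      unfolding two using z A N' by (simp add: \<iota>_def \<pi>_def ident_left[OF A A] comp_zero_right)
  qed (use z A N' in \<open>auto simp: \<iota>_def \<pi>_def less_Suc_eq\<close>)
  then show ?thesis using direct_sum_iff_sum_maps by blast
qed

lemma direct_sum_self: assumes A: "A \<in> Obj C" shows "direct_sum C [A] A"
proof -
  interpret AA: abelian_group "Hom C A A" by (rule hom_abelian_group) fact+
  have one: "{..<length [A]} = {0}" by auto
  have "sum_maps C [A] A (\<lambda>_. Ident C A) (\<lambda>_. Ident C A)"
    unfolding sum_maps_def one
    using A ident_closed[OF A] ident_left[OF A A ident_closed[OF A]] by simp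
  then show ?thesis using direct_sum_iff_sum_maps by blast
qed

lemma zero_object_empty_sum:
  assumes "direct_sum C [] N" shows "zero_object C N"
proof -
  obtain \<iota> \<pi> where s: "sum_maps C [] N \<iota> \<pi>" using assms direct_sum_iff_sum_maps by blast
  interpret NN: abelian_group "Hom C N N" using sum_mapsD(1)[OF s] hom_abelian_group by blast
  show ?thesis using sum_mapsD(7)[OF s] sum_mapsD(1)[OF s] zero_object_iff_ident by simp
qed

text \<open>The two idempotents of a decomposition add up to the identity, so one of them is invertible. It
  annihilates the inclusion of the other summand, which is therefore zero.\<close>

lemma local_endomorphism_ring_indecomposable:
  assumes A: "A \<in> Obj C" and loc: "local_endomorphism_ring C A"
  shows "indecomposable C A"
  unfolding indecomposable_def
proof (intro conjI allI impI)
  show "\<not> zero_object C A"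
    using loc A zero_object_iff_ident by (auto simp: local_endomorphism_ring_def)
next
  fix B D assume "direct_sum C [B, D] A"
  then obtain \<iota> \<pi> where s: "sum_maps C [B, D] A \<iota> \<pi>" using direct_sum_iff_sum_maps by blast
  have B: "B \<in> Obj C" and D: "D \<in> Obj C" using sum_mapsD(2)[OF s, of 0] sum_mapsD(2)[OF s, of 1] by auto
  interpret AA: abelian_group "Hom C A A" by (rule hom_abelian_group) fact+
  have zero: "zero_object C Q" if P: "P \<in> Obj C" "Q \<in> Obj C"
    and i: "i \<in> arrows C P A" "p \<in> arrows C A P" "i' \<in> arrows C Q A" "p' \<in> arrows C A Q"
    and z: "p \<cdot> i' = \<zero>\<^bsub>Hom C Q P\<^esub>" and id: "p' \<cdot> i' = Ident C Q"
    and iso: "i \<cdot> p \<in> iso_arrows C A A" for P Q i p i' p'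
  proof -
    obtain w where w: "w \<in> arrows C A A" "w \<cdot> (i \<cdot> p) = Ident C A"
      using iso by (auto elim: iso_arrowsE)
    have "i' = (w \<cdot> (i \<cdot> p)) \<cdot> i'" using w ident_left P A i by simp
    also have "\<dots> = w \<cdot> (i \<cdot> (p \<cdot> i'))"
      using comp_assoc[OF P(2) A A A i(3) comp_closed[OF A P(1) A i(2,1)] w(1)]
        comp_assoc[OF P(2) A P(1) A i(3,2,1)] by simp
    also have "\<dots> = \<zero>\<^bsub>Hom C Q A\<^esub>"
      unfolding z using comp_zero_right P A w i by simp
    finally show ?thesis using id comp_zero_right[OF P(2) A P(2) i(4)] zero_object_iff_ident[OF P(2)] by simp
  qed
  have two: "{..<length [B, D]} = {0, Suc 0}" by auto
  have arr: "\<iota> 0 \<in> arrows C B A" "\<pi> 0 \<in> arrows C A B" "\<iota> 1 \<in> arrows C D A" "\<pi> 1 \<in> arrows C A D"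
    using sum_mapsD(3,4)[OF s, of 0] sum_mapsD(3,4)[OF s, of 1] by auto
  have e: "\<iota> 0 \<cdot> \<pi> 0 \<in> arrows C A A" "\<iota> 1 \<cdot> \<pi> 1 \<in> arrows C A A"
    using comp_closed arr A B D by auto
  have "Ident C A = \<iota> 0 \<cdot> \<pi> 0 \<oplus>\<^bsub>Hom C A A\<^esub> \<iota> 1 \<cdot> \<pi> 1"
    using sum_mapsD(7)[OF s] e unfolding two by simp
  then have "\<iota> 0 \<cdot> \<pi> 0 \<in> iso_arrows C A A \<or> \<iota> 1 \<cdot> \<pi> 1 \<in> iso_arrows C A A"
    using loc ident_iso[OF A] e unfolding local_endomorphism_ring_def by metis
  then show "zero_object C B \<or> zero_object C D"
    using zero[OF B D arr] zero[OF D B arr(3,4,1,2)] sum_mapsD(5,6)[OF s] 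
    by (metis One_nat_def length_Cons less_Suc_eq list.size(3) nth_Cons_0 nth_Cons_Suc zero_neq_one zero_less_Suc)
qed (use A in auto)

text \<open>Together with the next lemma, this is the universal property of the direct sum as a coproduct.\<close>

lemma copairing:
  assumes s: "sum_maps C As S \<iota> \<pi>" and T: "T \<in> Obj C"
    and f: "\<And>i. i < length As \<Longrightarrow> f i \<in> arrows C (As ! i) T"
  obtains g where "g \<in> arrows C S T" "\<And>i. i < length As \<Longrightarrow> g \<cdot> \<iota> i = f i"
proof
  note S = sum_mapsD(1)[OF s] and A = sum_mapsD(2)[OF s]
    and \<iota> = sum_mapsD(3)[OF s] and \<pi> = sum_mapsD(4)[OF s]
  have fp: "f i \<cdot> \<pi> i \<in> arrows C S T" if "i < length As" for i
    by (rule comp_closed[OF S A[OF that] T \<pi>[OF that] f[OF that]])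
  then show "(\<Oplus>\<^bsub>Hom C S T\<^esub>i\<in>{..<length As}. f i \<cdot> \<pi> i) \<in> arrows C S T"
    by (intro finsum_arrows_closed) (use S T in auto)
  fix j assume j: "j < length As"
  interpret JT: abelian_group "Hom C (As ! j) T" by (rule hom_abelian_group[OF A[OF j] T])
  have "(\<Oplus>\<^bsub>Hom C S T\<^esub>i\<in>{..<length As}. f i \<cdot> \<pi> i) \<cdot> \<iota> j
      = (\<Oplus>\<^bsub>Hom C (As ! j) T\<^esub>i\<in>{..<length As}. (f i \<cdot> \<pi> i) \<cdot> \<iota> j)"
    by (rule comp_finsum_left) (use S T fp A[OF j] \<iota>[OF j] in auto)
  also have "\<dots> = (\<Oplus>\<^bsub>Hom C (As ! j) T\<^esub>i\<in>{..<length As}.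
      if j = i then f i else \<zero>\<^bsub>Hom C (As ! j) T\<^esub>)"
  proof (rule JT.finsum_cong')
    fix i assume "i \<in> {..<length As}"
    then have i: "i < length As" by simp
    have "(f i \<cdot> \<pi> i) \<cdot> \<iota> j = f i \<cdot> (\<pi> i \<cdot> \<iota> j)"
      by (rule comp_assoc[OF A[OF j] S A[OF i] T \<iota>[OF j] \<pi>[OF i] f[OF i]])
    also have "\<dots> = (if j = i then f i else \<zero>\<^bsub>Hom C (As ! j) T\<^esub>)"
      using sum_mapsD(5)[OF s i] sum_mapsD(6)[OF s i j] ident_right[OF A[OF i] T f[OF i]]
        comp_zero_right[OF A[OF j] A[OF i] T f[OF i]] by auto
    finally show "(f i \<cdot> \<pi> i) \<cdot> \<iota> j = (if j = i then f i else \<zero>\<^bsub>Hom C (As ! j) T\<^esub>)" .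
  next
    show "(\<lambda>i. if j = i then f i else \<zero>\<^bsub>Hom C (As ! j) T\<^esub>) \<in> {..<length As} \<rightarrow> arrows C (As ! j) T"
      using f j by auto
  qed simp
  also have "\<dots> = (\<Oplus>\<^bsub>Hom C (As ! j) T\<^esub>i\<in>{..<length As}.
      if j = i then f j else \<zero>\<^bsub>Hom C (As ! j) T\<^esub>)"
    by (rule arg_cong2[where f = "finsum (Hom C (As ! j) T)"]) auto
  also have "\<dots> = f j"
    using JT.finsum_singleton[of j "{..<length As}" "\<lambda>_. f j"] j f[OF j] by auto
  finally show "(\<Oplus>\<^bsub>Hom C S T\<^esub>i\<in>{..<length As}. f i \<cdot> \<pi> i) \<cdot> \<iota> j = f j" .
qed

lemma arrow_from_sum_eqI:
  assumes s: "sum_maps C As S \<iota> \<pi>" and T: "T \<in> Obj C"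
    and f: "f \<in> arrows C S T" and g: "g \<in> arrows C S T"
    and eq: "\<And>i. i < length As \<Longrightarrow> f \<cdot> \<iota> i = g \<cdot> \<iota> i"
  shows "f = g"
proof -
  note S = sum_mapsD(1)[OF s] and A = sum_mapsD(2)[OF s]
  interpret ST: abelian_group "Hom C S T" by (rule hom_abelian_group[OF S T])
  have "(\<Oplus>\<^bsub>Hom C S T\<^esub>i\<in>{..<length As}. (f \<cdot> \<iota> i) \<cdot> \<pi> i)
      = (\<Oplus>\<^bsub>Hom C S T\<^esub>i\<in>{..<length As}. (g \<cdot> \<iota> i) \<cdot> \<pi> i)"
  proof (rule ST.finsum_cong')
    show "(\<lambda>i. (g \<cdot> \<iota> i) \<cdot> \<pi> i) \<in> {..<length As} \<rightarrow> arrows C S T"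
      using comp_closed[OF S A T sum_mapsD(4)[OF s] comp_closed[OF A S T sum_mapsD(3)[OF s] g]] by auto
  qed (use eq in auto)
  then show ?thesis
    using arrow_from_sum[OF s T f] arrow_from_sum[OF s T g] by simp
qed

text \<open>Expanding the identity of the middle object reduces a nonzero composite through an object of an
  additive closure to one through an indecomposable object.\<close>

lemma nonzero_through_sum:
  assumes s: "sum_maps C As S \<iota> \<pi>" and A: "A \<in> Obj C" and B: "B \<in> Obj C"
    and f: "f \<in> arrows C A S" and g: "g \<in> arrows C S B" and nz: "g \<cdot> f \<noteq> \<zero>\<^bsub>Hom C A B\<^esub>"
  obtains i where "i < length As" "(g \<cdot> \<iota> i) \<cdot> (\<pi> i \<cdot> f) \<noteq> \<zero>\<^bsub>Hom C A B\<^esub>"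
proof -
  note S = sum_mapsD(1)[OF s] and As = sum_mapsD(2)[OF s]
    and \<iota> = sum_mapsD(3)[OF s] and \<pi> = sum_mapsD(4)[OF s]
  have c: "\<iota> i \<cdot> (\<pi> i \<cdot> f) \<in> arrows C A S" if "i < length As" for i
    by (rule comp_closed[OF A As[OF that] S comp_closed[OF A S As[OF that] f \<pi>[OF that]] \<iota>[OF that]])
  have "g \<cdot> f = g \<cdot> (\<Oplus>\<^bsub>Hom C A S\<^esub>i\<in>{..<length As}. \<iota> i \<cdot> (\<pi> i \<cdot> f))"
    using arrow_to_sum[OF s A f] by simp
  also have "\<dots> = (\<Oplus>\<^bsub>Hom C A B\<^esub>i\<in>{..<length As}. g \<cdot> (\<iota> i \<cdot> (\<pi> i \<cdot> f)))"
    by (rule comp_finsum_right) (use A S B g c in auto)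
  finally have "(\<Oplus>\<^bsub>Hom C A B\<^esub>i\<in>{..<length As}. g \<cdot> (\<iota> i \<cdot> (\<pi> i \<cdot> f))) \<noteq> \<zero>\<^bsub>Hom C A B\<^esub>"
    using nz by simp
  then obtain i where i: "i < length As" "g \<cdot> (\<iota> i \<cdot> (\<pi> i \<cdot> f)) \<noteq> \<zero>\<^bsub>Hom C A B\<^esub>"
    by (rule finsum_arrows_nonzero[OF A B]) simp
  have "(g \<cdot> \<iota> i) \<cdot> (\<pi> i \<cdot> f) = g \<cdot> (\<iota> i \<cdot> (\<pi> i \<cdot> f))"
    by (rule comp_assoc[OF A As[OF i(1)] S B comp_closed[OF A S As[OF i(1)] f \<pi>[OF i(1)]] \<iota>[OF i(1)] g])
  then show ?thesis using that i by metis
qed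

lemma zero_hom_from_sum_iff:
  assumes sum: "direct_sum C As S" and B: "B \<in> Obj C"
  shows "zero_module (Hom C S B) \<longleftrightarrow> (\<forall>A\<in>set As. zero_module (Hom C A B))"
proof -
  obtain \<iota> \<pi> where s: "sum_maps C As S \<iota> \<pi>" using sum direct_sum_iff_sum_maps by blast
  note S = sum_mapsD(1)[OF s] and A = sum_mapsD(2)[OF s]
    and \<iota> = sum_mapsD(3)[OF s] and \<pi> = sum_mapsD(4)[OF s]
  show ?thesis
  proof
    assume z: "zero_module (Hom C S B)"
    have "zero_module (Hom C (As ! i) B)" if i: "i < length As" for i
    proof (rule zero_moduleI[OF A[OF i] B])
      fix f assume f: "f \<in> arrows C (As ! i) B"
      have "f = (f \<cdot> \<pi> i) \<cdot> \<iota> i"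
        using comp_assoc[OF A[OF i] S A[OF i] B \<iota>[OF i] \<pi>[OF i] f] sum_mapsD(5)[OF s i]
          ident_right[OF A[OF i] B f] by simp
      also have "f \<cdot> \<pi> i = \<zero>\<^bsub>Hom C S B\<^esub>"
        by (rule zero_moduleD[OF z comp_closed[OF S A[OF i] B \<pi>[OF i] f]])
      finally show "f = \<zero>\<^bsub>Hom C (As ! i) B\<^esub>"
        using comp_zero_left[OF A[OF i] S B \<iota>[OF i]] by simp
    qed
    then show "\<forall>A\<in>set As. zero_module (Hom C A B)" by (auto simp: in_set_conv_nth)
  next
    assume z: "\<forall>A\<in>set As. zero_module (Hom C A B)"
    show "zero_module (Hom C S B)"
    proof (rule zero_moduleI[OF S B])
      fix f assume f: "f \<in> arrows C S B"
      show "f = \<zero>\<^bsub>Hom C S B\<^esub>"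
      proof (rule arrow_from_sum_eqI[OF s B f zero_closed[OF S B]])
        fix i assume i: "i < length As"
        then have "zero_module (Hom C (As ! i) B)" using z by auto
        then have "f \<cdot> \<iota> i = \<zero>\<^bsub>Hom C (As ! i) B\<^esub>"
          by (rule zero_moduleD[OF _ comp_closed[OF A[OF i] S B \<iota>[OF i] f]])
        then show "f \<cdot> \<iota> i = \<zero>\<^bsub>Hom C S B\<^esub> \<cdot> \<iota> i"
          using comp_zero_left[OF A[OF i] S B \<iota>[OF i]] by simp
      qed
    qed
  qed
qed

lemma zero_hom_isomorphic_source:
  assumes A: "A \<in> Obj C" and A': "A' \<in> Obj C" and B: "B \<in> Obj C" and iso: "isomorphic C A A'"
    and z: "zero_module (Hom C A B)"
  shows "zero_module (Hom C A' B)"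
proof (rule zero_moduleI[OF A' B])
  obtain u v where u: "u \<in> arrows C A A'" and v: "v \<in> arrows C A' A" and uv: "u \<cdot> v = Ident C A'"
    using iso unfolding isomorphic_def iso_arrows_def by blast
  fix f assume f: "f \<in> arrows C A' B"
  have "f = (f \<cdot> u) \<cdot> v"
    using comp_assoc[OF A' A A' B v u f] uv ident_right[OF A' B f] by simp
  also have "f \<cdot> u = \<zero>\<^bsub>Hom C A B\<^esub>" by (rule zero_moduleD[OF z comp_closed[OF A A' B u f]])
  finally show "f = \<zero>\<^bsub>Hom C A' B\<^esub>" using comp_zero_left[OF A' A B v] by simp
qed

end

section \<open>Krull--Schmidt categories with Hom spaces of dimension at most one\<close>

text \<open>In the categories below, these objects form the additive closure of \<open>E ` J\<close>. In contrast to
  \<open>add_closure\<close>, the description makes no reference to summands, and it is self-dual.\<close>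

definition finite_sums :: "('k, 'o, 'm, 'y) lincat_scheme \<Rightarrow> ('i \<Rightarrow> 'o) \<Rightarrow> 'i set \<Rightarrow> 'o set" where
  "finite_sums C E J = {A. \<exists>us. set us \<subseteq> J \<and> direct_sum C (map E us) A}"

text \<open>The objects \<open>E i\<close> represent the indecomposables, and a nonzero map between two of them is unique
  up to a scalar. The assumptions are self-dual.\<close>

locale thin_krull_schmidt_category = linear_category k C
  for k :: "('k, 'x) ring_scheme" and C :: "('k, 'o, 'm, 'y) lincat_scheme" (structure) +
  fixes I :: "'i set" and E :: "'i \<Rightarrow> 'o"
  assumes direct_sums: "set As \<subseteq> Obj C \<Longrightarrow> \<exists>S. direct_sum C As S"
    and E_obj: "i \<in> I \<Longrightarrow> E i \<in> Obj C"
    and E_nonzero: "i \<in> I \<Longrightarrow> Ident C (E i) \<noteq> \<zero>\<^bsub>Hom C (E i) (E i)\<^esub>"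
    and E_inj: "\<lbrakk>i \<in> I; j \<in> I; isomorphic C (E i) (E j)\<rbrakk> \<Longrightarrow> i = j"
    and hom_thin: "\<lbrakk>i \<in> I; j \<in> I\<rbrakk> \<Longrightarrow>
      zero_module (Hom C (E i) (E j)) \<or> one_dimensional k (Hom C (E i) (E j))"
    and decomposition: "A \<in> Obj C \<Longrightarrow> \<exists>us. set us \<subseteq> I \<and> direct_sum C (map E us) A"
begin

lemma multiple_of_nonzero:
  assumes "i \<in> I" "j \<in> I" "f \<in> arrows C (E i) (E j)" "g \<in> arrows C (E i) (E j)"
    and "f \<noteq> \<zero>\<^bsub>Hom C (E i) (E j)\<^esub>"
  obtains c where "c \<in> carrier k" "g = c \<odot>\<^bsub>Hom C (E i) (E j)\<^esub> f"
  using hom_thin[OF assms(1,2)] assms(3-) zero_moduleD unfolding one_dimensional_def by metis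

text \<open>The nonzero endomorphism \<open>h \<cdot> f\<close> is a multiple of the identity, so \<open>f\<close> has a left inverse \<open>h'\<close>.
  The endomorphism \<open>f \<cdot> h'\<close> is nonzero too and for the same reason a multiple of the identity, which
  gives a right inverse of \<open>f\<close>.\<close>

lemma E_eq_of_nonzero_loop:
  assumes i: "i \<in> I" and j: "j \<in> I"
    and f: "f \<in> arrows C (E i) (E j)" and h: "h \<in> arrows C (E j) (E i)"
    and nz: "h \<cdot> f \<noteq> \<zero>\<^bsub>Hom C (E i) (E i)\<^esub>"
  shows "i = j"
proof (rule E_inj[OF i j])
  note Ei = E_obj[OF i] and Ej = E_obj[OF j]
  have hf: "h \<cdot> f \<in> arrows C (E i) (E i)" by (rule comp_closed[OF Ei Ej Ei f h])
  obtain c where c: "c \<in> carrier k" "Ident C (E i) = c \<odot>\<^bsub>Hom C (E i) (E i)\<^esub> (h \<cdot> f)"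
    using multiple_of_nonzero[OF i i hf ident_closed[OF Ei] nz] .
  define h' where "h' = c \<odot>\<^bsub>Hom C (E j) (E i)\<^esub> h"
  have h': "h' \<in> arrows C (E j) (E i)"
    unfolding h'_def by (rule smult_arrow_closed[OF Ej Ei c(1) h])
  have h'f: "h' \<cdot> f = Ident C (E i)"
    unfolding h'_def using comp_smult_left[OF Ei Ej Ei f h c(1)] c(2) by simp
  have fh': "f \<cdot> h' \<in> arrows C (E j) (E j)" by (rule comp_closed[OF Ej Ei Ej h' f])
  have ffh: "(f \<cdot> h') \<cdot> f = f"
    using comp_assoc[OF Ei Ej Ei Ej f h' f] h'f ident_right[OF Ei Ej f] by simp
  have "f \<cdot> h' \<noteq> \<zero>\<^bsub>Hom C (E j) (E j)\<^esub>"
  proof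
    assume "f \<cdot> h' = \<zero>\<^bsub>Hom C (E j) (E j)\<^esub>"
    then have "f = \<zero>\<^bsub>Hom C (E i) (E j)\<^esub>" using ffh comp_zero_left[OF Ei Ej Ej f] by simp
    then show False using nz comp_zero_right[OF Ei Ej Ei h] by simp
  qed
  then obtain d where d: "d \<in> carrier k" "Ident C (E j) = d \<odot>\<^bsub>Hom C (E j) (E j)\<^esub> (f \<cdot> h')"
    using multiple_of_nonzero[OF j j fh' ident_closed[OF Ej]] by blast
  define f' where "f' = d \<odot>\<^bsub>Hom C (E i) (E j)\<^esub> f"
  have f': "f' \<in> arrows C (E i) (E j)"
    unfolding f'_def by (rule smult_arrow_closed[OF Ei Ej d(1) f])
  have f'h: "f' \<cdot> h' = Ident C (E j)"
    unfolding f'_def using comp_smult_left[OF Ej Ei Ej h' f d(1)] d(2) by simp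
  have "f = (f' \<cdot> h') \<cdot> f" using f'h ident_left[OF Ei Ej f] by simp
  also have "\<dots> = f'"
    using comp_assoc[OF Ei Ej Ei Ej f h' f'] h'f ident_right[OF Ei Ej f'] by simp
  finally have "f \<cdot> h' = Ident C (E j)" using f'h by simp
  then show "isomorphic C (E i) (E j)"
    unfolding isomorphic_def iso_arrows_def using f h' h'f by blast
qed

text \<open>Such a loop is nonzero through one of the summands of \<open>A\<close>, with which \<open>E i\<close> therefore coincides.\<close>

lemma member_of_nonzero_loop:
  assumes J: "J \<subseteq> I" and i: "i \<in> I" and A: "A \<in> finite_sums C E J"
    and f: "f \<in> arrows C (E i) A" and g: "g \<in> arrows C A (E i)"
    and nz: "g \<cdot> f \<noteq> \<zero>\<^bsub>Hom C (E i) (E i)\<^esub>"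
  shows "i \<in> J"
proof -
  obtain us \<iota> \<pi> where us: "set us \<subseteq> J" and s: "sum_maps C (map E us) A \<iota> \<pi>"
    using A unfolding finite_sums_def direct_sum_iff_sum_maps by blast
  note A' = sum_mapsD(1)[OF s] and Ei = E_obj[OF i]
  obtain m where m: "m < length (map E us)"
    and nz': "(g \<cdot> \<iota> m) \<cdot> (\<pi> m \<cdot> f) \<noteq> \<zero>\<^bsub>Hom C (E i) (E i)\<^esub>"
    by (rule nonzero_through_sum[OF s Ei Ei f g nz])
  have u: "us ! m \<in> J" using m us by auto
  then have ui: "us ! m \<in> I" using J by auto
  note Eu = E_obj[OF ui]
  have "\<iota> m \<in> arrows C (E (us ! m)) A" "\<pi> m \<in> arrows C A (E (us ! m))"
    using sum_mapsD(3,4)[OF s m] m by auto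
  then have "i = us ! m"
    by (intro E_eq_of_nonzero_loop[OF i ui _ _ nz'] comp_closed[OF Ei A' Eu f] comp_closed[OF Eu A' Ei _ g])
  then show ?thesis using u by simp
qed

lemma E_in_finite_sums_iff:
  assumes J: "J \<subseteq> I" and i: "i \<in> I"
  shows "E i \<in> finite_sums C E J \<longleftrightarrow> i \<in> J"
proof
  assume "i \<in> J"
  then have "set [i] \<subseteq> J \<and> direct_sum C (map E [i]) (E i)"
    using direct_sum_self[OF E_obj[OF i]] by simp
  then show "E i \<in> finite_sums C E J"
    unfolding finite_sums_def by blast
next
  note id = ident_closed[OF E_obj[OF i]]
  assume "E i \<in> finite_sums C E J"
  then show "i \<in> J"
    by (rule member_of_nonzero_loop[OF J i _ id id])
      (use E_nonzero[OF i] ident_left[OF E_obj[OF i] E_obj[OF i] id] in simp)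
qed

lemma summand_in_finite_sums:
  assumes J: "J \<subseteq> I" and A: "A \<in> finite_sums C E J" and B: "B \<in> Obj C"
    and i: "i \<in> arrows C B A" and p: "p \<in> arrows C A B" and pi: "p \<cdot> i = Ident C B"
  shows "B \<in> finite_sums C E J"
proof -
  have A': "A \<in> Obj C" using A unfolding finite_sums_def direct_sum_def by blast
  obtain vs \<iota> \<pi> where vs: "set vs \<subseteq> I" and s: "sum_maps C (map E vs) B \<iota> \<pi>"
    using decomposition[OF B] unfolding direct_sum_iff_sum_maps by blast
  have "vs ! n \<in> J" if n: "n < length vs" for n
  proof -
    have n': "n < length (map E vs)" and v: "vs ! n \<in> I" using n vs by auto
    note Ev = E_obj[OF v]
    have io: "\<iota> n \<in> arrows C (E (vs ! n)) B" and po: "\<pi> n \<in> arrows C B (E (vs ! n))"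
      using sum_mapsD(3,4)[OF s n'] n by auto
    have "(\<pi> n \<cdot> p) \<cdot> (i \<cdot> \<iota> n) = Ident C (E (vs ! n))"
      using comp_cancel_middle[OF Ev B Ev A' io i p po pi] sum_mapsD(5)[OF s n'] n by simp
    then show ?thesis
      using member_of_nonzero_loop[OF J v A comp_closed[OF Ev B A' io i] comp_closed[OF A' B Ev p po]]
        E_nonzero[OF v] by simp
  qed
  then have "set vs \<subseteq> J" by (auto simp: in_set_conv_nth)
  then show ?thesis
    using s unfolding finite_sums_def direct_sum_iff_sum_maps by blast
qed

lemma add_closure_eq_finite_sums:
  assumes J: "J \<subseteq> I"
  shows "add_closure C (E ` J) = finite_sums C E J"
proof
  show "add_closure C (E ` J) \<subseteq> finite_sums C E J"
  proof
    fix A assume "A \<in> add_closure C (E ` J)"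
    then obtain As S B where A: "A \<in> Obj C" and As: "set As \<subseteq> E ` J" "direct_sum C As S"
      and B: "direct_summand C B S" and iso: "isomorphic C A B"
      unfolding add_closure_def by blast
    have "As \<in> map E ` lists J" using As(1) lists_image[of E J] by (metis in_listsI subsetD)
    then obtain us where us: "set us \<subseteq> J" "As = map E us" by blast
    have S: "S \<in> finite_sums C E J" using us As(2) unfolding finite_sums_def by blast
    obtain D \<iota> \<pi> where s: "sum_maps C [B, D] S \<iota> \<pi>"
      using B unfolding direct_summand_def direct_sum_iff_sum_maps by blast
    have B': "B \<in> Obj C" and i: "\<iota> 0 \<in> arrows C B S" and p: "\<pi> 0 \<in> arrows C S B"
      and pi: "\<pi> 0 \<cdot> \<iota> 0 = Ident C B"
      using sum_mapsD(2-5)[OF s, of 0] by simp_all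
    note S' = sum_mapsD(1)[OF s]
    obtain u v where uv: "u \<in> arrows C A B" "v \<in> arrows C B A" "v \<cdot> u = Ident C A"
      using iso unfolding isomorphic_def iso_arrows_def by blast
    have "(v \<cdot> \<pi> 0) \<cdot> (\<iota> 0 \<cdot> u) = v \<cdot> u"
      by (rule comp_cancel_middle[OF A B' A S' uv(1) i p uv(2) pi])
    then show "A \<in> finite_sums C E J"
      using summand_in_finite_sums[OF J S A comp_closed[OF A B' S' uv(1) i] comp_closed[OF S' B' A p uv(2)]]
        uv(3) by simp
  qed
next
  show "finite_sums C E J \<subseteq> add_closure C (E ` J)"
  proof
    fix A assume "A \<in> finite_sums C E J"
    then obtain us where us: "set us \<subseteq> J" "direct_sum C (map E us) A"
      unfolding finite_sums_def by blast
    have A: "A \<in> Obj C" using us unfolding direct_sum_def by blast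
    obtain N where "direct_sum C [] N" using direct_sums[of "[]"] by auto
    then have "direct_summand C A A"
      unfolding direct_summand_def using direct_sum_self_zero[OF A] zero_object_empty_sum by blast
    moreover have "isomorphic C A A" using ident_iso[OF A] unfolding isomorphic_def by blast
    moreover have "set (map E us) \<subseteq> E ` J" using us by auto
    ultimately show "A \<in> add_closure C (E ` J)"
      using us A unfolding add_closure_def by blast
  qed
qed

text \<open>The indecomposable summands of a precover of \<open>E j\<close> form \<open>F\<close>: a nonzero map to \<open>E j\<close> lifts to
  the precover and is nonzero through one of its summands. Conversely a precover of \<open>t\<close> is assembled
  from generators of the spaces \<open>Hom (E s) (E j)\<close>, where \<open>E j\<close> is a summand of \<open>t\<close> and \<open>s\<close> runs
  through the set \<open>F\<close> that belongs to \<open>j\<close>.\<close>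

lemma precovering_finite_sums_iff:
  assumes J: "J \<subseteq> I"
  shows "precovering C (finite_sums C E J) \<longleftrightarrow>
    (\<forall>j\<in>I. \<exists>F. finite F \<and> F \<subseteq> J \<and> (\<forall>i\<in>J. \<not> zero_module (Hom C (E i) (E j)) \<longrightarrow>
      (\<exists>s\<in>F. \<exists>f\<in>arrows C (E i) (E j). f \<noteq> \<zero>\<^bsub>Hom C (E i) (E j)\<^esub> \<and>
        factors_through C (E i) (E j) (E s) f)))"
    (is "?precov \<longleftrightarrow> (\<forall>j\<in>I. ?dom j)")
proof
  assume pre: ?precov
  show "\<forall>j\<in>I. ?dom j"
  proof
    fix j assume j: "j \<in> I"
    note Ej = E_obj[OF j]
    obtain y p where y: "y \<in> finite_sums C E J" and p: "p \<in> arrows C y (E j)"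
      and univ: "\<And>y' f'. y' \<in> finite_sums C E J \<Longrightarrow> f' \<in> arrows C y' (E j) \<Longrightarrow>
        \<exists>g\<in>arrows C y' y. f' = p \<cdot> g"
      using pre Ej unfolding precovering_def by blast
    obtain us \<iota> \<pi> where us: "set us \<subseteq> J" and s: "sum_maps C (map E us) y \<iota> \<pi>"
      using y unfolding finite_sums_def direct_sum_iff_sum_maps by blast
    note Y = sum_mapsD(1)[OF s]
    show "?dom j"
    proof (intro exI[of _ "set us"] conjI ballI impI)
      fix i assume i: "i \<in> J" and nz: "\<not> zero_module (Hom C (E i) (E j))"
      have i': "i \<in> I" using i J by auto
      note Ei = E_obj[OF i']
      obtain f where f: "f \<in> arrows C (E i) (E j)" "f \<noteq> \<zero>\<^bsub>Hom C (E i) (E j)\<^esub>"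
        using nz zero_moduleI[OF Ei Ej] by blast
      have "E i \<in> finite_sums C E J" using E_in_finite_sums_iff[OF J i'] i by simp
      then obtain g where g: "g \<in> arrows C (E i) y" "f = p \<cdot> g"
        using univ f by blast
      obtain m where m: "m < length (map E us)"
        and nz: "(p \<cdot> \<iota> m) \<cdot> (\<pi> m \<cdot> g) \<noteq> \<zero>\<^bsub>Hom C (E i) (E j)\<^esub>"
        using nonzero_through_sum[OF s Ei Ej g(1) p] f(2) g(2) by metis
      have u: "us ! m \<in> set us" using m by auto
      then have Eu: "E (us ! m) \<in> Obj C" using us J E_obj by blast
      have \<iota>: "\<iota> m \<in> arrows C (E (us ! m)) y" and \<pi>: "\<pi> m \<in> arrows C y (E (us ! m))"
        using sum_mapsD(3,4)[OF s m] m by auto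
      have "\<pi> m \<cdot> g \<in> arrows C (E i) (E (us ! m))" by (rule comp_closed[OF Ei Y Eu g(1) \<pi>])
      moreover have "p \<cdot> \<iota> m \<in> arrows C (E (us ! m)) (E j)" by (rule comp_closed[OF Eu Y Ej \<iota> p])
      ultimately show "\<exists>s\<in>set us. \<exists>f\<in>arrows C (E i) (E j). f \<noteq> \<zero>\<^bsub>Hom C (E i) (E j)\<^esub> \<and>
          factors_through C (E i) (E j) (E s) f"
        using u nz comp_closed[OF Ei Eu Ej] unfolding factors_through_def by blast
    qed (use us in auto)
  qed
next
  assume dom: "\<forall>j\<in>I. ?dom j"
  then obtain F where F: "\<And>j. j \<in> I \<Longrightarrow> finite (F j)" "\<And>j. j \<in> I \<Longrightarrow> F j \<subseteq> J"
    "\<And>i j. j \<in> I \<Longrightarrow> i \<in> J \<Longrightarrow> \<not> zero_module (Hom C (E i) (E j)) \<Longrightarrow>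
      \<exists>s\<in>F j. \<exists>f\<in>arrows C (E i) (E j). f \<noteq> \<zero>\<^bsub>Hom C (E i) (E j)\<^esub> \<and>
        factors_through C (E i) (E j) (E s) f"
    by metis
  \<comment> \<open>A generator of each Hom space; for the zero space it is the zero map.\<close>
  have "\<forall>s\<in>I. \<forall>j\<in>I. \<exists>h\<in>arrows C (E s) (E j). \<forall>b\<in>arrows C (E s) (E j).
      \<exists>c\<in>carrier k. b = c \<odot>\<^bsub>Hom C (E s) (E j)\<^esub> h"
  proof (intro ballI)
    fix s j assume s: "s \<in> I" and j: "j \<in> I"
    note Es = E_obj[OF s] and Ej = E_obj[OF j]
    interpret M: Module.module k "Hom C (E s) (E j)" by (rule hom_module[OF Es Ej])
    show "\<exists>h\<in>arrows C (E s) (E j). \<forall>b\<in>arrows C (E s) (E j).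
        \<exists>c\<in>carrier k. b = c \<odot>\<^bsub>Hom C (E s) (E j)\<^esub> h"
    proof (cases "zero_module (Hom C (E s) (E j))")
      case True
      then show ?thesis
        using zero_closed[OF Es Ej] zero_moduleD M.smult_r_null k.zero_closed by metis
    next
      case False
      then show ?thesis using hom_thin[OF s j] unfolding one_dimensional_def by metis
    qed
  qed
  then obtain h where h: "\<And>s j. s \<in> I \<Longrightarrow> j \<in> I \<Longrightarrow> h s j \<in> arrows C (E s) (E j)"
    and gen: "\<And>s j b. s \<in> I \<Longrightarrow> j \<in> I \<Longrightarrow> b \<in> arrows C (E s) (E j) \<Longrightarrow>
      \<exists>c\<in>carrier k. b = c \<odot>\<^bsub>Hom C (E s) (E j)\<^esub> h s j"
    by metis
  show ?precov
    unfolding precovering_def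
  proof
    fix t assume t: "t \<in> Obj C"
    obtain js \<iota> \<pi> where js: "set js \<subseteq> I" and st: "sum_maps C (map E js) t \<iota> \<pi>"
      using decomposition[OF t] unfolding direct_sum_iff_sum_maps by blast
    have jI: "js ! m \<in> I" if "m < length js" for m using js that by auto
    have tm: "\<iota> m \<in> arrows C (E (js ! m)) t" "\<pi> m \<in> arrows C t (E (js ! m))" if "m < length js" for m
      using sum_mapsD(3,4)[OF st, of m] that by auto
    \<comment> \<open>The precover has a summand \<open>E s\<close> for each position \<open>m\<close> in \<open>js\<close> and each \<open>s\<close> in \<open>F (js ! m)\<close>.\<close>
    have "finite (SIGMA m:{..<length js}. F (js ! m))" using F(1) jI by auto
    then obtain ps where ps: "set ps = (SIGMA m:{..<length js}. F (js ! m))"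
      using finite_list by blast
    have psn: "fst (ps ! n) < length js" "snd (ps ! n) \<in> F (js ! fst (ps ! n))"
      "snd (ps ! n) \<in> J" "snd (ps ! n) \<in> I" "E (snd (ps ! n)) \<in> Obj C"
      if "n < length ps" for n
    proof -
      have "ps ! n \<in> (SIGMA m:{..<length js}. F (js ! m))" using ps that nth_mem by blast
      then show 1: "fst (ps ! n) < length js" and 2: "snd (ps ! n) \<in> F (js ! fst (ps ! n))" by auto
      then show 3: "snd (ps ! n) \<in> J" using F(2)[OF jI[OF 1]] by blast
      then show "snd (ps ! n) \<in> I" using J by blast
      then show "E (snd (ps ! n)) \<in> Obj C" by (rule E_obj)
    qed
    have "set (map E (map snd ps)) \<subseteq> Obj C" using psn(5) by (clarsimp simp: in_set_conv_nth) (metis snd_conv)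
    then obtain y \<iota>' \<pi>' where sy: "sum_maps C (map E (map snd ps)) y \<iota>' \<pi>'"
      using direct_sums unfolding direct_sum_iff_sum_maps by blast
    have "set (map snd ps) \<subseteq> J" using psn(3) by (force simp: in_set_conv_nth)
    then have yJ: "y \<in> finite_sums C E J"
      using sy unfolding finite_sums_def direct_sum_iff_sum_maps by blast
    note Y = sum_mapsD(1)[OF sy]
    have ym: "\<iota>' n \<in> arrows C (E (snd (ps ! n))) y" if "n < length ps" for n
      using sum_mapsD(3)[OF sy, of n] that by auto
    have "\<iota> (fst (ps ! n)) \<cdot> h (snd (ps ! n)) (js ! fst (ps ! n)) \<in> arrows C (map E (map snd ps) ! n) t"
      if "n < length (map E (map snd ps))" for n
    proof -
      have n: "n < length ps" using that by simp
      show ?thesis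
        using comp_closed[OF psn(5)[OF n] E_obj[OF jI[OF psn(1)[OF n]]] t
            h[OF psn(4)[OF n] jI[OF psn(1)[OF n]]] tm(1)[OF psn(1)[OF n]]] n by simp
    qed
    then obtain f where f: "f \<in> arrows C y t"
      and f\<iota>: "\<And>n. n < length ps \<Longrightarrow>
        f \<cdot> \<iota>' n = \<iota> (fst (ps ! n)) \<cdot> h (snd (ps ! n)) (js ! fst (ps ! n))"
      using copairing[OF sy t, of "\<lambda>n. \<iota> (fst (ps ! n)) \<cdot> h (snd (ps ! n)) (js ! fst (ps ! n))"]
      by (metis length_map)
    have lift_E: "\<exists>g\<in>arrows C (E i) y. f' = f \<cdot> g" if i: "i \<in> J" and f': "f' \<in> arrows C (E i) t" for i f'
    proof -
      have iI: "i \<in> I" using i J by auto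
      note Ei = E_obj[OF iI]
      have "\<exists>g\<in>arrows C (E i) y. \<iota> m \<cdot> (\<pi> m \<cdot> f') = f \<cdot> g" if m: "m < length js" for m
      proof -
        note jm = jI[OF m]
        note Ej = E_obj[OF jm]
        define a where "a = \<pi> m \<cdot> f'"
        have a: "a \<in> arrows C (E i) (E (js ! m))"
          unfolding a_def by (rule comp_closed[OF Ei t Ej f' tm(2)[OF m]])
        show ?thesis
        proof (cases "a = \<zero>\<^bsub>Hom C (E i) (E (js ! m))\<^esub>")
          case True
          then show ?thesis
            using comp_zero_right[OF Ei Ej t tm(1)[OF m]] comp_zero_right[OF Ei Y t f]
              zero_closed[OF Ei Y] unfolding a_def by metis
        next
          case False
          then have "\<not> zero_module (Hom C (E i) (E (js ! m)))" using a zero_moduleD by blast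
          then obtain s f0 where s: "s \<in> F (js ! m)" and f0: "f0 \<in> arrows C (E i) (E (js ! m))"
            "f0 \<noteq> \<zero>\<^bsub>Hom C (E i) (E (js ! m))\<^esub>" and fac: "factors_through C (E i) (E (js ! m)) (E s) f0"
            using F(3)[OF jm i] by blast
          have sI: "s \<in> I" using s F(2)[OF jm] J by blast
          note Es = E_obj[OF sI]
          obtain c b where c: "c \<in> arrows C (E i) (E s)" and b: "b \<in> arrows C (E s) (E (js ! m))"
            and f0': "f0 = b \<cdot> c" using fac unfolding factors_through_def by blast
          obtain x where x: "x \<in> carrier k" "a = x \<odot>\<^bsub>Hom C (E i) (E (js ! m))\<^esub> f0"
            using multiple_of_nonzero[OF iI jm f0(1) a f0(2)] .
          obtain z where z: "z \<in> carrier k" "b = z \<odot>\<^bsub>Hom C (E s) (E (js ! m))\<^esub> h s (js ! m)"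
            using gen[OF sI jm b] by blast
          \<comment> \<open>All scalars are moved to \<open>c\<close>, so that the generator remains on the left.\<close>
          define c' where "c' = x \<odot>\<^bsub>Hom C (E i) (E s)\<^esub> (z \<odot>\<^bsub>Hom C (E i) (E s)\<^esub> c)"
          have zc: "z \<odot>\<^bsub>Hom C (E i) (E s)\<^esub> c \<in> arrows C (E i) (E s)"
            by (rule smult_arrow_closed[OF Ei Es z(1) c])
          have c': "c' \<in> arrows C (E i) (E s)"
            unfolding c'_def by (rule smult_arrow_closed[OF Ei Es x(1) zc])
          note hsm = h[OF sI jm]
          have hc: "h s (js ! m) \<cdot> c' = a"
            unfolding c'_def x(2) f0' z(2)
            using comp_smult_right[OF Ei Es Ej zc hsm x(1)] comp_smult_right[OF Ei Es Ej c hsm z(1)]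
              comp_smult_left[OF Ei Es Ej c hsm z(1)] by simp
          have "(m, s) \<in> set ps" using ps m s by simp
          then obtain n where n: "n < length ps" "ps ! n = (m, s)" by (auto simp: in_set_conv_nth)
          have \<iota>'n: "\<iota>' n \<in> arrows C (E s) y" using ym[OF n(1)] n(2) by simp
          have "f \<cdot> (\<iota>' n \<cdot> c') = (f \<cdot> \<iota>' n) \<cdot> c'"
            using comp_assoc[OF Ei Es Y t c' \<iota>'n f] by simp
          also have "\<dots> = (\<iota> m \<cdot> h s (js ! m)) \<cdot> c'" using f\<iota>[OF n(1)] n(2) by simp
          also have "\<dots> = \<iota> m \<cdot> a"
            using comp_assoc[OF Ei Es Ej t c' hsm tm(1)[OF m]] hc by simp
          finally show ?thesis
            using comp_closed[OF Ei Es Y c' \<iota>'n] unfolding a_def by metis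
        qed
      qed
      then obtain g where g: "\<And>m. m < length js \<Longrightarrow> g m \<in> arrows C (E i) y"
        "\<And>m. m < length js \<Longrightarrow> \<iota> m \<cdot> (\<pi> m \<cdot> f') = f \<cdot> g m"
        by metis
      interpret It: abelian_group "Hom C (E i) t" by (rule hom_abelian_group[OF Ei t])
      have "f' = (\<Oplus>\<^bsub>Hom C (E i) t\<^esub>m\<in>{..<length js}. \<iota> m \<cdot> (\<pi> m \<cdot> f'))"
        using arrow_to_sum[OF st Ei f'] by simp
      also have "\<dots> = (\<Oplus>\<^bsub>Hom C (E i) t\<^esub>m\<in>{..<length js}. f \<cdot> g m)"
        by (rule It.finsum_cong') (use g comp_closed[OF Ei Y t _ f] in auto)
      also have "\<dots> = f \<cdot> (\<Oplus>\<^bsub>Hom C (E i) y\<^esub>m\<in>{..<length js}. g m)"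
        by (rule comp_finsum_right[symmetric]) (use Ei Y t f g in auto)
      finally have eq: "f' = f \<cdot> (\<Oplus>\<^bsub>Hom C (E i) y\<^esub>m\<in>{..<length js}. g m)" .
      have "(\<Oplus>\<^bsub>Hom C (E i) y\<^esub>m\<in>{..<length js}. g m) \<in> arrows C (E i) y"
        by (rule finsum_arrows_closed[OF Ei Y g(1)]) simp
      with eq show ?thesis by blast
    qed
    have "\<exists>g\<in>arrows C y' y. f' = f \<cdot> g"
      if y': "y' \<in> finite_sums C E J" and f': "f' \<in> arrows C y' t" for y' f'
    proof -
      obtain us \<iota>'' \<pi>'' where us: "set us \<subseteq> J" and s: "sum_maps C (map E us) y' \<iota>'' \<pi>''"
        using y' unfolding finite_sums_def direct_sum_iff_sum_maps by blast
      note Y' = sum_mapsD(1)[OF s]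
      have u: "us ! m \<in> J" "E (us ! m) \<in> Obj C" "\<iota>'' m \<in> arrows C (E (us ! m)) y'" if "m < length us" for m
        using sum_mapsD(2,3)[OF s, of m] us that by auto
      have "\<exists>g\<in>arrows C (E (us ! m)) y. f' \<cdot> \<iota>'' m = f \<cdot> g" if m: "m < length us" for m
        by (rule lift_E[OF u(1)[OF m] comp_closed[OF u(2)[OF m] Y' t u(3)[OF m] f']])
      then obtain g where g: "\<And>m. m < length us \<Longrightarrow> g m \<in> arrows C (E (us ! m)) y"
        "\<And>m. m < length us \<Longrightarrow> f' \<cdot> \<iota>'' m = f \<cdot> g m" by metis
      have "g m \<in> arrows C (map E us ! m) y" if "m < length (map E us)" for m using g(1) that by simp
      then obtain g' where g': "g' \<in> arrows C y' y" "\<And>m. m < length us \<Longrightarrow> g' \<cdot> \<iota>'' m = g m"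
        using copairing[OF s Y, of g] by (metis length_map)
      have "f' = f \<cdot> g'"
      proof (rule arrow_from_sum_eqI[OF s t f' comp_closed[OF Y' Y t g'(1) f]])
        fix m assume "m < length (map E us)"
        then have m: "m < length us" by simp
        show "f' \<cdot> \<iota>'' m = (f \<cdot> g') \<cdot> \<iota>'' m"
          using comp_assoc[OF u(2)[OF m] Y' Y t u(3)[OF m] g'(1) f] g'(2)[OF m] g(2)[OF m] by simp
      qed
      then show ?thesis using g' by blast
    qed
    then show "\<exists>y\<in>finite_sums C E J. \<exists>f\<in>arrows C y t. \<forall>y'\<in>finite_sums C E J. \<forall>f'\<in>arrows C y' t.
        \<exists>g\<in>arrows C y' y. f' = f \<cdot> g"
      using yJ f by blast
  qed
qed

end

lemma (in linear_category) direct_sum_opposite: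
  "direct_sum (opposite C) As S \<longleftrightarrow> direct_sum C As S"
  using linear_category.direct_sum_iff_sum_maps[OF linear_category_opposite, of As S]
    direct_sum_iff_sum_maps[of As S] sum_maps_opposite[of C As S] by blast

lemma isomorphic_opposite: "isomorphic (opposite C) A B \<longleftrightarrow> isomorphic C A B"
  unfolding isomorphic_def iso_arrows_def by auto

lemma (in thin_krull_schmidt_category) thin_krull_schmidt_category_opposite:
  "thin_krull_schmidt_category k (opposite C) I E"
proof (intro thin_krull_schmidt_category.intro linear_category_opposite
    thin_krull_schmidt_category_axioms.intro)
qed (use direct_sums E_obj E_nonzero E_inj hom_thin decomposition direct_sum_opposite in
    \<open>auto simp: isomorphic_opposite\<close>)

lemma (in thin_krull_schmidt_category) preenveloping_finite_sums_iff:
  assumes J: "J \<subseteq> I"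
  shows "preenveloping C (finite_sums C E J) \<longleftrightarrow>
    (\<forall>j\<in>I. \<exists>F. finite F \<and> F \<subseteq> J \<and> (\<forall>i\<in>J. \<not> zero_module (Hom C (E j) (E i)) \<longrightarrow>
      (\<exists>s\<in>F. \<exists>f\<in>arrows C (E j) (E i). f \<noteq> \<zero>\<^bsub>Hom C (E j) (E i)\<^esub> \<and>
        factors_through C (E j) (E i) (E s) f)))"
proof -
  interpret op: thin_krull_schmidt_category k "opposite C" I E
    by (rule thin_krull_schmidt_category_opposite)
  have "preenveloping C Y \<longleftrightarrow> precovering (opposite C) Y" for Y
    by (simp add: preenveloping_def precovering_def)
  moreover have "finite_sums (opposite C) E J = finite_sums C E J"
    by (simp add: finite_sums_def direct_sum_opposite)
  moreover have "factors_through (opposite C) A B S f = factors_through C B A S f" for A B S f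
    by (auto simp: factors_through_def)
  ultimately show ?thesis using op.precovering_finite_sums_iff[OF J] by simp
qed

lemma zero_module_bij_betw:
  assumes "bij_betw \<phi> (carrier M) (carrier N)" "\<zero>\<^bsub>M\<^esub> \<in> carrier M" "\<zero>\<^bsub>N\<^esub> \<in> carrier N"
  shows "zero_module M \<longleftrightarrow> zero_module N"
proof -
  have "inj_on \<phi> (carrier M)" and im: "\<phi> ` carrier M = carrier N"
    using assms(1) by (auto simp: bij_betw_def)
  show ?thesis
    unfolding zero_module_def
  proof
    assume "carrier M = {\<zero>\<^bsub>M\<^esub>}"
    then show "carrier N = {\<zero>\<^bsub>N\<^esub>}" using im assms(3) by (metis image_empty image_insert singletonD)
  next
    assume N: "carrier N = {\<zero>\<^bsub>N\<^esub>}"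
    have "x = \<zero>\<^bsub>M\<^esub>" if x: "x \<in> carrier M" for x
    proof (rule inj_onD[OF \<open>inj_on \<phi> (carrier M)\<close> _ x assms(2)])
      have "\<phi> x \<in> carrier N" "\<phi> \<zero>\<^bsub>M\<^esub> \<in> carrier N" using im x assms(2) by auto
      then show "\<phi> x = \<phi> \<zero>\<^bsub>M\<^esub>" using N by simp
    qed
    then show "carrier M = {\<zero>\<^bsub>M\<^esub>}" using assms(2) by blast
  qed
qed

section \<open>Cluster tilting in terms of diagonals\<close>

text \<open>The combinatorial form of the precovering condition. The \<open>{x0, x1}\<close> are the members of \<open>\<D>\<close>
  with a nonzero map to the object of \<open>{y0, y1}\<close>, and each such map has to factor through one of
  finitely many objects.\<close>

definition finitely_dominated_above :: "complex set \<Rightarrow> complex set set \<Rightarrow> bool" where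
  "finitely_dominated_above Z \<D> \<longleftrightarrow> (\<forall>y0 y1. {y0, y1} \<in> diagonals Z \<longrightarrow>
    (\<exists>F. finite F \<and> F \<subseteq> \<D> \<and> (\<forall>x0 x1. {x0, x1} \<in> \<D> \<longrightarrow> hom_configuration Z x0 x1 y0 y1 \<longrightarrow>
      (\<exists>s0 s1. {s0, s1} \<in> F \<and> cyc_le [x0, s0, y0] \<and> cyc_le [x1, s1, y1]))))"

text \<open>The dual condition, about maps from the object of \<open>{y0, y1}\<close> and preenvelopes.\<close>

definition finitely_dominated_below :: "complex set \<Rightarrow> complex set set \<Rightarrow> bool" where
  "finitely_dominated_below Z \<D> \<longleftrightarrow> (\<forall>y0 y1. {y0, y1} \<in> diagonals Z \<longrightarrow>
    (\<exists>F. finite F \<and> F \<subseteq> \<D> \<and> (\<forall>x0 x1. {x0, x1} \<in> \<D> \<longrightarrow> hom_configuration Z y0 y1 x0 x1 \<longrightarrow>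
      (\<exists>s0 s1. {s0, s1} \<in> F \<and> cyc_le [y0, s0, x0] \<and> cyc_le [y1, s1, x1]))))"

text \<open>Each of the two labellings of a diagonal \<open>Y\<close> comes with a finite set, and their union serves for
  the unordered pair.\<close>

lemma labelled_domination:
  "(\<forall>Y\<in>diagonals Z. \<exists>F. finite F \<and> F \<subseteq> \<D> \<and> (\<forall>U\<in>\<D>. \<forall>x0 x1 y0 y1.
      U = {x0, x1} \<longrightarrow> Y = {y0, y1} \<longrightarrow> conf x0 x1 y0 y1 \<longrightarrow>
        (\<exists>s0 s1. {s0, s1} \<in> F \<and> cov x0 x1 y0 y1 s0 s1))) \<longleftrightarrow>
    (\<forall>y0 y1. {y0, y1} \<in> diagonals Z \<longrightarrow> (\<exists>F. finite F \<and> F \<subseteq> \<D> \<and>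
      (\<forall>x0 x1. {x0, x1} \<in> \<D> \<longrightarrow> conf x0 x1 y0 y1 \<longrightarrow>
        (\<exists>s0 s1. {s0, s1} \<in> F \<and> cov x0 x1 y0 y1 s0 s1))))"
    (is "(\<forall>Y\<in>diagonals Z. ?unlabelled Y) \<longleftrightarrow> (\<forall>y0 y1. _ \<longrightarrow> ?labelled y0 y1)")
proof (intro iffI allI impI ballI)
  fix y0 y1 assume "\<forall>Y\<in>diagonals Z. ?unlabelled Y" "{y0, y1} \<in> diagonals Z"
  then have "?unlabelled {y0, y1}" by (rule bspec)
  then obtain F where F: "finite F" "F \<subseteq> \<D>" and *: "\<forall>U\<in>\<D>. \<forall>x0 x1 y0' y1'. U = {x0, x1} \<longrightarrow>
      {y0, y1} = {y0', y1'} \<longrightarrow> conf x0 x1 y0' y1' \<longrightarrow> (\<exists>s0 s1. {s0, s1} \<in> F \<and> cov x0 x1 y0' y1' s0 s1)"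
    by (elim exE conjE) (rule that)
  show "?labelled y0 y1"
    by (intro exI[of _ F] conjI F allI impI) (rule *[rule_format, OF _ refl refl])
next
  fix Y assume lab: "\<forall>y0 y1. {y0, y1} \<in> diagonals Z \<longrightarrow> ?labelled y0 y1" and Y: "Y \<in> diagonals Z"
  obtain a b where ab: "Y = {a, b}" using Y unfolding diagonals_def by blast
  have "?labelled a b" by (rule lab[THEN spec, THEN spec, THEN mp]) (use Y ab in simp)
  then obtain F where F: "finite F" "F \<subseteq> \<D>" and F': "\<forall>x0 x1. {x0, x1} \<in> \<D> \<longrightarrow> conf x0 x1 a b \<longrightarrow>
      (\<exists>s0 s1. {s0, s1} \<in> F \<and> cov x0 x1 a b s0 s1)"
    by (elim exE conjE) (rule that)
  have "?labelled b a"
    by (rule lab[THEN spec, THEN spec, THEN mp]) (use Y ab in \<open>simp add: insert_commute\<close>)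
  then obtain G where G: "finite G" "G \<subseteq> \<D>" and G': "\<forall>x0 x1. {x0, x1} \<in> \<D> \<longrightarrow> conf x0 x1 b a \<longrightarrow>
      (\<exists>s0 s1. {s0, s1} \<in> G \<and> cov x0 x1 b a s0 s1)"
    by (elim exE conjE) (rule that)
  show "?unlabelled Y"
  proof (intro exI[of _ "F \<union> G"] conjI ballI allI impI)
    fix U x0 x1 y0 y1 assume U: "U \<in> \<D>" "U = {x0, x1}" "Y = {y0, y1}" "conf x0 x1 y0 y1"
    consider "y0 = a" "y1 = b" | "y0 = b" "y1 = a" using U(3) ab by (auto simp: doubleton_eq_iff)
    then show "\<exists>s0 s1. {s0, s1} \<in> F \<union> G \<and> cov x0 x1 y0 y1 s0 s1"
    proof cases
      case 1
      have "\<exists>s0 s1. {s0, s1} \<in> F \<and> cov x0 x1 a b s0 s1" using F'[rule_format, of x0 x1] U 1 by simp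
      then show ?thesis using 1 by blast
    next
      case 2
      have "\<exists>s0 s1. {s0, s1} \<in> G \<and> cov x0 x1 b a s0 s1" using G'[rule_format, of x0 x1] U 2 by simp
      then show ?thesis using 2 by blast
    qed
  qed (use F G in auto)
qed

lemma (in triangulated_category) zero_hom_Sus_iff:
  assumes "A \<in> Obj C" "B \<in> Obj C"
  shows "zero_module (Hom C (Sus C A) (Sus C B)) \<longleftrightarrow> zero_module (Hom C A B)"
proof -
  have "bij_betw (restrict (Susm C) (arrows C A B)) (arrows C A B) (arrows C (Sus C A) (Sus C B))"
    using sus_linear_fully_faithful[OF assms] by (simp add: linear_isos_def)
  then show ?thesis
    using zero_module_bij_betw zero_closed sus_closed assms by metis
qed

context igusa_todorov_category
begin

lemma E_in_Obj: "U \<in> diagonals Z \<Longrightarrow> E U \<in> Obj C"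
  using E_indecomposable unfolding indecomposable_def by blast

lemma hom_nonzero_iff:
  assumes U: "U \<in> diagonals Z" and V: "V \<in> diagonals Z"
  shows "\<not> zero_module (Hom C (E U) (E V)) \<longleftrightarrow>
    (\<exists>x0 x1 y0 y1. U = {x0, x1} \<and> V = {y0, y1} \<and> hom_configuration Z x0 x1 y0 y1)"
    and "zero_module (Hom C (E U) (E V)) \<or> one_dimensional k (Hom C (E U) (E V))"
proof -
  have one: "one_dimensional k (Hom C (E U) (E V))"
    if conf: "\<exists>x0 x1 y0 y1. U = {x0, x1} \<and> V = {y0, y1} \<and> hom_configuration Z x0 x1 y0 y1"
  proof -
    obtain x0 x1 y0 y1 where "U = {x0, x1}" "V = {y0, y1}" "hom_configuration Z x0 x1 y0 y1"
      using conf by blast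
    then have "linear_isos k (Hom C (E U) (E V)) (regular_module k) \<noteq> {}"
      using hom_nonzero U V by blast
    then show ?thesis
      by (rule one_dimensionalI[OF k.field_axioms hom_module[OF E_in_Obj[OF U] E_in_Obj[OF V]]])
  qed
  moreover have "\<not> zero_module M" if "one_dimensional k M" for M :: "('k, 'm) module"
    using that by (auto simp: one_dimensional_def zero_module_def)
  ultimately show "\<not> zero_module (Hom C (E U) (E V)) \<longleftrightarrow>
    (\<exists>x0 x1 y0 y1. U = {x0, x1} \<and> V = {y0, y1} \<and> hom_configuration Z x0 x1 y0 y1)"
    and "zero_module (Hom C (E U) (E V)) \<or> one_dimensional k (Hom C (E U) (E V))"
    using hom_zero[OF U V] by blast+
qed

lemma indecomposable_decomposition:
  assumes A: "A \<in> Obj C"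
  shows "\<exists>us. set us \<subseteq> diagonals Z \<and> direct_sum C (map E us) A"
proof -
  obtain As where As: "direct_sum C As A" "\<And>B. B \<in> set As \<Longrightarrow> local_endomorphism_ring C B"
    using krull_schmidt A unfolding krull_schmidt_def by blast
  have obj: "set As \<subseteq> Obj C" using As(1) unfolding direct_sum_def by blast
  have "\<exists>U\<in>diagonals Z. isomorphic C B (E U)" if "B \<in> set As" for B
    using E_surjective local_endomorphism_ring_indecomposable As(2) that obj by blast
  then obtain u where u: "\<And>B. B \<in> set As \<Longrightarrow> u B \<in> diagonals Z"
    "\<And>B. B \<in> set As \<Longrightarrow> isomorphic C B (E (u B))" by metis
  have "direct_sum C (map E (map u As)) A"
  proof (rule direct_sum_iso_components[OF As(1)])
    show "set (map E (map u As)) \<subseteq> Obj C" using u(1) E_in_Obj by auto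
  qed (use u(2) in auto)
  moreover have "set (map u As) \<subseteq> diagonals Z" using u(1) by auto
  ultimately show ?thesis by blast
qed

sublocale thin: thin_krull_schmidt_category k C "diagonals Z" E
proof
  fix U assume U: "U \<in> diagonals Z"
  show "Ident C (E U) \<noteq> \<zero>\<^bsub>Hom C (E U) (E U)\<^esub>"
    using E_indecomposable[OF U] zero_object_iff_ident[OF E_in_Obj[OF U]]
    unfolding indecomposable_def by simp
qed (fact direct_sums E_in_Obj E_injective hom_nonzero_iff(2) indecomposable_decomposition)+

text \<open>The two spaces are dual to each other, and the dual of the zero space is zero.\<close>

lemma zero_Ext1_commute:
  assumes A: "A \<in> Obj C" and B: "B \<in> Obj C"
  shows "zero_module (Ext1 C A B) \<longleftrightarrow> zero_module (Ext1 C B A)"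
proof -
  have imp: "zero_module (Ext1 C A B)"
    if A: "A \<in> Obj C" and B: "B \<in> Obj C" and z: "zero_module (Ext1 C B A)" for A B
  proof -
    obtain \<theta> where "\<theta> \<in> linear_isos k (Ext1 C A B) (dual_module k (Ext1 C B A))"
      using two_calabi_yau A B unfolding two_calabi_yau_def by blast
    then have bij: "bij_betw \<theta> (arrows C A (Sus C B)) (linear_maps k (Ext1 C B A) (regular_module k))"
      by (simp add: linear_isos_def dual_module_def Ext1_def)
    interpret M: Module.module k "Hom C B (Sus C A)" by (rule hom_module[OF B sus_closed[OF A]])
    have carr: "carrier (Ext1 C B A) = {\<zero>\<^bsub>Hom C B (Sus C A)\<^esub>}" (is "_ = {?z}")
      using z by (simp add: zero_module_def Ext1_def)
    have unique: "\<phi> = (\<lambda>x\<in>{?z}. \<zero>\<^bsub>k\<^esub>)" if \<phi>: "\<phi> \<in> linear_maps k (Ext1 C B A) (regular_module k)" for \<phi>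
    proof -
      have \<phi>': "\<phi> \<in> {?z} \<rightarrow>\<^sub>E carrier k"
        using \<phi> carr by (simp add: linear_maps_def regular_module_def)
      have "\<phi> (\<zero>\<^bsub>k\<^esub> \<odot>\<^bsub>Hom C B (Sus C A)\<^esub> ?z) = \<zero>\<^bsub>k\<^esub> \<otimes>\<^bsub>k\<^esub> \<phi> ?z"
        using \<phi> carr by (simp add: linear_maps_def regular_module_def Ext1_def)
      then have "\<phi> ?z = \<zero>\<^bsub>k\<^esub>"
        using PiE_mem[OF \<phi>', of ?z] by simp
      then show ?thesis using PiE_arb[OF \<phi>'] by (auto simp: fun_eq_iff restrict_def)
    qed
    have "\<theta> x = \<theta> y" if "x \<in> arrows C A (Sus C B)" "y \<in> arrows C A (Sus C B)" for x y
      using unique[OF bij_betwE[OF bij, rule_format, OF that(1)]]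
        unique[OF bij_betwE[OF bij, rule_format, OF that(2)]] by simp
    then have "x = y" if "x \<in> arrows C A (Sus C B)" "y \<in> arrows C A (Sus C B)" for x y
      using that by (intro inj_onD[OF bij_betw_imp_inj_on[OF bij]])
    then show ?thesis
      unfolding Ext1_def using zero_moduleI[OF A sus_closed[OF B]] zero_closed[OF A sus_closed[OF B]]
      by blast
  qed
  show ?thesis using imp[OF A B] imp[OF B A] by blast
qed

lemma zero_Ext1_iff_not_cross:
  assumes U: "U \<in> diagonals Z" and V: "V \<in> diagonals Z"
  shows "zero_module (Ext1 C (E U) (E V)) \<longleftrightarrow> \<not> cross U V"
proof
  assume z: "zero_module (Ext1 C (E U) (E V))"
  show "\<not> cross U V"
  proof
    assume "cross U V"
    then have "one_dimensional k (Ext1 C (E U) (E V))"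
      using ext_cross[OF U V] one_dimensionalI[OF k.field_axioms] hom_module E_in_Obj U V sus_closed
      unfolding Ext1_def by blast
    then show False using z by (auto simp: one_dimensional_def zero_module_def)
  qed
qed (rule ext_not_cross[OF U V])

text \<open>The suspension is fully faithful and dense, so the condition on \<open>Hom (\<Sigma>\<inverse> y) t\<close> is one on
  \<open>Hom y (\<Sigma> t)\<close>.\<close>

lemma right_perp_desuspension:
  assumes Y: "Y \<subseteq> Obj C"
  shows "right_perp C (desuspension C Y) = {t \<in> Obj C. \<forall>y\<in>Y. zero_module (Ext1 C y t)}"
proof (intro equalityI subsetI)
  fix t assume "t \<in> right_perp C (desuspension C Y)"
  then have t: "t \<in> Obj C" and z: "\<And>s. s \<in> desuspension C Y \<Longrightarrow> zero_module (Hom C s t)"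
    by (auto simp: right_perp_def)
  have "zero_module (Ext1 C y t)" if y: "y \<in> Y" for y
  proof -
    have y': "y \<in> Obj C" using y Y by blast
    obtain s where s: "s \<in> Obj C" "isomorphic C (Sus C s) y" using sus_essentially_surjective[OF y'] by blast
    then have "zero_module (Hom C s t)" using z y unfolding desuspension_def by blast
    then have "zero_module (Hom C (Sus C s) (Sus C t))" using zero_hom_Sus_iff[OF s(1) t] by simp
    then show ?thesis
      unfolding Ext1_def
      by (rule zero_hom_isomorphic_source[OF sus_closed[OF s(1)] y' sus_closed[OF t] s(2)])
  qed
  then show "t \<in> {t \<in> Obj C. \<forall>y\<in>Y. zero_module (Ext1 C y t)}" using t by blast
next
  fix t assume t: "t \<in> {t \<in> Obj C. \<forall>y\<in>Y. zero_module (Ext1 C y t)}"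
  then have t': "t \<in> Obj C" by blast
  have "zero_module (Hom C s t)" if sY: "s \<in> desuspension C Y" for s
  proof -
    obtain y where s: "s \<in> Obj C" and y: "y \<in> Y" "isomorphic C (Sus C s) y"
      using sY unfolding desuspension_def by blast
    have "zero_module (Hom C y (Sus C t))" using t y unfolding Ext1_def by blast
    then have "zero_module (Hom C (Sus C s) (Sus C t))"
      using zero_hom_isomorphic_source[OF _ sus_closed[OF s] sus_closed[OF t'] isomorphic_sym[OF y(2)]]
        Y y(1) by blast
    then show ?thesis using zero_hom_Sus_iff[OF s t'] by simp
  qed
  then show "t \<in> right_perp C (desuspension C Y)" using t' by (auto simp: right_perp_def)
qed

lemma left_perp_Sus:
  assumes Y: "Y \<subseteq> Obj C"
  shows "left_perp C (Sus C ` Y) = {t \<in> Obj C. \<forall>y\<in>Y. zero_module (Ext1 C y t)}"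
proof -
  have "zero_module (Hom C t (Sus C y)) \<longleftrightarrow> zero_module (Ext1 C y t)"
    if "t \<in> Obj C" "y \<in> Y" for t y
    using zero_Ext1_commute[of t y] that Y by (auto simp: Ext1_def)
  then show ?thesis unfolding left_perp_def by auto
qed

text \<open>The vanishing of \<open>Ext1\<close> can be tested on indecomposable summands: a direct sum in the first
  argument splits, and one in the second argument is moved to the first by duality.\<close>

lemma Ext1_perp_finite_sums:
  assumes D: "\<D> \<subseteq> diagonals Z"
  shows "{t \<in> Obj C. \<forall>y\<in>finite_sums C E \<D>. zero_module (Ext1 C y t)} =
    finite_sums C E {U \<in> diagonals Z. \<forall>V\<in>\<D>. \<not> cross V U}"
proof -
  have ext: "(\<forall>y\<in>finite_sums C E \<D>. zero_module (Ext1 C y t)) \<longleftrightarrow> (\<forall>U\<in>set us. \<forall>V\<in>\<D>. \<not> cross V U)"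
    if us: "set us \<subseteq> diagonals Z" and t: "direct_sum C (map E us) t" for us t
  proof -
    have t': "t \<in> Obj C" using t unfolding direct_sum_def by blast
    note St = sus_closed[OF t']
    have "(\<forall>y\<in>finite_sums C E \<D>. zero_module (Ext1 C y t)) \<longleftrightarrow> (\<forall>V\<in>\<D>. zero_module (Ext1 C (E V) t))"
    proof
      assume *: "\<forall>y\<in>finite_sums C E \<D>. zero_module (Ext1 C y t)"
      show "\<forall>V\<in>\<D>. zero_module (Ext1 C (E V) t)"
        using * thin.E_in_finite_sums_iff[OF D] D by blast
    next
      assume *: "\<forall>V\<in>\<D>. zero_module (Ext1 C (E V) t)"
      show "\<forall>y\<in>finite_sums C E \<D>. zero_module (Ext1 C y t)"
      proof
        fix y assume "y \<in> finite_sums C E \<D>"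
        then obtain vs where vs: "set vs \<subseteq> \<D>" "direct_sum C (map E vs) y"
          unfolding finite_sums_def by blast
        show "zero_module (Ext1 C y t)"
          using zero_hom_from_sum_iff[OF vs(2) St] * vs(1) unfolding Ext1_def by auto
      qed
    qed
    also have "\<dots> \<longleftrightarrow> (\<forall>V\<in>\<D>. \<forall>U\<in>set us. \<not> cross V U)"
    proof (intro ball_cong refl)
      fix V assume V: "V \<in> \<D>"
      then have V': "V \<in> diagonals Z" using D by blast
      note EV = E_in_Obj[OF V']
      have "zero_module (Ext1 C (E V) t) \<longleftrightarrow> zero_module (Hom C t (Sus C (E V)))"
        using zero_Ext1_commute[OF EV t'] by (simp add: Ext1_def)
      also have "\<dots> \<longleftrightarrow> (\<forall>U\<in>set us. zero_module (Ext1 C (E U) (E V)))"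
        using zero_hom_from_sum_iff[OF t sus_closed[OF EV]] by (simp add: Ext1_def)
      also have "\<dots> \<longleftrightarrow> (\<forall>U\<in>set us. \<not> cross V U)"
        using zero_Ext1_iff_not_cross[OF V'] zero_Ext1_commute[OF EV E_in_Obj] us by blast
      finally show "zero_module (Ext1 C (E V) t) \<longleftrightarrow> (\<forall>U\<in>set us. \<not> cross V U)" .
    qed
    finally show ?thesis by blast
  qed
  show ?thesis
  proof (intro equalityI subsetI)
    fix t assume t: "t \<in> {t \<in> Obj C. \<forall>y\<in>finite_sums C E \<D>. zero_module (Ext1 C y t)}"
    obtain us where us: "set us \<subseteq> diagonals Z" "direct_sum C (map E us) t"
      using indecomposable_decomposition t by blast
    then have "set us \<subseteq> {U \<in> diagonals Z. \<forall>V\<in>\<D>. \<not> cross V U}" using ext[OF us] t by blast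
    then show "t \<in> finite_sums C E {U \<in> diagonals Z. \<forall>V\<in>\<D>. \<not> cross V U}"
      using us(2) unfolding finite_sums_def by blast
  next
    fix t assume "t \<in> finite_sums C E {U \<in> diagonals Z. \<forall>V\<in>\<D>. \<not> cross V U}"
    then obtain us where us: "set us \<subseteq> {U \<in> diagonals Z. \<forall>V\<in>\<D>. \<not> cross V U}"
      "direct_sum C (map E us) t" unfolding finite_sums_def by blast
    moreover have "t \<in> Obj C" using us(2) unfolding direct_sum_def by blast
    ultimately show "t \<in> {t \<in> Obj C. \<forall>y\<in>finite_sums C E \<D>. zero_module (Ext1 C y t)}"
      using ext[OF _ us(2)] by blast
  qed
qed

text \<open>Both perpendicular categories are the additive closure of the diagonals that cross no member of
  \<open>\<D>\<close>, and an additive closure determines its indecomposable objects.\<close>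

lemma weakly_cluster_tilting_iff:
  assumes D: "\<D> \<subseteq> diagonals Z"
  shows "weakly_cluster_tilting C (add_closure C (E ` \<D>)) \<longleftrightarrow>
    {U \<in> diagonals Z. \<forall>V\<in>\<D>. \<not> cross V U} = \<D>" (is "_ \<longleftrightarrow> ?N = \<D>")
proof -
  have sub: "finite_sums C E \<D> \<subseteq> Obj C" unfolding finite_sums_def direct_sum_def by blast
  have "weakly_cluster_tilting C (add_closure C (E ` \<D>)) \<longleftrightarrow> finite_sums C E \<D> = finite_sums C E ?N"
    unfolding weakly_cluster_tilting_def thin.add_closure_eq_finite_sums[OF D]
      right_perp_desuspension[OF sub] left_perp_Sus[OF sub] Ext1_perp_finite_sums[OF D] by blast
  also have "\<dots> \<longleftrightarrow> ?N = \<D>"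
  proof
    assume eq: "finite_sums C E \<D> = finite_sums C E ?N"
    have "U \<in> ?N \<longleftrightarrow> U \<in> \<D>" for U
      proof (cases "U \<in> diagonals Z")
        case True
        then show ?thesis
          using thin.E_in_finite_sums_iff[OF D True] thin.E_in_finite_sums_iff[of ?N U] eq by auto
      next
        case False
        then show ?thesis using D by auto
      qed
    then show "?N = \<D>" by blast
  qed simp
  finally show ?thesis .
qed

text \<open>The criterion for a factorization does not depend on the nonzero map \<open>E U \<rightarrow> E Y\<close>, so any one of
  them decides.\<close>

lemma nonzero_factors_iff:
  assumes U: "U \<in> diagonals Z" and Y: "Y \<in> diagonals Z" and F: "F \<subseteq> diagonals Z"
  shows "(\<not> zero_module (Hom C (E U) (E Y)) \<longrightarrow> (\<exists>S\<in>F. \<exists>f\<in>arrows C (E U) (E Y).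
      f \<noteq> \<zero>\<^bsub>Hom C (E U) (E Y)\<^esub> \<and> factors_through C (E U) (E Y) (E S) f)) \<longleftrightarrow>
    (\<forall>x0 x1 y0 y1. U = {x0, x1} \<longrightarrow> Y = {y0, y1} \<longrightarrow> hom_configuration Z x0 x1 y0 y1 \<longrightarrow>
      (\<exists>s0 s1. {s0, s1} \<in> F \<and> cyc_le [x0, s0, y0] \<and> cyc_le [x1, s1, y1]))"
    (is "(?nonzero \<longrightarrow> ?factors) \<longleftrightarrow> ?dominated")
proof (cases ?nonzero)
  case True
  then obtain f where f: "f \<in> arrows C (E U) (E Y)" "f \<noteq> \<zero>\<^bsub>Hom C (E U) (E Y)\<^esub>"
    using zero_moduleI[OF E_in_Obj[OF U] E_in_Obj[OF Y]] by blast
  have eqv: "?factors \<longleftrightarrow> (\<exists>s0 s1. {s0, s1} \<in> F \<and> cyc_le [x0, s0, y0] \<and> cyc_le [x1, s1, y1])"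
    if xy: "U = {x0, x1}" "Y = {y0, y1}" "hom_configuration Z x0 x1 y0 y1" for x0 x1 y0 y1
  proof -
    have "factors_through C (E U) (E Y) (E S) h \<longleftrightarrow>
        (\<exists>s0 s1. S = {s0, s1} \<and> cyc_le [x0, s0, y0] \<and> cyc_le [x1, s1, y1])"
      if "S \<in> F" "h \<in> arrows C (E U) (E Y)" "h \<noteq> \<zero>\<^bsub>Hom C (E U) (E Y)\<^esub>" for S h
      using factorization[of x0 x1 y0 y1 S h] that F U Y xy by blast
    then show ?thesis using f by blast
  qed
  obtain x0 x1 y0 y1 where xy: "U = {x0, x1}" "Y = {y0, y1}" "hom_configuration Z x0 x1 y0 y1"
    using True hom_nonzero_iff(1)[OF U Y] by blast
  show ?thesis
  proof
    assume "?nonzero \<longrightarrow> ?factors"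
    then have ?factors using True by (rule mp)
    then show ?dominated by (intro allI impI) (rule eqv[THEN iffD1])
  next
    assume ?dominated
    note this[THEN spec, THEN spec, THEN spec, THEN spec, THEN mp, THEN mp, THEN mp, OF xy]
    then have ?factors by (rule eqv[OF xy, THEN iffD2])
    then show "?nonzero \<longrightarrow> ?factors" ..
  qed
next
  case False
  then have "\<not> hom_configuration Z x0 x1 y0 y1" if "U = {x0, x1}" "Y = {y0, y1}" for x0 x1 y0 y1
    using hom_nonzero_iff(1)[OF U Y] that by blast
  then show ?thesis using False by simp
qed

lemma precovering_iff:
  assumes D: "\<D> \<subseteq> diagonals Z"
  shows "precovering C (add_closure C (E ` \<D>)) \<longleftrightarrow> finitely_dominated_above Z \<D>"
proof -
  have key: "(\<not> zero_module (Hom C (E U) (E Y)) \<longrightarrow> (\<exists>S\<in>F. \<exists>f\<in>arrows C (E U) (E Y).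
      f \<noteq> \<zero>\<^bsub>Hom C (E U) (E Y)\<^esub> \<and> factors_through C (E U) (E Y) (E S) f)) \<longleftrightarrow>
    (\<forall>x0 x1 y0 y1. U = {x0, x1} \<longrightarrow> Y = {y0, y1} \<longrightarrow> hom_configuration Z x0 x1 y0 y1 \<longrightarrow>
      (\<exists>s0 s1. {s0, s1} \<in> F \<and> cyc_le [x0, s0, y0] \<and> cyc_le [x1, s1, y1]))"
    if U: "U \<in> \<D>" and Y: "Y \<in> diagonals Z" and F: "F \<subseteq> \<D>" for U Y F
    by (rule nonzero_factors_iff) (use U Y F D in auto)
  show ?thesis
    unfolding thin.add_closure_eq_finite_sums[OF D] thin.precovering_finite_sums_iff[OF D]
      finitely_dominated_above_def labelled_domination[of Z \<D> "\<lambda>x0 x1 y0 y1. hom_configuration Z x0 x1 y0 y1"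
        "\<lambda>x0 x1 y0 y1 s0 s1. cyc_le [x0, s0, y0] \<and> cyc_le [x1, s1, y1]", symmetric]
    by (intro ball_cong refl ex_cong1 conj_cong) (rule key)
qed

lemma preenveloping_iff:
  assumes D: "\<D> \<subseteq> diagonals Z"
  shows "preenveloping C (add_closure C (E ` \<D>)) \<longleftrightarrow> finitely_dominated_below Z \<D>"
proof -
  have key: "(\<not> zero_module (Hom C (E Y) (E U)) \<longrightarrow> (\<exists>S\<in>F. \<exists>f\<in>arrows C (E Y) (E U).
      f \<noteq> \<zero>\<^bsub>Hom C (E Y) (E U)\<^esub> \<and> factors_through C (E Y) (E U) (E S) f)) \<longleftrightarrow>
    (\<forall>x0 x1 y0 y1. U = {x0, x1} \<longrightarrow> Y = {y0, y1} \<longrightarrow> hom_configuration Z y0 y1 x0 x1 \<longrightarrow>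
      (\<exists>s0 s1. {s0, s1} \<in> F \<and> cyc_le [y0, s0, x0] \<and> cyc_le [y1, s1, x1]))"
    if U: "U \<in> \<D>" and Y: "Y \<in> diagonals Z" and F: "F \<subseteq> \<D>" for U Y F
  proof -
    have swap: "(\<forall>x0 x1 y0 y1. A x0 x1 \<longrightarrow> B y0 y1 \<longrightarrow> R x0 x1 y0 y1) \<longleftrightarrow>
        (\<forall>y0 y1 x0 x1. B y0 y1 \<longrightarrow> A x0 x1 \<longrightarrow> R x0 x1 y0 y1)"
      for A B :: "complex \<Rightarrow> complex \<Rightarrow> bool" and R by blast
    have UF: "U \<in> diagonals Z" "F \<subseteq> diagonals Z" using U F D by auto
    show ?thesis unfolding nonzero_factors_iff[OF Y UF] by (rule swap)
  qed
  show ?thesis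
    unfolding thin.add_closure_eq_finite_sums[OF D] thin.preenveloping_finite_sums_iff[OF D]
      finitely_dominated_below_def labelled_domination[of Z \<D> "\<lambda>x0 x1 y0 y1. hom_configuration Z y0 y1 x0 x1"
        "\<lambda>x0 x1 y0 y1 s0 s1. cyc_le [y0, s0, x0] \<and> cyc_le [y1, s1, x1]", symmetric]
    by (intro ball_cong refl ex_cong1 conj_cong) (rule key)
qed

end

section \<open>Cyclic orders in coordinates\<close>

text \<open>Three reals which increase after a cyclic permutation.\<close>

definition cyc3 :: "real \<Rightarrow> real \<Rightarrow> real \<Rightarrow> bool" where
  "cyc3 r s t \<longleftrightarrow> r < s \<and> s < t \<or> s < t \<and> t < r \<or> t < r \<and> r < s"

definition cyc_between :: "('a \<Rightarrow> 'a \<Rightarrow> real) \<Rightarrow> 'a \<Rightarrow> 'a \<Rightarrow> 'a \<Rightarrow> bool" where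
  "cyc_between g x y z \<longleftrightarrow> 0 < g x y \<and> g x y < g x z"

definition in_arc :: "('a \<Rightarrow> 'a \<Rightarrow> real) \<Rightarrow> 'a \<Rightarrow> 'a \<Rightarrow> 'a \<Rightarrow> bool" where
  "in_arc g x y z \<longleftrightarrow> y = x \<or> y = z \<or> cyc_between g x y z"

text \<open>For an admissible subset of the circle these are the proper limit points, described by the order
  alone.\<close>

definition limit_point :: "'a set \<Rightarrow> ('a \<Rightarrow> 'a \<Rightarrow> real) \<Rightarrow> 'a set \<Rightarrow> 'a \<Rightarrow> bool" where
  "limit_point S g Z a \<longleftrightarrow> a \<in> S - Z \<and> (\<forall>u\<in>S - {a}. \<exists>z\<in>Z. cyc_between g u z a) \<and>
    (\<forall>u\<in>S - {a}. \<exists>z\<in>Z. cyc_between g a z u)"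

text \<open>The diagonals, without predecessors and successors: \<open>Z\<close> meets both open arcs between the ends.\<close>

definition chord :: "('a \<Rightarrow> 'a \<Rightarrow> real) \<Rightarrow> 'a set \<Rightarrow> 'a set \<Rightarrow> bool" where
  "chord g Z U \<longleftrightarrow> (\<exists>x\<in>Z. \<exists>y\<in>Z. U = {x, y} \<and> (\<exists>w\<in>Z. cyc_between g x w y) \<and> (\<exists>w\<in>Z. cyc_between g y w x))"

definition crossing :: "('a \<Rightarrow> 'a \<Rightarrow> real) \<Rightarrow> 'a set \<Rightarrow> 'a set \<Rightarrow> bool" where
  "crossing g U V \<longleftrightarrow> (\<exists>x0 x1 y0 y1. U = {x0, x1} \<and> V = {y0, y1} \<and>
    cyc_between g x0 y0 x1 \<and> cyc_between g x1 y1 x0)"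

text \<open>The condition for a nonzero map, without predecessors: \<open>y0 \<le> x1\<^sup>-\<^sup>-\<close> means that a point of \<open>Z\<close> lies
  strictly between \<open>y0\<close> and \<open>x1\<close>. In this form, reversing the orientation exchanges source and target.\<close>

definition configuration ::
    "('a \<Rightarrow> 'a \<Rightarrow> real) \<Rightarrow> 'a set \<Rightarrow> 'a \<Rightarrow> 'a \<Rightarrow> 'a \<Rightarrow> 'a \<Rightarrow> bool" where
  "configuration g Z x0 x1 y0 y1 \<longleftrightarrow> (\<exists>w\<in>Z. \<exists>w'\<in>Z.
    g x0 y0 < g x0 w \<and> g x0 w < g x0 x1 \<and> g x0 x1 \<le> g x0 y1 \<and> g x0 y1 < g x0 w')"

text \<open>This becomes \<open>finitely_dominated_above\<close> on the circle, and \<open>finitely_dominated_below\<close> after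
  reversing the orientation.\<close>

definition dominated :: "('a \<Rightarrow> 'a \<Rightarrow> real) \<Rightarrow> 'a set \<Rightarrow> 'a set set \<Rightarrow> bool" where
  "dominated g Z \<D> \<longleftrightarrow> (\<forall>y0 y1. chord g Z {y0, y1} \<longrightarrow>
    (\<exists>F. finite F \<and> F \<subseteq> \<D> \<and> (\<forall>x0 x1. {x0, x1} \<in> \<D> \<longrightarrow> configuration g Z x0 x1 y0 y1 \<longrightarrow>
      (\<exists>s0 s1. {s0, s1} \<in> F \<and> in_arc g x0 s0 y0 \<and> in_arc g x1 s1 y1))))"

definition fountain :: "'a set \<Rightarrow> ('a \<Rightarrow> 'a \<Rightarrow> real) \<Rightarrow> 'a set \<Rightarrow> 'a set set \<Rightarrow> 'a \<Rightarrow> bool" where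
  "fountain S g Z \<D> a \<longleftrightarrow> (\<exists>z\<in>Z.
    (\<forall>u\<in>S - {a}. \<exists>x\<in>Z. cyc_between g u x a \<and> {z, x} \<in> \<D>) \<and>
    (\<forall>u\<in>S - {a}. \<exists>x\<in>Z. cyc_between g a x u \<and> {z, x} \<in> \<D>))"

definition leapfrog :: "'a set \<Rightarrow> ('a \<Rightarrow> 'a \<Rightarrow> real) \<Rightarrow> 'a set \<Rightarrow> 'a set set \<Rightarrow> 'a \<Rightarrow> bool" where
  "leapfrog S g Z \<D> a \<longleftrightarrow> (\<forall>u\<in>S - {a}. \<forall>v\<in>S - {a}. \<exists>x\<in>Z. \<exists>y\<in>Z.
    cyc_between g u x a \<and> cyc_between g a y v \<and> {x, y} \<in> \<D>)"

text \<open>The end \<open>p\<close> tends to \<open>a\<close> from below while \<open>q\<close> does not follow it but stays in the arc from \<open>a\<close>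
  to \<open>m\<close>.\<close>

definition far_reaching :: "'a set \<Rightarrow> ('a \<Rightarrow> 'a \<Rightarrow> real) \<Rightarrow> 'a set \<Rightarrow> 'a set set \<Rightarrow> 'a \<Rightarrow> bool" where
  "far_reaching S g Z \<D> a \<longleftrightarrow> (\<exists>m\<in>S - {a}. \<forall>u\<in>S - {a}. \<exists>p\<in>Z. \<exists>q\<in>Z.
    {p, q} \<in> \<D> \<and> cyc_between g u p a \<and> (q = m \<or> cyc_between g a q m))"

text \<open>The coordinates for the reversed orientation. The base point \<open>c\<close> keeps the coordinate \<open>0\<close>.\<close>

definition reflect :: "('a \<Rightarrow> 'a \<Rightarrow> real) \<Rightarrow> 'a \<Rightarrow> 'a \<Rightarrow> real" where
  "reflect g c x = (if x = c then 0 else 2 * pi - g c x)"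

text \<open>A circle, given by the functions \<open>g c\<close> which measure the angle from a base point \<open>c\<close>. By the last
  assumption the cyclic order can be read off after cutting the circle at any point, so that each
  argument is free to choose a cut and to work with real numbers. The assumptions are invariant under
  \<open>reflect\<close>, which halves the work.\<close>

locale cyclic_coordinates =
  fixes S :: "'a set" and g :: "'a \<Rightarrow> 'a \<Rightarrow> real"
  assumes coord_bij: "c \<in> S \<Longrightarrow> bij_betw (g c) S {0..<2 * pi}"
    and coord_self: "c \<in> S \<Longrightarrow> g c c = 0"
    and between_change: "\<lbrakk>c \<in> S; x \<in> S; y \<in> S; z \<in> S\<rbrakk> \<Longrightarrow>
      cyc_between g x y z \<longleftrightarrow> cyc3 (g c x) (g c y) (g c z)"
begin

lemma coord_range: "\<lbrakk>c \<in> S; x \<in> S\<rbrakk> \<Longrightarrow> 0 \<le> g c x \<and> g c x < 2 * pi"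
  using bij_betw_apply[OF coord_bij] by fastforce

lemma coord_inj: "\<lbrakk>c \<in> S; x \<in> S; y \<in> S\<rbrakk> \<Longrightarrow> g c x = g c y \<longleftrightarrow> x = y"
  using coord_bij by (meson bij_betw_imp_inj_on inj_on_eq_iff)

lemma coord_pos: "\<lbrakk>c \<in> S; x \<in> S; x \<noteq> c\<rbrakk> \<Longrightarrow> 0 < g c x"
  using coord_range[of c x] coord_inj[of c x c] coord_self[of c] by force

lemma coord_surj:
  assumes "c \<in> S" "0 \<le> r" "r < 2 * pi" obtains x where "x \<in> S" "g c x = r"
  using bij_betw_imp_surj_on[OF coord_bij[OF assms(1)]] assms(2,3)
  by (metis atLeastLessThan_iff imageE)

text \<open>The first disjunct is the case of \<open>y\<close> at the base point, whose coordinate is the minimum \<open>0\<close>.\<close>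

lemma coord_less_iff_cyc3:
  assumes "x \<in> S" "y \<in> S" "z \<in> S" "c \<in> S"
  shows "g x y < g x z \<longleftrightarrow> (x = y \<and> x \<noteq> z) \<or> cyc3 (g c x) (g c y) (g c z)"
  using between_change[OF assms(4,1,2,3)] coord_self[OF assms(1)] coord_pos[OF assms(1,2)]
    coord_pos[OF assms(1,3)] coord_range[OF assms(1,2)] coord_range[OF assms(1,3)]
    coord_inj[OF assms(4,1,2)] coord_inj[OF assms(4,1,3)]
  unfolding cyc_between_def cyc3_def by force

lemma reflect_between:
  assumes "x \<in> S" "y \<in> S" "z \<in> S"
  shows "cyc_between (reflect g) x y z \<longleftrightarrow> cyc_between g z y x"
  using between_change[OF assms(1) assms(3,2,1)] coord_self[OF assms(1)]
    coord_pos[OF assms(1,2)] coord_pos[OF assms(1,3)] coord_range[OF assms(1,2)] coord_range[OF assms(1,3)]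
  unfolding cyc_between_def[of "reflect g"] reflect_def cyc3_def by auto

lemma reflect_in_arc:
  assumes "x \<in> S" "y \<in> S" "z \<in> S"
  shows "in_arc (reflect g) x y z \<longleftrightarrow> in_arc g z y x"
  using reflect_between[OF assms] by (auto simp: in_arc_def)

lemma cyclic_coordinates_reflect: "cyclic_coordinates S (reflect g)"
proof
  fix c assume c: "c \<in> S"
  show "reflect g c c = 0" by (simp add: reflect_def)
  show "bij_betw (reflect g c) S {0..<2 * pi}"
  proof (rule bij_betw_imageI)
    show "inj_on (reflect g c) S"
    proof (rule inj_onI)
      fix x y assume x: "x \<in> S" and y: "y \<in> S" and "reflect g c x = reflect g c y"
      then show "x = y"
        using coord_inj[OF c x y] coord_range[OF c x] coord_range[OF c y]
        by (auto simp: reflect_def split: if_splits)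
    qed
    show "reflect g c ` S = {0..<2 * pi}"
    proof (intro equalityI subsetI)
      fix r assume "r \<in> reflect g c ` S"
      then show "r \<in> {0..<2 * pi}"
        using coord_range[OF c] coord_pos[OF c] by (force simp: reflect_def split: if_splits)
    next
      fix r assume r: "r \<in> {0..<2 * pi}"
      show "r \<in> reflect g c ` S"
      proof (cases "r = 0")
        case True then show ?thesis using c by (auto simp: reflect_def image_iff)
      next
        case False
        then obtain x where x: "x \<in> S" "g c x = 2 * pi - r"
          using coord_surj[OF c, of "2 * pi - r"] r by auto
        then have "x \<noteq> c" using coord_self[OF c] r by auto
        then show ?thesis using x by (auto simp: reflect_def image_iff intro!: bexI[of _ x])
      qed
    qed
  qed
  fix x y z assume xyz: "x \<in> S" "y \<in> S" "z \<in> S"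
  have k: "0 \<le> g c x" "0 \<le> g c y" "0 \<le> g c z" "g c x < 2*pi" "g c y < 2*pi" "g c z < 2*pi"
    "x \<noteq> c \<Longrightarrow> 0 < g c x" "y \<noteq> c \<Longrightarrow> 0 < g c y" "z \<noteq> c \<Longrightarrow> 0 < g c z"
    using coord_range[OF c] coord_pos[OF c] xyz by auto
  show "cyc_between (reflect g) x y z \<longleftrightarrow> cyc3 (reflect g c x) (reflect g c y) (reflect g c z)"
    unfolding reflect_between[OF xyz] between_change[OF c xyz(3,2,1)]
    unfolding cyc3_def reflect_def using k coord_self[OF c] by auto
qed

lemma configuration_reflect:
  assumes Z: "Z \<subseteq> S" and x: "x0 \<in> S" "x1 \<in> S" and y: "y0 \<in> S" "y1 \<in> S"
  shows "configuration (reflect g) Z x0 x1 y0 y1 \<longleftrightarrow> configuration g Z y0 y1 x0 x1"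
proof -
  have "(reflect g x0 y0 < reflect g x0 w \<and> reflect g x0 w < reflect g x0 x1 \<and>
       reflect g x0 x1 \<le> reflect g x0 y1 \<and> reflect g x0 y1 < reflect g x0 w')
    \<longleftrightarrow> (g y0 x0 < g y0 w' \<and> g y0 w' < g y0 y1 \<and> g y0 y1 \<le> g y0 x1 \<and> g y0 x1 < g y0 w)"
    if w: "w \<in> S" "w' \<in> S" for w w'
  proof -
    note c = x(1)
    have l: "a \<le> b \<longleftrightarrow> \<not> b < a" for a b :: real by auto
    have k: "0 \<le> g x0 x1" "0 \<le> g x0 y0" "0 \<le> g x0 y1" "0 \<le> g x0 w" "0 \<le> g x0 w'"
      "g x0 x1 < 2*pi" "g x0 y0 < 2*pi" "g x0 y1 < 2*pi" "g x0 w < 2*pi" "g x0 w' < 2*pi"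
      using coord_range[OF c] x y w by auto
    have i: "x1 = x0 \<longleftrightarrow> g x0 x1 = 0" "y0 = x0 \<longleftrightarrow> g x0 y0 = 0" "y1 = x0 \<longleftrightarrow> g x0 y1 = 0"
      "w = x0 \<longleftrightarrow> g x0 w = 0" "w' = x0 \<longleftrightarrow> g x0 w' = 0"
      "y0 = y1 \<longleftrightarrow> g x0 y0 = g x0 y1" "y0 = w \<longleftrightarrow> g x0 y0 = g x0 w" "y0 = w' \<longleftrightarrow> g x0 y0 = g x0 w'"
      "y0 = x1 \<longleftrightarrow> g x0 y0 = g x0 x1" "y0 = x0 \<longleftrightarrow> g x0 y0 = 0"
      using coord_inj[OF c] coord_self[OF c] x y w by metis+
    have "g y0 x0 < g y0 w' \<longleftrightarrow> (y0 = x0 \<and> y0 \<noteq> w') \<or> cyc3 (g x0 y0) (g x0 x0) (g x0 w')"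
      "g y0 w' < g y0 y1 \<longleftrightarrow> (y0 = w' \<and> y0 \<noteq> y1) \<or> cyc3 (g x0 y0) (g x0 w') (g x0 y1)"
      "g y0 x1 < g y0 y1 \<longleftrightarrow> (y0 = x1 \<and> y0 \<noteq> y1) \<or> cyc3 (g x0 y0) (g x0 x1) (g x0 y1)"
      "g y0 x1 < g y0 w \<longleftrightarrow> (y0 = x1 \<and> y0 \<noteq> w) \<or> cyc3 (g x0 y0) (g x0 x1) (g x0 w)"
      using coord_less_iff_cyc3 x y w by blast+
    then show ?thesis
      unfolding reflect_def l i using k coord_self[OF c] unfolding cyc3_def i
      by (smt (verit))
  qed
  then show ?thesis
    unfolding configuration_def using Z by blast
qed

end

lemma doubleton_commute: "{x, y} \<in> \<D> \<longleftrightarrow> {y, x} \<in> \<D>"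
  by (simp add: insert_commute)

locale chord_family = cyclic_coordinates S g for S :: "'a set" and g +
  fixes Z :: "'a set" and \<D> :: "'a set set"
  assumes Z_subset: "Z \<subseteq> S"
    and chords: "U \<in> \<D> \<Longrightarrow> chord g Z U"
    and not_crossing: "\<lbrakk>U \<in> \<D>; V \<in> \<D>\<rbrakk> \<Longrightarrow> \<not> crossing g U V"
begin

lemma endpoints: assumes "{p, q} \<in> \<D>" shows "p \<in> Z" "q \<in> Z" "p \<noteq> q"
proof -
  obtain x y w where "x \<in> Z" "y \<in> Z" "{p, q} = {x, y}" "w \<in> Z" "cyc_between g x w y"
    using chords[OF assms] unfolding chord_def by blast
  moreover have "x \<noteq> y" if "x \<in> Z" "cyc_between g x w y" for x y w
    using that coord_self[of x] Z_subset by (auto simp: cyc_between_def)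
  ultimately show "p \<in> Z" "q \<in> Z" "p \<noteq> q" by (auto simp: doubleton_eq_iff)
qed

lemma in_S: "z \<in> Z \<Longrightarrow> z \<in> S"
  using Z_subset by blast

lemma no_linked_pair:
  assumes c: "c \<in> S" and pq: "{p, q} \<in> \<D>" and xy: "{x, y} \<in> \<D>"
    and o: "g c p < g c x" "g c x < g c q" "g c q < g c y"
  shows False
proof -
  note S = in_S[OF endpoints(1)[OF pq]] in_S[OF endpoints(2)[OF pq]]
    in_S[OF endpoints(1)[OF xy]] in_S[OF endpoints(2)[OF xy]]
  have "cyc_between g p x q" "cyc_between g q y p"
    using between_change[OF c S(1,3,2)] between_change[OF c S(2,4,1)] o by (auto simp: cyc3_def)
  then have "crossing g {p, q} {x, y}" unfolding crossing_def by blast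
  then show False using not_crossing pq xy by blast
qed

lemma chord_family_reflect: "chord_family S (reflect g) Z \<D>"
proof -
  interpret r: cyclic_coordinates S "reflect g" by (rule cyclic_coordinates_reflect)
  show ?thesis
  proof
    fix U assume U: "U \<in> \<D>"
    obtain x y w w' where "x \<in> Z" "y \<in> Z" "U = {x, y}" "w \<in> Z" "cyc_between g x w y" "w' \<in> Z" "cyc_between g y w' x"
      using chords[OF U] unfolding chord_def by blast
    then show "chord (reflect g) Z U"
      unfolding chord_def using reflect_between in_S by metis
  next
    fix U V assume U: "U \<in> \<D>" and V: "V \<in> \<D>"
    show "\<not> crossing (reflect g) U V"
    proof
      assume "crossing (reflect g) U V"
      then obtain x0 x1 y0 y1 where xy: "U = {x0, x1}" "V = {y0, y1}"
        and b: "cyc_between (reflect g) x0 y0 x1" "cyc_between (reflect g) x1 y1 x0"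
        unfolding crossing_def by blast
      have "x0 \<in> S" "x1 \<in> S" "y0 \<in> S" "y1 \<in> S"
        using endpoints[of x0 x1] endpoints[of y0 y1] U V xy in_S by auto
      then have "cyc_between g x1 y0 x0" "cyc_between g x0 y1 x1" using b reflect_between by auto
      then have "crossing g U V" unfolding crossing_def xy by (metis insert_commute)
      then show False using not_crossing U V by blast
    qed
  qed (fact Z_subset)
qed

lemma fountain_reflect: "fountain S (reflect g) Z \<D> a \<longleftrightarrow> fountain S g Z \<D> a" if a: "a \<in> S"
proof -
  have 1: "(\<forall>u\<in>S - {a}. \<exists>x\<in>Z. cyc_between (reflect g) u x a \<and> {z, x} \<in> \<D>) \<longleftrightarrow>
      (\<forall>u\<in>S - {a}. \<exists>x\<in>Z. cyc_between g a x u \<and> {z, x} \<in> \<D>)" for z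
    by (intro ball_cong bex_cong refl) (use reflect_between a in_S in auto)
  have 2: "(\<forall>u\<in>S - {a}. \<exists>x\<in>Z. cyc_between (reflect g) a x u \<and> {z, x} \<in> \<D>) \<longleftrightarrow>
      (\<forall>u\<in>S - {a}. \<exists>x\<in>Z. cyc_between g u x a \<and> {z, x} \<in> \<D>)" for z
    by (intro ball_cong bex_cong refl) (use reflect_between a in_S in auto)
  show ?thesis unfolding fountain_def 1 2 by blast
qed

lemma leapfrog_reflect: "leapfrog S (reflect g) Z \<D> a \<longleftrightarrow> leapfrog S g Z \<D> a" if a: "a \<in> S"
proof -
  have "leapfrog S (reflect g) Z \<D> a \<longleftrightarrow> (\<forall>u\<in>S - {a}. \<forall>v\<in>S - {a}. \<exists>x\<in>Z. \<exists>y\<in>Z.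
      cyc_between g a x u \<and> cyc_between g v y a \<and> {x, y} \<in> \<D>)"
    unfolding leapfrog_def
    by (intro ball_cong bex_cong refl) (use reflect_between a in_S in auto)
  moreover have "(\<exists>x\<in>Z. \<exists>y\<in>Z. cyc_between g a x u \<and> cyc_between g v y a \<and> {x, y} \<in> \<D>) \<longleftrightarrow>
      (\<exists>x\<in>Z. \<exists>y\<in>Z. cyc_between g v x a \<and> cyc_between g a y u \<and> {x, y} \<in> \<D>)" for u v
    using doubleton_commute[of _ _ \<D>] by blast
  ultimately show ?thesis unfolding leapfrog_def by blast
qed

lemma limit_point_reflect: "limit_point S (reflect g) Z a \<longleftrightarrow> limit_point S g Z a"
proof (cases "a \<in> S")
  case a: True
  have 1: "(\<forall>u\<in>S - {a}. \<exists>z\<in>Z. cyc_between (reflect g) u z a) \<longleftrightarrow> (\<forall>u\<in>S - {a}. \<exists>z\<in>Z. cyc_between g a z u)"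
    by (intro ball_cong bex_cong refl) (use reflect_between a in_S in auto)
  have 2: "(\<forall>u\<in>S - {a}. \<exists>z\<in>Z. cyc_between (reflect g) a z u) \<longleftrightarrow> (\<forall>u\<in>S - {a}. \<exists>z\<in>Z. cyc_between g u z a)"
    by (intro ball_cong bex_cong refl) (use reflect_between a in_S in auto)
  show ?thesis unfolding limit_point_def 1 2 by blast
qed (simp add: limit_point_def)

end

section \<open>From finite domination to fountains and leapfrogs\<close>

text \<open>The circle is cut at a limit point \<open>a\<close>. Then \<open>Z\<close> lies in the open interval from \<open>0\<close> to \<open>2\<pi>\<close> and
  approaches both of its ends.\<close>

locale chord_family_at_limit = chord_family S g Z \<D>
  for S :: "'a set" and g and Z :: "'a set" and \<D> +
  fixes a :: 'a
  assumes limit: "limit_point S g Z a"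
begin

abbreviation k :: "'a \<Rightarrow> real" where "k \<equiv> g a"

lemma a_in_S: "a \<in> S" and a_notin_Z: "a \<notin> Z"
  using limit by (auto simp: limit_point_def)

lemma k_pos: "z \<in> Z \<Longrightarrow> 0 < k z" and k_less: "z \<in> S \<Longrightarrow> k z < 2 * pi" and k_ge: "z \<in> S \<Longrightarrow> 0 \<le> k z"
  and k_inj: "\<lbrakk>x \<in> S; y \<in> S\<rbrakk> \<Longrightarrow> k x = k y \<longleftrightarrow> x = y" and k_a: "k a = 0"
  using coord_pos[OF a_in_S] coord_range[OF a_in_S] coord_inj[OF a_in_S] coord_self[OF a_in_S]
    in_S a_notin_Z by blast+

lemma between_k: "\<lbrakk>x \<in> S; y \<in> S; z \<in> S\<rbrakk> \<Longrightarrow> cyc_between g x y z \<longleftrightarrow> cyc3 (k x) (k y) (k z)"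
  by (rule between_change[OF a_in_S])

lemma between_to_a: "\<lbrakk>u \<in> S - {a}; z \<in> Z\<rbrakk> \<Longrightarrow> cyc_between g u z a \<longleftrightarrow> k u < k z"
  using between_k[of u z a] a_in_S in_S[of z] k_a k_pos[of z] k_ge[of u] coord_pos[of a u]
  by (auto simp: cyc3_def)

lemma between_from_a: "u \<in> S - {a} \<Longrightarrow> z \<in> Z \<Longrightarrow> cyc_between g a z u \<longleftrightarrow> k z < k u"
  using k_pos[of z] by (auto simp: cyc_between_def)

lemma level_point:
  assumes "0 < t" "t < 2 * pi" obtains u where "u \<in> S - {a}" "k u = t"
  using coord_surj[OF a_in_S, of t] assms k_a by (metis Diff_iff less_eq_real_def less_irrefl singletonD)

lemma Z_above: assumes "t < 2 * pi" obtains z where "z \<in> Z" "t < k z"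
proof -
  have "0 < max t 1" "max t 1 < 2 * pi" using assms pi_gt3 by auto
  then obtain u where u: "u \<in> S - {a}" "k u = max t 1" by (rule level_point)
  then obtain z where z: "z \<in> Z" "cyc_between g u z a" using limit unfolding limit_point_def by blast
  then show ?thesis using between_to_a[OF u(1) z(1)] u(2) that by auto
qed

lemma Z_below: assumes "0 < t" obtains z where "z \<in> Z" "k z < t"
proof -
  have "0 < min t 1" "min t 1 < 2 * pi" using assms pi_gt3 by auto
  then obtain u where u: "u \<in> S - {a}" "k u = min t 1" by (rule level_point)
  then obtain z where z: "z \<in> Z" "cyc_between g a z u" using limit unfolding limit_point_def by blast
  then show ?thesis using between_from_a[OF u(1) z(1)] u(2) that by auto
qed

lemma leapfrogI:
  assumes "\<And>t s. t < 2 * pi \<Longrightarrow> 0 < s \<Longrightarrow> \<exists>x y. {x, y} \<in> \<D> \<and> t < k x \<and> k y < s"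
  shows "leapfrog S g Z \<D> a"
  unfolding leapfrog_def
proof (intro ballI)
  fix u v assume u: "u \<in> S - {a}" and v: "v \<in> S - {a}"
  obtain x y where xy: "{x, y} \<in> \<D>" "k u < k x" "k y < k v"
    using assms[of "k u" "k v"] k_less[of u] coord_pos[OF a_in_S, of v] u v by auto
  then show "\<exists>x\<in>Z. \<exists>y\<in>Z. cyc_between g u x a \<and> cyc_between g a y v \<and> {x, y} \<in> \<D>"
    using between_to_a[OF u] between_from_a[OF v] endpoints[OF xy(1)] by blast
qed

lemma far_reachingI:
  assumes m: "0 < m" "m < 2 * pi" and "\<And>t. t < 2 * pi \<Longrightarrow> \<exists>p q. {p, q} \<in> \<D> \<and> t < k p \<and> k q \<le> m"
  shows "far_reaching S g Z \<D> a"
proof -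
  obtain v where v: "v \<in> S - {a}" "k v = m" using level_point[OF m] .
  show ?thesis
    unfolding far_reaching_def
  proof (intro bexI[OF _ v(1)] ballI)
    fix u assume u: "u \<in> S - {a}"
    then obtain p q where pq: "{p, q} \<in> \<D>" "k u < k p" "k q \<le> m" using assms(3)[of "k u"] k_less[of u] by auto
    have "q = v \<or> k q < k v" using pq v k_inj[of q v] endpoints[OF pq(1)] in_S by fastforce
    then show "\<exists>p\<in>Z. \<exists>q\<in>Z. {p, q} \<in> \<D> \<and> cyc_between g u p a \<and> (q = v \<or> cyc_between g a q v)"
      using pq between_to_a[OF u] between_from_a[OF v(1)] endpoints[OF pq(1)] by blast
  qed
qed

lemma far_reachingE:
  assumes "far_reaching S g Z \<D> a"
  obtains m where "0 < m" "m < 2 * pi" "\<And>t. t < 2 * pi \<Longrightarrow> \<exists>p q. {p, q} \<in> \<D> \<and> t < k p \<and> k q \<le> m"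
proof -
  obtain v where v: "v \<in> S - {a}" and far: "\<And>u. u \<in> S - {a} \<Longrightarrow> \<exists>p\<in>Z. \<exists>q\<in>Z.
      {p, q} \<in> \<D> \<and> cyc_between g u p a \<and> (q = v \<or> cyc_between g a q v)"
    using assms unfolding far_reaching_def by blast
  show ?thesis
  proof (rule that)
    show "0 < k v" "k v < 2 * pi" using coord_pos[OF a_in_S] k_less v by auto
    fix t :: real assume "t < 2 * pi"
    then have "0 < max t 1" "max t 1 < 2 * pi" using pi_gt3 by auto
    then obtain u where u: "u \<in> S - {a}" "k u = max t 1" by (rule level_point)
    then obtain p q where pq: "p \<in> Z" "q \<in> Z" "{p, q} \<in> \<D>" "cyc_between g u p a" "q = v \<or> cyc_between g a q v"
      using far by blast
    then have "t < k p" "k q \<le> k v"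
      using between_to_a[OF u(1)] between_from_a[OF v] u(2) by auto
    then show "\<exists>p q. {p, q} \<in> \<D> \<and> t < k p \<and> k q \<le> k v" using pq by blast
  qed
qed

lemma fountainI:
  assumes z: "z \<in> Z" and "\<And>t. t < 2 * pi \<Longrightarrow> \<exists>x. {z, x} \<in> \<D> \<and> t < k x"
    and "\<And>s. 0 < s \<Longrightarrow> \<exists>x. {z, x} \<in> \<D> \<and> k x < s"
  shows "fountain S g Z \<D> a"
  unfolding fountain_def
proof (rule bexI[OF _ z], intro conjI ballI)
  fix u assume u: "u \<in> S - {a}"
  have "k u < 2 * pi" "0 < k u" using k_less coord_pos[OF a_in_S] u by auto
  then obtain x y where x: "{z, x} \<in> \<D>" "k u < k x" and y: "{z, y} \<in> \<D>" "k y < k u" using assms(2,3) by blast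
  show "\<exists>x\<in>Z. cyc_between g u x a \<and> {z, x} \<in> \<D>" using x between_to_a[OF u] endpoints(2)[OF x(1)] by blast
  show "\<exists>x\<in>Z. cyc_between g a x u \<and> {z, x} \<in> \<D>" using y between_from_a[OF u] endpoints(2)[OF y(1)] by blast
qed

lemma chord_k:
  assumes "y0 \<in> Z" "w \<in> Z" "y1 \<in> Z" "w' \<in> Z" "k y0 < k w" "k w < k y1" "k y1 < k w'"
  shows "chord g Z {y0, y1}"
proof -
  note S = in_S[OF assms(1)] in_S[OF assms(2)] in_S[OF assms(3)] in_S[OF assms(4)]
  have "cyc_between g y0 w y1" "cyc_between g y1 w' y0"
    using between_k[OF S(1,2,3)] between_k[OF S(3,4,1)] assms(5-) by (auto simp: cyc3_def)
  then show ?thesis unfolding chord_def using assms(1-4) by blast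
qed

text \<open>Domination for the target \<open>{y0, y1}\<close>, seen from \<open>a\<close>. The points \<open>w\<close> and \<open>w'\<close> make room for a
  nonzero map. If \<open>x0\<close> lies below \<open>a\<close>, then \<open>s0\<close> may already have passed \<open>a\<close>, which is the reason
  for the disjunction.\<close>

lemma domination_at_cut:
  assumes dom: "dominated g Z \<D>" and "y0 \<in> Z" "w \<in> Z" "y1 \<in> Z" "w' \<in> Z"
    and o: "k y0 < k w" "k w < k y1" "k y1 < k w'"
  obtains F where "finite F" "F \<subseteq> \<D>"
    "\<And>x0 x1. \<lbrakk>{x0, x1} \<in> \<D>; k w' < k x0 \<or> k x0 \<le> k y0; k w < k x1; k x1 \<le> k y1\<rbrakk> \<Longrightarrow>
      \<exists>s0 s1. {s0, s1} \<in> F \<and> (k x0 \<le> k s0 \<or> k s0 \<le> k y0) \<and>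
        (k x0 \<le> k y0 \<longrightarrow> k x0 \<le> k s0 \<and> k s0 \<le> k y0) \<and> k x1 \<le> k s1 \<and> k s1 \<le> k y1"
proof -
  note S = in_S[OF assms(2)] in_S[OF assms(3)] in_S[OF assms(4)] in_S[OF assms(5)]
  obtain F where F: "finite F" "F \<subseteq> \<D>" and
    *: "\<And>x0 x1. {x0, x1} \<in> \<D> \<Longrightarrow> configuration g Z x0 x1 y0 y1 \<Longrightarrow>
      \<exists>s0 s1. {s0, s1} \<in> F \<and> in_arc g x0 s0 y0 \<and> in_arc g x1 s1 y1"
    using dom chord_k[OF assms(2-8)] unfolding dominated_def by metis
  show ?thesis
  proof (rule that[OF F])
    fix x0 x1 assume x: "{x0, x1} \<in> \<D>" and ineq: "k w' < k x0 \<or> k x0 \<le> k y0" "k w < k x1" "k x1 \<le> k y1"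
    note P = in_S[OF endpoints(1)[OF x]] in_S[OF endpoints(2)[OF x]]
    have e: "x0 = y0 \<longleftrightarrow> k x0 = k y0" using k_inj[OF P(1) S(1)] by simp
    have "configuration g Z x0 x1 y0 y1"
      unfolding configuration_def
    proof (intro bexI conjI)
      show "g x0 y0 < g x0 w" "g x0 w < g x0 x1" "g x0 y1 < g x0 w'"
        using coord_less_iff_cyc3[OF P(1) _ _ a_in_S] S P o ineq e by (auto simp: cyc3_def)
      have "\<not> g x0 y1 < g x0 x1"
        using coord_less_iff_cyc3[OF P(1) S(3) P(2) a_in_S] o ineq by (auto simp: cyc3_def)
      then show "g x0 x1 \<le> g x0 y1" by simp
    qed (use assms in auto)
    then obtain s0 s1 where s: "{s0, s1} \<in> F" "in_arc g x0 s0 y0" "in_arc g x1 s1 y1" using *[OF x] by blast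
    have D: "{s0, s1} \<in> \<D>" using s(1) F(2) by blast
    note T = in_S[OF endpoints(1)[OF D]] in_S[OF endpoints(2)[OF D]]
    have "(k x0 \<le> k s0 \<or> k s0 \<le> k y0) \<and> (k x0 \<le> k y0 \<longrightarrow> k x0 \<le> k s0 \<and> k s0 \<le> k y0)"
      using s(2) between_k[OF P(1) T(1) S(1)] by (auto simp: in_arc_def cyc3_def)
    moreover have "k x1 \<le> k s1 \<and> k s1 \<le> k y1"
      using s(3) between_k[OF P(2) T(2) S(3)] ineq by (auto simp: in_arc_def cyc3_def)
    ultimately show "\<exists>s0 s1. {s0, s1} \<in> F \<and> (k x0 \<le> k s0 \<or> k s0 \<le> k y0) \<and>
        (k x0 \<le> k y0 \<longrightarrow> k x0 \<le> k s0 \<and> k s0 \<le> k y0) \<and> k x1 \<le> k s1 \<and> k s1 \<le> k y1"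
      using s(1) by blast
  qed
qed

lemma finite_vertices:
  assumes "finite F" "F \<subseteq> \<D>" shows "finite (\<Union>F)" "\<Union>F \<subseteq> Z"
proof -
  have U: "finite U \<and> U \<subseteq> Z" if U: "U \<in> \<D>" for U
  proof -
    obtain x y where "x \<in> Z" "y \<in> Z" "U = {x, y}" using chords[OF U] unfolding chord_def by blast
    then show ?thesis by simp
  qed
  show "finite (\<Union>F)" by (rule finite_Union[OF assms(1)]) (use U assms(2) in blast)
  show "\<Union>F \<subseteq> Z" using U assms(2) by blast
qed

text \<open>Let \<open>{p, q}\<close> be the members with \<open>p\<close> tending to \<open>a\<close> from below and \<open>q\<close> bounded by \<open>m\<close>. Since \<open>a\<close> has
  no leapfrog, \<open>q\<close> also stays away from \<open>a\<close> on the other side. Take a target \<open>{y0, y1}\<close> with \<open>y0\<close>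
  just above \<open>a\<close> and \<open>y1\<close> beyond all \<open>q\<close>, and let \<open>{v, u}\<close> dominate \<open>{p, q}\<close>. Once \<open>p\<close> is closer to
  \<open>a\<close> than the finitely many possible \<open>v\<close>, the point \<open>v\<close> must have passed \<open>a\<close>. As \<open>{v, u}\<close> and
  \<open>{p, q}\<close> do not cross, \<open>u = q\<close>. So there are only finitely many \<open>q\<close>; one of them occurs for \<open>p\<close>
  arbitrarily close to \<open>a\<close>, and the points \<open>v\<close> supply the other half of a fountain there.\<close>

lemma fountain_of_far_reaching:
  assumes dom: "dominated g Z \<D>" and far: "far_reaching S g Z \<D> a"
    and no_leap: "\<not> leapfrog S g Z \<D> a"
  shows "fountain S g Z \<D> a"
proof -
  obtain m where m: "0 < m" "m < 2 * pi" and far': "\<And>t. t < 2 * pi \<Longrightarrow> \<exists>p q. {p, q} \<in> \<D> \<and> t < k p \<and> k q \<le> m"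
    using far by (rule far_reachingE) blast
  obtain t0 s0 where t0: "t0 < 2 * pi" and s0: "0 < s0"
    and gap: "\<And>x y. {x, y} \<in> \<D> \<Longrightarrow> t0 < k x \<Longrightarrow> s0 \<le> k y"
  proof -
    have "\<exists>t<2 * pi. \<exists>s>0. \<forall>x y. {x, y} \<in> \<D> \<longrightarrow> t < k x \<longrightarrow> s \<le> k y"
    proof (rule ccontr)
      assume neg: "\<not> ?thesis"
      have "leapfrog S g Z \<D> a" by (rule leapfrogI) (use neg in \<open>meson not_le\<close>)
      then show False using no_leap by blast
    qed
    then show ?thesis using that by blast
  qed
  \<comment> \<open>The bound \<open>e\<close> controls how close to \<open>a\<close> the points \<open>v\<close> are.\<close>
  have key: "\<exists>V t. finite V \<and> t < 2 * pi \<and> V \<subseteq> Z \<and> (\<forall>p q. {p, q} \<in> \<D> \<longrightarrow> t < k p \<longrightarrow> k q \<le> m \<longrightarrow>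
      q \<in> V \<and> (\<exists>v. {v, q} \<in> \<D> \<and> k v < e))" if e: "0 < e" for e
  proof -
    obtain w where w: "w \<in> Z" "k w < min e s0" using Z_below[of "min e s0"] e s0 by auto
    obtain y0 where y0: "y0 \<in> Z" "k y0 < k w" using Z_below[OF k_pos[OF w(1)]] .
    have "max m (max t0 (k w)) < 2 * pi" using m t0 k_less in_S w by auto
    then obtain y1 where y1: "y1 \<in> Z" "max m (max t0 (k w)) < k y1" by (rule Z_above)
    obtain w' where w': "w' \<in> Z" "k y1 < k w'" using Z_above[OF k_less[OF in_S[OF y1(1)]]] .
    have "k w < k y1" using y1 by simp
    obtain F where F: "finite F" "F \<subseteq> \<D>" and
      FD: "\<And>p q. \<lbrakk>{p, q} \<in> \<D>; k w' < k p; k w < k q; k q \<le> k y1\<rbrakk> \<Longrightarrow>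
        \<exists>s0 s1. {s0, s1} \<in> F \<and> (k p \<le> k s0 \<or> k s0 \<le> k y0) \<and> k q \<le> k s1 \<and> k s1 \<le> k y1"
      using domination_at_cut[OF dom y0(1) w(1) y1(1) w'(1) y0(2) \<open>k w < k y1\<close> w'(2)] by (metis (no_types, lifting))
    define t where "t = Max (insert (k w') (k ` \<Union>F))"
    have fin: "finite (insert (k w') (k ` \<Union>F))" using finite_vertices[OF F] by blast
    have "t \<in> insert (k w') (k ` \<Union>F)" unfolding t_def by (rule Max_in[OF fin]) simp
    then have t2: "t < 2 * pi" using finite_vertices[OF F] k_less in_S w'(1) by blast
    have tmax: "k w' \<le> t" "\<And>x. x \<in> \<Union>F \<Longrightarrow> k x \<le> t" unfolding t_def using fin by (auto intro: Max_ge)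
    show ?thesis
    proof (intro exI[of _ "\<Union>F"] exI[of _ t] conjI allI impI t2 finite_vertices[OF F])
      fix p q assume pq: "{p, q} \<in> \<D>" and p: "t < k p" and q: "k q \<le> m"
      have qs: "s0 \<le> k q" by (rule gap[OF pq]) (use p tmax(1) w'(2) y1(2) in auto)
      then have "k w' < k p" "k w < k q" "k q \<le> k y1" using p q tmax(1) w(2) y1(2) by auto
      then obtain v u where vu: "{v, u} \<in> F" "k p \<le> k v \<or> k v \<le> k y0" "k q \<le> k u" "k u \<le> k y1"
        using FD[OF pq] by blast
      have D: "{v, u} \<in> \<D>" using vu(1) F(2) by blast
      have "v \<in> \<Union>F" "u \<in> \<Union>F" using vu(1) by auto
      then have v: "k v \<le> k y0" using vu(2) tmax(2)[of v] p by auto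
      have "u = q"
      proof (rule ccontr)
        assume "u \<noteq> q"
        then have "k q < k u" using vu(3) k_inj[of q u] in_S endpoints[OF pq] endpoints[OF D] by fastforce
        have "k v < k q" using v y0(2) \<open>k w < k q\<close> by simp
        moreover have "k u < k p" using vu(4) w'(2) \<open>k w' < k p\<close> by simp
        moreover have "{q, p} \<in> \<D>" using pq doubleton_commute by metis
        ultimately show False using no_linked_pair[OF a_in_S D] \<open>k q < k u\<close> by blast
      qed
      then show "q \<in> \<Union>F" "\<exists>v. {v, q} \<in> \<D> \<and> k v < e"
        using \<open>u \<in> \<Union>F\<close> D v y0(2) w(2) by auto
    qed
  qed
  obtain V t where V: "finite V" "V \<subseteq> Z" and t: "t < 2 * pi"
    and hub: "\<And>p q. {p, q} \<in> \<D> \<Longrightarrow> t < k p \<Longrightarrow> k q \<le> m \<Longrightarrow> q \<in> V"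
    using key[of 1] by auto
  \<comment> \<open>Otherwise, for each of the finitely many \<open>z\<close>, the ends \<open>p\<close> joined to \<open>z\<close> stay away from \<open>a\<close>.\<close>
  have "\<exists>z\<in>V. k z \<le> m \<and> (\<forall>t<2 * pi. \<exists>p. {p, z} \<in> \<D> \<and> t < k p)"
  proof (rule ccontr)
    assume "\<not> ?thesis"
    then have "\<forall>z\<in>V. \<exists>t<2 * pi. k z \<le> m \<longrightarrow> (\<forall>p. {p, z} \<in> \<D> \<longrightarrow> k p \<le> t)"
      using t by (metis not_le)
    then obtain \<tau> where \<tau>: "\<And>z. z \<in> V \<Longrightarrow> \<tau> z < 2 * pi"
      "\<And>z p. z \<in> V \<Longrightarrow> k z \<le> m \<Longrightarrow> {p, z} \<in> \<D> \<Longrightarrow> k p \<le> \<tau> z" by metis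
    define T where "T = Max (insert t (\<tau> ` V))"
    have fin: "finite (insert t (\<tau> ` V))" using V by blast
    have "T \<in> insert t (\<tau> ` V)" unfolding T_def by (rule Max_in[OF fin]) simp
    then have "T < 2 * pi" using t \<tau>(1) by blast
    then obtain p q where pq: "{p, q} \<in> \<D>" "T < k p" "k q \<le> m" using far' by blast
    have "t \<le> T" "\<And>z. z \<in> V \<Longrightarrow> \<tau> z \<le> T" unfolding T_def using fin by (auto intro: Max_ge)
    then show False using hub[OF pq(1) _ pq(3)] \<tau>(2)[of q p] pq by fastforce
  qed
  then obtain z where z: "z \<in> V" "k z \<le> m" and right: "\<And>t. t < 2 * pi \<Longrightarrow> \<exists>p. {p, z} \<in> \<D> \<and> t < k p" by blast
  have left: "\<exists>x. {x, z} \<in> \<D> \<and> k x < e" if e: "0 < e" for e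
  proof -
    obtain t' where t': "t' < 2 * pi" and *: "\<And>p q. {p, q} \<in> \<D> \<Longrightarrow> t' < k p \<Longrightarrow> k q \<le> m \<Longrightarrow> \<exists>v. {v, q} \<in> \<D> \<and> k v < e"
      using key[OF e] by blast
    obtain p where "{p, z} \<in> \<D>" "t' < k p" using right[OF t'] by blast
    then show ?thesis using * z(2) by blast
  qed
  show ?thesis
  proof (rule fountainI)
    show "z \<in> Z" using z(1) V(2) by blast
    show "\<exists>x. {z, x} \<in> \<D> \<and> t < k x" if "t < 2 * pi" for t
      using right[OF that] by (simp add: insert_commute)
    show "\<exists>x. {z, x} \<in> \<D> \<and> k x < s" if "0 < s" for s
      using left[OF that] by (simp add: insert_commute)
  qed
qed

text \<open>Consider the members which jump over \<open>x\<close> from an end \<open>q\<close> at or before \<open>x\<close> to an end \<open>p\<close>. As none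
  of them is far-reaching, the ends \<open>p\<close> stay away from \<open>a\<close>, and by domination there is a last one. No
  member jumps over this \<open>p\<close>: it would have started at or before \<open>x\<close> and end later than \<open>p\<close>, or it
  would cross \<open>{q, p}\<close>. An end \<open>p\<close> that is the next point of \<open>Z\<close> after \<open>x\<close> escapes domination and
  is treated apart.\<close>

lemma unlinked_vertex:
  assumes dom: "dominated g Z \<D>" and not_far: "\<not> far_reaching S g Z \<D> a" and x: "x \<in> Z"
  obtains x' where "x' \<in> Z" "k x \<le> k x'" "\<And>p q. {p, q} \<in> \<D> \<Longrightarrow> k x' < k p \<Longrightarrow> k x' \<le> k q"
proof -
  have "\<exists>t<2 * pi. \<forall>p q. {p, q} \<in> \<D> \<longrightarrow> k q \<le> k x \<longrightarrow> k p \<le> t"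
  proof (rule ccontr)
    assume neg: "\<not> ?thesis"
    have "far_reaching S g Z \<D> a"
      by (rule far_reachingI[OF k_pos[OF x] k_less[OF in_S[OF x]]]) (use neg in \<open>meson not_le\<close>)
    then show False using not_far by blast
  qed
  then obtain t where t: "t < 2 * pi" "\<And>p q. {p, q} \<in> \<D> \<Longrightarrow> k q \<le> k x \<Longrightarrow> k p \<le> t" by blast
  \<comment> \<open>The point \<open>w\<close> says that \<open>p\<close> is not the next point after \<open>x\<close>.\<close>
  define M where "M = {p. \<exists>q w. {p, q} \<in> \<D> \<and> k q \<le> k x \<and> w \<in> Z \<and> k x < k w \<and> k w < k p}"
  show ?thesis
  proof (cases "M = {}")
    case False
    then obtain p1 q1 w1 where 1: "{p1, q1} \<in> \<D>" "k q1 \<le> k x" "w1 \<in> Z" "k x < k w1" "k w1 < k p1"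
      unfolding M_def by blast
    have "max t (k w1) < 2 * pi" using t k_less in_S 1 by auto
    then obtain y1 where y1: "y1 \<in> Z" "max t (k w1) < k y1" by (rule Z_above)
    obtain w' where w': "w' \<in> Z" "k y1 < k w'" using Z_above[OF k_less[OF in_S[OF y1(1)]]] .
    have "k w1 < k y1" using y1 by simp
    obtain F where F: "finite F" "F \<subseteq> \<D>"
      and FD: "\<And>q p. \<lbrakk>{q, p} \<in> \<D>; k q \<le> k x; k w1 < k p; k p \<le> k y1\<rbrakk> \<Longrightarrow>
        \<exists>s0 s1. {s0, s1} \<in> F \<and> k s0 \<le> k x \<and> k p \<le> k s1"
      using domination_at_cut[OF dom x 1(3) y1(1) w'(1) 1(4) \<open>k w1 < k y1\<close> w'(2)] by (metis (no_types, lifting))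
    define B where "B = {s1 \<in> \<Union>F. \<exists>s0. {s1, s0} \<in> \<D> \<and> k s0 \<le> k x}"
    have BF: "B \<subseteq> \<Union>F" unfolding B_def by blast
    have B: "finite B" "B \<subseteq> Z"
      using finite_subset[OF BF finite_vertices(1)[OF F]] BF finite_vertices(2)[OF F] by auto
    have cof: "\<exists>s\<in>B. k p \<le> k s" if pq: "{p, q} \<in> \<D>" "k q \<le> k x" "k w1 < k p" for p q
    proof -
      have "k p \<le> k y1" using t(2)[OF pq(1,2)] y1(2) by simp
      then obtain s0 s1 where s: "{s0, s1} \<in> F" "k s0 \<le> k x" "k p \<le> k s1"
        using FD[of q p] pq by (auto simp: insert_commute)
      then have "{s1, s0} \<in> \<D>" "s1 \<in> \<Union>F" using F(2) by (auto simp: insert_commute)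
      then have "s1 \<in> B" unfolding B_def using s(2) by blast
      then show ?thesis using s(3) by blast
    qed
    have "B \<noteq> {}" using cof[OF 1(1,2,5)] by blast
    then have "Max (k ` B) \<in> k ` B" using B(1) by simp
    then obtain p where pB: "p \<in> B" "k p = Max (k ` B)" by auto
    have p: "p \<in> B" "\<And>s. s \<in> B \<Longrightarrow> k s \<le> k p" using pB B(1) by simp_all
    obtain q where q: "{p, q} \<in> \<D>" "k q \<le> k x" using p(1) unfolding B_def by blast
    have wp: "k w1 < k p" using cof[OF 1(1,2,5)] p(2) 1(5) by fastforce
    show ?thesis
    proof (rule that)
      show "p \<in> Z" using p(1) B by blast
      show "k x \<le> k p" using wp 1(4) by simp
      fix p' q' assume pq': "{p', q'} \<in> \<D>" and p': "k p < k p'"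
      show "k p \<le> k q'"
      proof (rule ccontr)
        assume "\<not> ?thesis"
        then have q': "k q' < k p" by simp
        show False
        proof (cases "k q' \<le> k x")
          case True
          then obtain s where "s \<in> B" "k p' \<le> k s" using cof[OF pq'] wp p' by force
          then show False using p(2)[of s] p' by simp
        next
          case False
          then have "k q < k q'" using q(2) by simp
          moreover have "{q, p} \<in> \<D>" "{q', p'} \<in> \<D>" using q(1) pq' by (simp_all add: insert_commute)
          ultimately show False using no_linked_pair[OF a_in_S] q' p' by blast
        qed
      qed
    qed
  next
    case True
    have adjacent: "\<not> (k x < k w \<and> k w < k p)" if "{p, q} \<in> \<D>" "k q \<le> k x" "w \<in> Z" for p q w
      using True that unfolding M_def by blast
    show ?thesis
    proof (cases "\<exists>p q. {p, q} \<in> \<D> \<and> k x < k p \<and> k q < k x")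
      case False
      then show ?thesis using that[OF x] by (meson not_le order_refl)
    next
      case True
      then obtain p q where pq: "{p, q} \<in> \<D>" "k x < k p" "k q < k x" by blast
      show ?thesis
      proof (rule that)
        show p: "p \<in> Z" using endpoints[OF pq(1)] by blast
        show "k x \<le> k p" using pq by simp
        fix p' q' assume pq': "{p', q'} \<in> \<D>" and p': "k p < k p'"
        have "\<not> k q' \<le> k x" using adjacent[OF pq' _ p] pq p' by auto
        moreover have "\<not> (k x < k q' \<and> k q' < k p)"
          using adjacent[OF pq(1) _ endpoints(2)[OF pq']] pq(3) by simp
        ultimately show "k p \<le> k q'" by simp
      qed
    qed
  qed
qed

lemma reflected: "chord_family_at_limit S (reflect g) Z \<D> a"
  using chord_family_reflect limit limit_point_reflect
  by (simp add: chord_family_at_limit_def chord_family_at_limit_axioms_def)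

text \<open>If ends tending to \<open>a\<close> from below or from above are far-reaching, then there is a fountain or a
  leapfrog. If not, there are \<open>x'\<close> just below \<open>a\<close> and \<open>y'\<close> just above \<open>a\<close> over which no member jumps.
  The chord \<open>{y', x'}\<close> then crosses no member and belongs to \<open>\<D>\<close> by maximality, so these chords form
  a leapfrog.\<close>

lemma fountain_or_leapfrog_of_dominated:
  assumes dom: "dominated g Z \<D>" and dom': "dominated (reflect g) Z \<D>"
    and maximal: "\<And>U. chord g Z U \<Longrightarrow> (\<And>V. V \<in> \<D> \<Longrightarrow> \<not> crossing g V U) \<Longrightarrow> U \<in> \<D>"
  shows "fountain S g Z \<D> a \<or> leapfrog S g Z \<D> a"
proof -
  interpret r: chord_family_at_limit S "reflect g" Z \<D> a by (rule reflected)
  have rk: "r.k z = 2 * pi - k z" if "z \<in> Z" for z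
    using that a_notin_Z by (auto simp: reflect_def)
  show ?thesis
  proof (cases "leapfrog S g Z \<D> a \<or> far_reaching S g Z \<D> a \<or> far_reaching S (reflect g) Z \<D> a")
    case True
    then show ?thesis
      using fountain_of_far_reaching[OF dom] r.fountain_of_far_reaching[OF dom']
        fountain_reflect[OF a_in_S] leapfrog_reflect[OF a_in_S] by blast
  next
    case False
    have "leapfrog S g Z \<D> a"
    proof (rule leapfrogI)
      fix t s :: real assume t: "t < 2 * pi" and s: "0 < s"
      obtain x where x: "x \<in> Z" "t < k x" using Z_above[OF t] .
      \<comment> \<open>The points \<open>w\<close> and \<open>w'\<close> lie in the two arcs between \<open>y'\<close> and \<open>x'\<close> and make \<open>{y', x'}\<close> a chord.\<close>
      obtain w where w: "w \<in> Z" "k w < k x" using Z_below[OF k_pos[OF x(1)]] .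
      have "0 < min s (k w)" using s k_pos[OF w(1)] by simp
      then obtain y where y: "y \<in> Z" "k y < min s (k w)" by (rule Z_below)
      obtain x' where x': "x' \<in> Z" "k x \<le> k x'" "\<And>p q. {p, q} \<in> \<D> \<Longrightarrow> k x' < k p \<Longrightarrow> k x' \<le> k q"
        using unlinked_vertex[OF dom _ x(1)] False by blast
      obtain y' where y': "y' \<in> Z" "r.k y \<le> r.k y'"
        and y'': "\<And>p q. {p, q} \<in> \<D> \<Longrightarrow> r.k y' < r.k p \<Longrightarrow> r.k y' \<le> r.k q"
        using r.unlinked_vertex[OF dom' _ y(1)] False by blast
      have yy: "k y' \<le> k y" using y'(2) rk y(1) y'(1) by simp
      have y3: "k q \<le> k y'" if "{p, q} \<in> \<D>" "k p < k y'" for p q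
        using y''[OF that(1)] that(2) rk endpoints[OF that(1)] y'(1) by simp
      obtain w' where w': "w' \<in> Z" "k x' < k w'" using Z_above[OF k_less[OF in_S[OF x'(1)]]] .
      have o: "k y' < k w" "k w < k x'" using yy y(2) w(2) x'(2) by auto
      note S = in_S[OF x'(1)] in_S[OF y'(1)]
      have "{y', x'} \<in> \<D>"
      proof (rule maximal[OF chord_k[OF y'(1) w(1) x'(1) w'(1) o w'(2)]])
        fix V assume V: "V \<in> \<D>"
        show "\<not> crossing g V {y', x'}"
        proof
          assume "crossing g V {y', x'}"
          then obtain p0 p1 q0 q1 where p: "V = {p0, p1}" and q: "{y', x'} = {q0, q1}"
            and b: "cyc_between g p0 q0 p1" "cyc_between g p1 q1 p0" unfolding crossing_def by blast
          have pD: "{p0, p1} \<in> \<D>" "{p1, p0} \<in> \<D>" using V p by (simp_all add: insert_commute)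
          note P = in_S[OF endpoints(1)[OF pD(1)]] in_S[OF endpoints(2)[OF pD(1)]]
          have "q0 = y' \<and> q1 = x' \<or> q0 = x' \<and> q1 = y'" using q by (auto simp: doubleton_eq_iff)
          then have "cyc3 (k p0) (k y') (k p1) \<and> cyc3 (k p1) (k x') (k p0) \<or>
              cyc3 (k p0) (k x') (k p1) \<and> cyc3 (k p1) (k y') (k p0)"
            using b between_k[OF P(1) _ P(2)] between_k[OF P(2) _ P(1)] S by auto
          then show False
            using x'(3)[OF pD(1)] x'(3)[OF pD(2)] y3[OF pD(1)] y3[OF pD(2)] o
            unfolding cyc3_def by linarith
        qed
      qed
      then show "\<exists>x y. {x, y} \<in> \<D> \<and> t < k x \<and> k y < s"
        using x(2) x'(2) y(2) yy by (intro exI[of _ x'] exI[of _ y']) (auto simp: insert_commute)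
    qed
    then show ?thesis by blast
  qed
qed

end

section \<open>From fountains and leapfrogs to finite domination\<close>

lemma compact_finite_cover_property:
  fixes K :: "'b::topological_space set"
  assumes "compact K" and local: "\<And>x. x \<in> K \<Longrightarrow> \<exists>T. open T \<and> x \<in> T \<and> Q T"
    and empty: "Q {}" and union: "\<And>A B. Q A \<Longrightarrow> Q B \<Longrightarrow> Q (A \<union> B)"
    and mono: "\<And>A B. A \<subseteq> B \<Longrightarrow> Q B \<Longrightarrow> Q A"
  shows "Q K"
proof -
  obtain T where T: "\<And>x. x \<in> K \<Longrightarrow> open (T x) \<and> x \<in> T x \<and> Q (T x)" using local by metis
  obtain F where F: "F \<subseteq> K" "finite F" "K \<subseteq> (\<Union>x\<in>F. T x)"
    by (rule compactE_image[OF assms(1), of K T]) (use T in auto)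
  have "Q (\<Union>x\<in>F. T x)"
    using F(2,1) by (induction F rule: finite_induct) (use T empty union in auto)
  then show ?thesis using mono F(3) by blast
qed

context chord_family
begin

text \<open>The pairs to be dominated for the target \<open>{y0, y1}\<close>: \<open>x0\<close> lies in the arc from \<open>y1\<close> to \<open>y0\<close> and
  \<open>x1\<close> in the arc from \<open>y0\<close> to \<open>y1\<close>. Each arc has the angle from its own starting point as coordinate,
  so that the pairs lie in a rectangle and domination is the product order.\<close>

definition pairs_below :: "'a \<Rightarrow> 'a \<Rightarrow> ('a \<times> 'a) set" where
  "pairs_below y0 y1 = {(x0, x1). {x0, x1} \<in> \<D> \<and>
    0 < g y0 x1 \<and> g y0 x1 \<le> g y0 y1 \<and> 0 < g y1 x0 \<and> g y1 x0 \<le> g y1 y0}"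

definition covers :: "'a \<Rightarrow> 'a \<Rightarrow> ('a \<times> 'a) set \<Rightarrow> ('a \<times> 'a) set \<Rightarrow> bool" where
  "covers y0 y1 F A \<longleftrightarrow> (\<forall>(x0, x1)\<in>A. \<exists>(s0, s1)\<in>F. g y1 x0 \<le> g y1 s0 \<and> g y0 x1 \<le> g y0 s1)"

text \<open>If a member of \<open>\<D>\<close> bridges \<open>c\<close> inside the arc from \<open>y0\<close> to \<open>y1\<close>, then it crosses each pair with
  \<open>x1\<close> under the bridge, and near \<open>c\<close> there is nothing to cover. A leapfrog at \<open>c\<close> contains a bridge,
  and so does a fountain at \<open>c\<close> whose centre \<open>z\<close> lies in this arc. If \<open>z\<close> lies in the other arc, then
  arms \<open>{z, p}\<close> and \<open>{z, q}\<close> ending on the two sides of \<open>c\<close> cross each pair with \<open>x1\<close> between \<open>p\<close> and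
  \<open>q\<close> unless \<open>x0 = z\<close>, so that \<open>(z, q)\<close> alone covers them.\<close>

lemma coverage_near_limit:
  assumes y: "y0 \<in> Z" "y1 \<in> Z" and c: "limit_point S g Z c" "g y0 c < g y0 y1"
    and fl: "fountain S g Z \<D> c \<or> leapfrog S g Z \<D> c"
  obtains l u F where "l < g y0 c" "g y0 c < u" "finite F" "F \<subseteq> pairs_below y0 y1"
    "covers y0 y1 F {(x0, x1) \<in> pairs_below y0 y1. l < g y0 x1 \<and> g y0 x1 < u}"
proof -
  let ?k = "g y0"
  have Y: "y0 \<in> S" "y1 \<in> S" and cS: "c \<in> S" and cZ: "c \<notin> Z"
    using y in_S c by (auto simp: limit_point_def)
  have k0: "?k y0 = 0" by (rule coord_self[OF Y(1)])
  have kge: "0 \<le> ?k z" if "z \<in> S" for z using coord_range[OF Y(1) that] by simp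
  have kpos: "0 < ?k z" if "z \<in> S" "z \<noteq> y0" for z by (rule coord_pos[OF Y(1) that])
  have kinj: "?k x = ?k z \<longleftrightarrow> x = z" if "x \<in> S" "z \<in> S" for x z by (rule coord_inj[OF Y(1) that])
  note bk = between_change[OF Y(1)]
  have cy: "c \<in> S" "c \<noteq> y0" "0 < ?k c" using cS cZ y kpos by auto
  have y1c: "y1 \<in> S - {c}" "y0 \<in> S - {c}" "y0 \<noteq> y1" using y cZ Y c(2) k0 cy(3) by auto
  have mem: "(x0, x1) \<in> pairs_below y0 y1 \<longleftrightarrow> {x0, x1} \<in> \<D> \<and> 0 < ?k x1 \<and> ?k x1 \<le> ?k y1 \<and>
      (x0 = y0 \<or> ?k y1 < ?k x0)" for x0 x1
  proof (cases "{x0, x1} \<in> \<D>")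
    case True
    then have X: "x0 \<in> S" using endpoints in_S by blast
    have "0 < g y1 x0 \<and> g y1 x0 \<le> g y1 y0 \<longleftrightarrow> x0 = y0 \<or> cyc_between g y1 x0 y0"
      using coord_inj[OF Y(2) X Y(1)] coord_pos[OF Y(2,1)] y1c by (auto simp: cyc_between_def)
    also have "\<dots> \<longleftrightarrow> x0 = y0 \<or> ?k y1 < ?k x0"
      using bk[OF Y(2) X Y(1)] k0 kge[OF X] kpos[OF Y(2)] y1c(3) by (auto simp: cyc3_def)
    finally show ?thesis using True by (auto simp: pairs_below_def)
  qed (auto simp: pairs_below_def)
  have below: "cyc_between g y0 x c \<longleftrightarrow> 0 < ?k x \<and> ?k x < ?k c" for x by (simp add: cyc_between_def)
  have above: "cyc_between g c x y1 \<longleftrightarrow> ?k c < ?k x \<and> ?k x < ?k y1" if "x \<in> Z" for x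
    using bk[OF cS in_S[OF that] Y(2)] c(2) by (auto simp: cyc3_def)
  note nolink = no_linked_pair[OF Y(1)]
  have comm: "{x, z} \<in> \<D> \<Longrightarrow> {z, x} \<in> \<D>" for x z by (simp add: insert_commute)
  note covered = that
  have bridged: thesis if D: "{p, q} \<in> \<D>" and o: "0 < ?k p" "?k p < ?k c" "?k c < ?k q" "?k q \<le> ?k y1" for p q
  proof (rule covered[of "?k p" "?k q" "{}"])
    have "\<not> (?k p < ?k x1 \<and> ?k x1 < ?k q)" if P: "(x0, x1) \<in> pairs_below y0 y1" for x0 x1
    proof
      assume i: "?k p < ?k x1 \<and> ?k x1 < ?k q"
      have E: "{x0, x1} \<in> \<D>" and "x0 = y0 \<or> ?k y1 < ?k x0" using P mem by auto
      then show False
        using nolink[of x0 x1 p q] nolink[of p q x1 x0] D comm i o k0 by auto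
    qed
    then show "covers y0 y1 {} {(x0, x1) \<in> pairs_below y0 y1. ?k p < ?k x1 \<and> ?k x1 < ?k q}"
      by (auto simp: covers_def)
  qed (use o in auto)
  show ?thesis
    using fl
  proof
    assume "leapfrog S g Z \<D> c"
    then obtain p q where pq: "p \<in> Z" "q \<in> Z" "cyc_between g y0 p c" "cyc_between g c q y1" "{p, q} \<in> \<D>"
      unfolding leapfrog_def using y1c by blast
    then show ?thesis by (intro bridged[OF pq(5)]) (use below above in auto)
  next
    assume "fountain S g Z \<D> c"
    then obtain z where z: "z \<in> Z" and down: "\<And>u. u \<in> S - {c} \<Longrightarrow> \<exists>x\<in>Z. cyc_between g u x c \<and> {z, x} \<in> \<D>"
      and up: "\<And>u. u \<in> S - {c} \<Longrightarrow> \<exists>x\<in>Z. cyc_between g c x u \<and> {z, x} \<in> \<D>"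
      unfolding fountain_def by blast
    obtain p where p: "p \<in> Z" "cyc_between g y0 p c" "{z, p} \<in> \<D>" using down[OF y1c(2)] by blast
    obtain q where q: "q \<in> Z" "cyc_between g c q y1" "{z, q} \<in> \<D>" using up[OF y1c(1)] by blast
    have o: "0 < ?k p" "?k p < ?k c" "?k c < ?k q" "?k q < ?k y1" using p q below above by auto
    have zc: "?k z \<noteq> ?k c" using kinj[OF in_S[OF z] cS] z cZ by auto
    consider (out) "z = y0 \<or> ?k y1 < ?k z" | (right) "?k c < ?k z" "?k z \<le> ?k y1" | (left) "0 < ?k z" "?k z < ?k c"
      using zc kpos[OF in_S[OF z]] by fastforce
    then show ?thesis
    proof cases
      case out
      have hub: "x0 = z" if "(x0, x1) \<in> pairs_below y0 y1" "?k p < ?k x1" "?k x1 < ?k q" for x0 x1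
      proof (rule ccontr)
        assume "x0 \<noteq> z"
        have D: "{x0, x1} \<in> \<D>" and x0: "x0 = y0 \<or> ?k y1 < ?k x0" using that mem by auto
        have i: "?k p < ?k x1" "?k x1 < ?k q" "{x1, x0} \<in> \<D>" "{p, z} \<in> \<D>" "{q, z} \<in> \<D>"
          using that D p(3) q(3) by (simp_all add: insert_commute)
        have "?k x0 \<noteq> ?k z" using kinj[OF in_S[OF endpoints(1)[OF D]] in_S[OF z]] \<open>x0 \<noteq> z\<close> by simp
        then consider "?k x0 < ?k z" "x0 = y0" | "?k x0 < ?k z" "?k y1 < ?k x0" |
            "?k z < ?k x0" "z = y0" | "?k z < ?k x0" "?k y1 < ?k z"
          using x0 out by linarith
        then show False
        proof cases
          case 1 show False by (rule nolink[OF D i(4)]) (use 1 i o out k0 in auto)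
        next
          case 2 show False by (rule nolink[OF i(3,5)]) (use 2 i o in auto)
        next
          case 3 show False by (rule nolink[OF q(3) i(3)]) (use 3 i o x0 k0 in auto)
        next
          case 4 show False by (rule nolink[OF i(4,3)]) (use 4 i o in auto)
        qed
      qed
      have "(z, q) \<in> pairs_below y0 y1" using mem q(3) o out by auto
      then show ?thesis
        by (intro that[of "?k p" "?k q" "{(z, q)}"]) (use o hub in \<open>auto simp: covers_def\<close>)
    next
      case right
      show ?thesis by (rule bridged[of p z]) (use p(3) comm o right in auto)
    next
      case left
      show ?thesis by (rule bridged[OF q(3)]) (use o left in auto)
    qed
  qed
qed

text \<open>A point that is not a limit point has a free arc on either side. If such an arc contains the base
  point \<open>y\<close>, where the coordinate jumps, then a bound outside the range of coordinates takes its place.\<close>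

lemma isolated_coordinate:
  assumes c: "c \<in> S" "\<not> limit_point S g Z c" and y: "y \<in> S"
    and below: "(\<And>u. u \<in> S - {c} \<Longrightarrow> \<exists>z\<in>Z. cyc_between g u z c) \<Longrightarrow> limit_point S g Z c"
    and above: "(\<And>u. u \<in> S - {c} \<Longrightarrow> \<exists>z\<in>Z. cyc_between g c z u) \<Longrightarrow> limit_point S g Z c"
  obtains l u where "l < g y c" "g y c < u" "\<And>x. x \<in> Z \<Longrightarrow> l < g y x \<Longrightarrow> g y x < u \<Longrightarrow> x = c"
proof -
  obtain p where p: "p \<in> S - {c}" "\<And>z. z \<in> Z \<Longrightarrow> \<not> cyc_between g p z c" using below c(2) by blast
  obtain q where q: "q \<in> S - {c}" "\<And>z. z \<in> Z \<Longrightarrow> \<not> cyc_between g c z q" using above c(2) by blast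
  let ?k = "g y"
  have pq: "p \<in> S" "q \<in> S" "?k p \<noteq> ?k c" "?k q \<noteq> ?k c"
    using p(1) q(1) coord_inj[OF y _ c(1)] by auto
  define l where "l = (if ?k p < ?k c then ?k p else ?k c - 1)"
  define u where "u = (if ?k c < ?k q then ?k q else ?k c + 1)"
  show ?thesis
  proof (rule that)
    show "l < ?k c" "?k c < u" by (auto simp: l_def u_def)
    fix x assume x: "x \<in> Z" and lx: "l < ?k x" and xu: "?k x < u"
    have "\<not> cyc3 (?k p) (?k x) (?k c)" "\<not> cyc3 (?k c) (?k x) (?k q)"
      using p(2)[OF x] q(2)[OF x] between_change[OF y pq(1) in_S[OF x] c(1)]
        between_change[OF y c(1) in_S[OF x] pq(2)] by auto
    then have "?k x = ?k c"
      using lx xu pq(3,4) unfolding cyc3_def l_def u_def by (auto split: if_splits)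
    then show "x = c" using coord_inj[OF y in_S[OF x] c(1)] by simp
  qed
qed

text \<open>The rectangle is compact, so it suffices to cover the pairs near each of its points \<open>(r, s)\<close>. If
  one coordinate is that of a limit point, the lemma \<open>coverage_near_limit\<close> does this; otherwise
  at most one pair is near.\<close>

lemma dominated_of_fountains_and_leapfrogs:
  assumes below: "\<And>a. a \<in> S \<Longrightarrow> (\<And>u. u \<in> S - {a} \<Longrightarrow> \<exists>z\<in>Z. cyc_between g u z a) \<Longrightarrow> limit_point S g Z a"
    and above: "\<And>a. a \<in> S \<Longrightarrow> (\<And>u. u \<in> S - {a} \<Longrightarrow> \<exists>z\<in>Z. cyc_between g a z u) \<Longrightarrow> limit_point S g Z a"
    and fl: "\<And>a. limit_point S g Z a \<Longrightarrow> fountain S g Z \<D> a \<or> leapfrog S g Z \<D> a"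
  shows "dominated g Z \<D>"
  unfolding dominated_def
proof (intro allI impI)
  fix y0 y1 assume ch: "chord g Z {y0, y1}"
  have y: "y0 \<in> Z" "y1 \<in> Z" "y0 \<noteq> y1"
  proof -
    obtain x x' w where x: "x \<in> Z" "x' \<in> Z" "{y0, y1} = {x, x'}" "cyc_between g x w x'"
      using ch unfolding chord_def by blast
    have "x \<noteq> x'" using x(4) coord_self[OF in_S[OF x(1)]] by (auto simp: cyc_between_def)
    then show "y0 \<in> Z" "y1 \<in> Z" "y0 \<noteq> y1" using x by (auto simp: doubleton_eq_iff)
  qed
  note Y = in_S[OF y(1)] in_S[OF y(2)]
  let ?P = "pairs_below y0 y1"
  define Q where "Q T \<longleftrightarrow> (\<exists>F. finite F \<and> F \<subseteq> ?P \<and>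
    covers y0 y1 F {(x0, x1) \<in> ?P. (g y1 x0, g y0 x1) \<in> T})" for T
  have "Q ({0..g y1 y0} \<times> {0..g y0 y1})"
  proof (rule compact_finite_cover_property)
    show "Q {}" unfolding Q_def covers_def by (rule exI[of _ "{}"]) auto
    show "Q (A \<union> B)" if A: "Q A" and B: "Q B" for A B
    proof -
      obtain F G where "finite F" "F \<subseteq> ?P" "covers y0 y1 F {(x0, x1) \<in> ?P. (g y1 x0, g y0 x1) \<in> A}"
        "finite G" "G \<subseteq> ?P" "covers y0 y1 G {(x0, x1) \<in> ?P. (g y1 x0, g y0 x1) \<in> B}"
        using A B unfolding Q_def by blast
      then show ?thesis unfolding Q_def
        by (intro exI[of _ "F \<union> G"]) (fastforce simp: covers_def)
    qed
    show "Q A" if AB: "A \<subseteq> B" "Q B" for A B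
    proof -
      obtain F where "finite F" "F \<subseteq> ?P" "covers y0 y1 F {(x0, x1) \<in> ?P. (g y1 x0, g y0 x1) \<in> B}"
        using AB(2) unfolding Q_def by blast
      then show ?thesis unfolding Q_def
        by (intro exI[of _ F]) (use AB(1) in \<open>fastforce simp: covers_def\<close>)
    qed
    show "\<exists>T. open T \<and> rs \<in> T \<and> Q T" if rs: "rs \<in> {0..g y1 y0} \<times> {0..g y0 y1}" for rs
    proof -
      obtain r s where rs': "rs = (r, s)" "0 \<le> r" "r \<le> g y1 y0" "0 \<le> s" "s \<le> g y0 y1" using rs by auto
      have "r < 2 * pi" "s < 2 * pi"
        using rs' coord_range[OF Y(2,1)] coord_range[OF Y(1,2)] by auto
      obtain c where c: "c \<in> S" "g y1 c = r" using coord_surj[OF Y(2) rs'(2) \<open>r < 2 * pi\<close>] .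
      obtain d where d: "d \<in> S" "g y0 d = s" using coord_surj[OF Y(1) rs'(4) \<open>s < 2 * pi\<close>] .
      consider (snd) "limit_point S g Z d" | (fst) "limit_point S g Z c"
        | (neither) "\<not> limit_point S g Z c" "\<not> limit_point S g Z d" by blast
      then show ?thesis
      proof cases
        case snd
        then have "d \<noteq> y1" using y by (auto simp: limit_point_def)
        then have "g y0 d < g y0 y1" using rs' d coord_inj[OF Y(1) d(1) Y(2)] by simp
        then obtain l u F where F: "l < g y0 d" "g y0 d < u" "finite F" "F \<subseteq> ?P"
          "covers y0 y1 F {(x0, x1) \<in> ?P. l < g y0 x1 \<and> g y0 x1 < u}"
          using coverage_near_limit[OF y(1,2) snd _ fl[OF snd]] by blast
        have "{(x0, x1) \<in> ?P. (g y1 x0, g y0 x1) \<in> UNIV \<times> {l<..<u}} =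
            {(x0, x1) \<in> ?P. l < g y0 x1 \<and> g y0 x1 < u}" by auto
        then have "Q (UNIV \<times> {l<..<u})" unfolding Q_def using F by auto
        moreover have "open (UNIV \<times> {l<..<u} :: (real \<times> real) set)" by (intro open_Times) auto
        ultimately show ?thesis using F(1,2) rs' d by (intro exI[of _ "UNIV \<times> {l<..<u}"]) auto
      next
        case fst
        then have "c \<noteq> y0" using y by (auto simp: limit_point_def)
        then have "g y1 c < g y1 y0" using rs' c coord_inj[OF Y(2) c(1) Y(1)] by simp
        then obtain l u F where F: "l < g y1 c" "g y1 c < u" "finite F" "F \<subseteq> pairs_below y1 y0"
          "covers y1 y0 F {(x1, x0) \<in> pairs_below y1 y0. l < g y1 x0 \<and> g y1 x0 < u}"
          using coverage_near_limit[OF y(2,1) fst _ fl[OF fst]] by blast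
        have swap: "(x0, x1) \<in> ?P \<longleftrightarrow> (x1, x0) \<in> pairs_below y1 y0" for x0 x1
          unfolding pairs_below_def by (auto simp: insert_commute)
        have "covers y0 y1 (prod.swap ` F) {(x0, x1) \<in> ?P. (g y1 x0, g y0 x1) \<in> {l<..<u} \<times> UNIV}"
          unfolding covers_def
        proof (rule ballI)
          fix xx assume xx: "xx \<in> {(x0, x1) \<in> ?P. (g y1 x0, g y0 x1) \<in> {l<..<u} \<times> UNIV}"
          obtain x0 x1 where x01: "xx = (x0, x1)" by (cases xx)
          have "(x1, x0) \<in> {(x1, x0) \<in> pairs_below y1 y0. l < g y1 x0 \<and> g y1 x0 < u}"
            using swap xx x01 by auto
          then obtain s1 s0 where s: "(s1, s0) \<in> F" "g y0 x1 \<le> g y0 s1" "g y1 x0 \<le> g y1 s0"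
            using F(5) unfolding covers_def by blast
          have "(s0, s1) \<in> prod.swap ` F" using s(1) by force
          then show "case xx of (x0, x1) \<Rightarrow> \<exists>(s0, s1)\<in>prod.swap ` F. g y1 x0 \<le> g y1 s0 \<and> g y0 x1 \<le> g y0 s1"
            unfolding x01 prod.case by (rule bexI[rotated]) (use s in simp)
        qed
        moreover have "prod.swap ` F \<subseteq> ?P" using F(4) swap by auto
        ultimately have "Q ({l<..<u} \<times> UNIV)" unfolding Q_def using F(3) by blast
        moreover have "open ({l<..<u} \<times> UNIV :: (real \<times> real) set)" by (intro open_Times) auto
        ultimately show ?thesis using F(1,2) rs' c by (intro exI[of _ "{l<..<u} \<times> UNIV"]) auto
      next
        case neither
        obtain l u where 1: "l < g y0 d" "g y0 d < u" "\<And>x. x \<in> Z \<Longrightarrow> l < g y0 x \<Longrightarrow> g y0 x < u \<Longrightarrow> x = d"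
          using isolated_coordinate[OF d(1) neither(2) Y(1) below[OF d(1)] above[OF d(1)]] by blast
        obtain l' u' where 2: "l' < g y1 c" "g y1 c < u'" "\<And>x. x \<in> Z \<Longrightarrow> l' < g y1 x \<Longrightarrow> g y1 x < u' \<Longrightarrow> x = c"
          using isolated_coordinate[OF c(1) neither(1) Y(2) below[OF c(1)] above[OF c(1)]] by blast
        have "x0 = c \<and> x1 = d" if "(x0, x1) \<in> ?P" "l' < g y1 x0" "g y1 x0 < u'" "l < g y0 x1" "g y0 x1 < u" for x0 x1
        proof -
          have D: "{x0, x1} \<in> \<D>" using that(1) by (simp add: pairs_below_def)
          show ?thesis using 1(3)[OF endpoints(2)[OF D] that(4,5)] 2(3)[OF endpoints(1)[OF D] that(2,3)] by blast
        qed
        then have "covers y0 y1 (?P \<inter> {(c, d)}) {(x0, x1) \<in> ?P. (g y1 x0, g y0 x1) \<in> {l'<..<u'} \<times> {l<..<u}}"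
          unfolding covers_def by fastforce
        then have "Q ({l'<..<u'} \<times> {l<..<u})"
          unfolding Q_def by (intro exI[of _ "?P \<inter> {(c, d)}"]) auto
        moreover have "open ({l'<..<u'} \<times> {l<..<u} :: (real \<times> real) set)" by (intro open_Times) auto
        ultimately show ?thesis
          using 1(1,2) 2(1,2) rs' c d by (intro exI[of _ "{l'<..<u'} \<times> {l<..<u}"]) auto
      qed
    qed
  qed (intro compact_Times compact_Icc)
  then obtain F where F: "finite F" "F \<subseteq> ?P"
    and cov: "covers y0 y1 F {(x0, x1) \<in> ?P. (g y1 x0, g y0 x1) \<in> {0..g y1 y0} \<times> {0..g y0 y1}}"
    unfolding Q_def by blast
  show "\<exists>F. finite F \<and> F \<subseteq> \<D> \<and> (\<forall>x0 x1. {x0, x1} \<in> \<D> \<longrightarrow> configuration g Z x0 x1 y0 y1 \<longrightarrow>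
      (\<exists>s0 s1. {s0, s1} \<in> F \<and> in_arc g x0 s0 y0 \<and> in_arc g x1 s1 y1))"
  proof (intro exI[of _ "(\<lambda>(s0, s1). {s0, s1}) ` F"] conjI allI impI)
    show "finite ((\<lambda>(s0, s1). {s0, s1}) ` F)" using F by simp
    show "(\<lambda>(s0, s1). {s0, s1}) ` F \<subseteq> \<D>" using F(2) by (auto simp: pairs_below_def)
    fix x0 x1 assume D: "{x0, x1} \<in> \<D>" and conf: "configuration g Z x0 x1 y0 y1"
    note XS = in_S[OF endpoints(1)[OF D]] in_S[OF endpoints(2)[OF D]]
    have o: "g x0 y0 < g x0 x1" "g x0 x1 \<le> g x0 y1" using conf unfolding configuration_def by force+
    have k0: "g x0 x0 = 0" "0 \<le> g x0 y0" "x0 = y0 \<longleftrightarrow> g x0 y0 = 0" "x1 = y1 \<longleftrightarrow> g x0 x1 = g x0 y1"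
      using coord_self coord_range coord_inj[OF XS(1)] XS Y by metis+
    have arc1: "x1 = y1 \<or> cyc_between g y0 x1 y1"
      using between_change[OF XS(1) Y(1) XS(2) Y(2)] o k0 by (auto simp: cyc3_def)
    have arc0: "x0 = y0 \<or> cyc_between g y1 x0 y0"
      using between_change[OF XS(1) Y(2) XS(1) Y(1)] o k0 by (auto simp: cyc3_def)
    have pos: "0 < g y0 y1" "0 < g y1 y0" using coord_pos Y y(3) by auto
    have P: "(x0, x1) \<in> ?P" "(g y1 x0, g y0 x1) \<in> {0..g y1 y0} \<times> {0..g y0 y1}"
      using arc0 arc1 pos D by (auto simp: pairs_below_def cyc_between_def)
    then obtain s0 s1 where s: "(s0, s1) \<in> F" "g y1 x0 \<le> g y1 s0" "g y0 x1 \<le> g y0 s1"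
      using cov unfolding covers_def by fastforce
    have sP: "(s0, s1) \<in> ?P" using s(1) F(2) by blast
    then have sD: "{s0, s1} \<in> \<D>" and sr: "g y0 s1 \<le> g y0 y1" "g y1 s0 \<le> g y1 y0" by (auto simp: pairs_below_def)
    note SS = in_S[OF endpoints(1)[OF sD]] in_S[OF endpoints(2)[OF sD]]
    have pos': "0 < g y0 x1" "0 < g y1 x0" using P(1) by (auto simp: pairs_below_def)
    have "in_arc g x0 s0 y0"
      unfolding in_arc_def between_change[OF Y(2) XS(1) SS(1) Y(1)] cyc3_def
      using s(2) sr(2) coord_inj[OF Y(2) SS(1) XS(1)] coord_inj[OF Y(2) SS(1) Y(1)] by linarith
    moreover have "in_arc g x1 s1 y1"
      unfolding in_arc_def between_change[OF Y(1) XS(2) SS(2) Y(2)] cyc3_def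
      using s(3) sr(1) coord_inj[OF Y(1) SS(2) XS(2)] coord_inj[OF Y(1) SS(2) Y(2)] by linarith
    ultimately show "\<exists>s0 s1. {s0, s1} \<in> (\<lambda>(s0, s1). {s0, s1}) ` F \<and> in_arc g x0 s0 y0 \<and> in_arc g x1 s1 y1"
      using s(1) by (intro exI[of _ s0] exI[of _ s1]) (auto intro: image_eqI[of _ _ "(s0, s1)"])
  qed
qed

end

section \<open>The circle\<close>

lemma angle_from_range: "0 \<le> angle_from c x" "angle_from c x < 2 * pi"
  using Arg2pi by (auto simp: angle_from_def)

lemma circle_nonzero: "c \<in> circle \<Longrightarrow> c \<noteq> 0"
  by auto

lemma cis_angle_from:
  assumes "c \<in> circle" "x \<in> circle" shows "x = c * cis (angle_from c x)"
proof -
  have "cmod (x / c) = 1" using assms by (simp add: norm_divide)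
  then have "cis (angle_from c x) = x / c"
    unfolding angle_from_def cis_conv_exp using complex_norm_eq_1_exp by blast
  then show ?thesis using circle_nonzero[OF assms(1)] by simp
qed

lemma angle_from_unique:
  assumes "c \<in> circle" "0 \<le> r" "r < 2 * pi" shows "angle_from c (c * cis r) = r"
  unfolding angle_from_def
  by (rule Arg2pi_unique[of 1]) (use assms circle_nonzero in \<open>auto simp: cis_conv_exp\<close>)

lemma angle_from_change:
  assumes c: "c \<in> circle" and x: "x \<in> circle" and y: "y \<in> circle"
  shows "angle_from x y = (if angle_from c x \<le> angle_from c y then angle_from c y - angle_from c x
    else angle_from c y - angle_from c x + 2 * pi)"
proof -
  define r where "r = (if angle_from c x \<le> angle_from c y then angle_from c y - angle_from c x
    else angle_from c y - angle_from c x + 2 * pi)"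
  have r: "0 \<le> r" "r < 2 * pi" using angle_from_range[of c x] angle_from_range[of c y] by (auto simp: r_def)
  have "cis r = cis (angle_from c y - angle_from c x)"
    by (simp add: r_def cis_mult[symmetric])
  then have "x * cis r = c * cis (angle_from c x) * cis (angle_from c y - angle_from c x)"
    using cis_angle_from[OF c x] by simp
  also have "\<dots> = c * cis (angle_from c y)" by (simp add: cis_mult mult.assoc)
  finally have "x * cis r = y" using cis_angle_from[OF c y] by simp
  then show ?thesis using angle_from_unique[OF x r] by (simp add: r_def)
qed

interpretation circle: cyclic_coordinates circle angle_from
proof
  fix c assume c: "c \<in> circle"
  show "angle_from c c = 0" using angle_from_unique[OF c, of 0] by simp
  show "bij_betw (angle_from c) circle {0..<2 * pi}"
  proof (rule bij_betw_byWitness[where f' = "\<lambda>r. c * cis r"])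
    show "\<forall>x\<in>circle. c * cis (angle_from c x) = x" using cis_angle_from[OF c] by simp
    show "\<forall>r\<in>{0..<2 * pi}. angle_from c (c * cis r) = r" using angle_from_unique[OF c] by simp
    show "angle_from c ` circle \<subseteq> {0..<2 * pi}" using angle_from_range by auto
    show "(\<lambda>r. c * cis r) ` {0..<2 * pi} \<subseteq> circle" using c by (auto simp: norm_mult)
  qed
  fix x y z assume x: "x \<in> circle" and y: "y \<in> circle" and z: "z \<in> circle"
  show "cyc_between angle_from x y z \<longleftrightarrow> cyc3 (angle_from c x) (angle_from c y) (angle_from c z)"
    unfolding cyc_between_def cyc3_def angle_from_change[OF c x y] angle_from_change[OF c x z]
    using angle_from_range[of c x] angle_from_range[of c y] angle_from_range[of c z] by auto
qed

lemma cyc_less_iff_between: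
  "cyc_less [x, y, z] \<longleftrightarrow> x \<in> circle \<and> y \<in> circle \<and> z \<in> circle \<and> cyc_between angle_from x y z"
  using circle.coord_self[of x] by (auto simp: cyc_less_def cyc_between_def)

lemma cyc_le_iff_in_arc:
  "cyc_le [x, y, z] \<longleftrightarrow> x \<in> circle \<and> y \<in> circle \<and> z \<in> circle \<and> in_arc angle_from x y z"
proof (cases "x \<in> circle \<and> y \<in> circle \<and> z \<in> circle")
  case True
  then show ?thesis
    using circle.coord_self[of x] angle_from_range[of x y] circle.coord_inj[of x y z]
      circle.coord_pos[of x y] angle_from_range[of x z]
    by (auto simp: cyc_le_def in_arc_def cyc_between_def)
qed (auto simp: cyc_le_def)

lemma cross_iff_crossing:
  assumes "U \<subseteq> circle" "V \<subseteq> circle"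
  shows "cross U V \<longleftrightarrow> crossing angle_from U V"
proof -
  have four: "cyc_less [x0, y0, x1, y1] \<longleftrightarrow> cyc_between angle_from x0 y0 x1 \<and> cyc_between angle_from x1 y1 x0"
    if "x0 \<in> circle" "y0 \<in> circle" "x1 \<in> circle" "y1 \<in> circle" for x0 y0 x1 y1
    using that circle.coord_self[of x0] circle.between_change[of x0 x1 y1 x0]
      circle.coord_pos[of x0 y1] angle_from_range(1)[of x0 y1]
    by (auto simp: cyc_less_def cyc_between_def[of _ x0] cyc3_def)
  show ?thesis
  proof
    assume "cross U V"
    then obtain x0 x1 y0 y1 where xy: "U = {x0, x1}" "V = {y0, y1}"
      "cyc_less [x0, y0, x1, y1] \<or> cyc_less [x0, y1, x1, y0]"
      unfolding cross_def by blast
    have c: "x0 \<in> circle" "x1 \<in> circle" "y0 \<in> circle" "y1 \<in> circle" using assms xy(1,2) by auto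
    from xy(3) show "crossing angle_from U V"
    proof
      assume "cyc_less [x0, y0, x1, y1]"
      then show ?thesis unfolding crossing_def using four[OF c(1,3,2,4)] xy(1,2) by blast
    next
      assume "cyc_less [x0, y1, x1, y0]"
      moreover have "V = {y1, y0}" using xy(2) by auto
      ultimately show ?thesis unfolding crossing_def using four[OF c(1,4,2,3)] xy(1) by blast
    qed
  next
    assume "crossing angle_from U V"
    then obtain x0 x1 y0 y1 where xy: "U = {x0, x1}" "V = {y0, y1}"
      "cyc_between angle_from x0 y0 x1" "cyc_between angle_from x1 y1 x0"
      unfolding crossing_def by blast
    then have "cyc_less [x0, y0, x1, y1]" using four[of x0 y0 x1 y1] assms by auto
    then show "cross U V" unfolding cross_def using xy by blast
  qed
qed

text \<open>The cosine of the angle tends to \<open>1\<close>, but on the interval from \<open>m\<close> to \<open>t\<close> it is bounded away from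
  \<open>1\<close>.\<close>

lemma eventually_angle_outside:
  assumes a: "a \<in> circle" and z: "range z \<subseteq> circle" and lim: "z \<longlonglongrightarrow> a"
    and m: "0 < m" and t: "t < 2 * pi"
  shows "\<forall>\<^sub>F i in sequentially. angle_from a (z i) < m \<or> t < angle_from a (z i)"
proof (cases "m \<le> t")
  case True
  have cos: "cos (angle_from a (z i)) = Re (z i / a)" for i
  proof -
    have "z i / a = cis (angle_from a (z i))"
      using cis_angle_from[OF a subsetD[OF z rangeI[of z i]]] circle_nonzero[OF a]
      by (metis nonzero_mult_div_cancel_left)
    then show ?thesis by simp
  qed
  have less1: "cos r < 1" if "0 < r" "r < 2 * pi" for r :: real
  proof -
    have "0 < sin (r / 2)" using that by (intro sin_gt_zero) auto
    then show ?thesis using cos_double_sin[of "r / 2"] by simp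
  qed
  have "(\<lambda>i. Re (z i / a)) \<longlonglongrightarrow> Re (a / a)"
    by (intro tendsto_intros lim) (use circle_nonzero[OF a] in auto)
  then have "(\<lambda>i. cos (angle_from a (z i))) \<longlonglongrightarrow> 1" using cos circle_nonzero[OF a] by simp
  moreover have "max (cos m) (cos t) < 1" using less1[of m] less1[of t] m t True by auto
  ultimately have "\<forall>\<^sub>F i in sequentially. max (cos m) (cos t) < cos (angle_from a (z i))"
    by (rule order_tendstoD)
  then show ?thesis
  proof (rule eventually_mono)
    fix i assume i: "max (cos m) (cos t) < cos (angle_from a (z i))"
    let ?r = "angle_from a (z i)"
    show "?r < m \<or> t < ?r"
    proof (rule ccontr)
      assume "\<not> ?thesis"
      then have r: "m \<le> ?r" "?r \<le> t" by auto
      show False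
      proof (cases "?r \<le> pi")
        case True
        then have "cos ?r \<le> cos m" using r m by (intro cos_monotone_0_pi_le) auto
        then show False using i by simp
      next
        case False
        have "cos (2 * pi - ?r) \<le> cos (2 * pi - t)" using False r t by (intro cos_monotone_0_pi_le) auto
        then show False using i by simp
      qed
    qed
  qed
qed (auto intro!: always_eventually)

lemma tendsto_of_angle_from:
  assumes a: "a \<in> circle" and z: "range z \<subseteq> circle"
    and lim: "(\<lambda>i. angle_from a (z i)) \<longlonglongrightarrow> r" and r: "cis r = 1"
  shows "z \<longlonglongrightarrow> a"
proof -
  have "(\<lambda>i. a * cis (angle_from a (z i))) \<longlonglongrightarrow> a * cis r"
    unfolding cis_conv_exp by (intro tendsto_intros lim)
  moreover have "a * cis (angle_from a (z i)) = z i" for i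
    by (rule cis_angle_from[OF a subsetD[OF z rangeI[of z i]], symmetric])
  ultimately show ?thesis using r by simp
qed

lemma between_to_iff_angle:
  assumes "a \<in> circle" "u \<in> circle - {a}" "x \<in> circle - {a}"
  shows "cyc_between angle_from u x a \<longleftrightarrow> angle_from a u < angle_from a x"
  using circle.between_change[of a u x a] circle.coord_self[of a] circle.coord_pos[of a u]
    circle.coord_pos[of a x] assms by (auto simp: cyc3_def)

lemma between_from_iff_angle:
  assumes "a \<in> circle" "x \<in> circle - {a}"
  shows "cyc_between angle_from a x u \<longleftrightarrow> angle_from a x < angle_from a u"
  using circle.coord_pos[of a x] assms by (auto simp: cyc_between_def)

text \<open>The angles from \<open>a\<close> can only accumulate at \<open>0\<close> and \<open>2\<pi>\<close>; the bound \<open>\<mu>\<close> keeps them away from \<open>0\<close>.\<close>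

lemma tends_from_below_iff:
  assumes Z: "Z \<subseteq> circle" and a: "a \<in> circle" "a \<notin> Z"
  shows "tends_from_below Z z a \<longleftrightarrow> range z \<subseteq> Z \<and> (\<lambda>i. angle_from a (z i)) \<longlonglongrightarrow> 2 * pi"
proof
  assume t: "tends_from_below Z z a"
  then obtain \<mu> where rng: "range z \<subseteq> Z" and lim: "z \<longlonglongrightarrow> a" and \<mu>: "\<mu> \<in> circle - {a}"
    and ev: "\<forall>\<^sub>F i in sequentially. z i \<in> cyc_closed_interval \<mu> a"
    unfolding tends_from_below_def by blast
  have zc: "z i \<in> circle - {a}" for i using subsetD[OF rng rangeI[of z i]] Z a by blast
  have ge: "angle_from a \<mu> \<le> angle_from a (z i)" if "z i \<in> cyc_closed_interval \<mu> a" for i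
    using that zc[of i] between_to_iff_angle[OF a(1) \<mu> zc]
    by (auto simp: cyc_closed_interval_def cyc_le_iff_in_arc in_arc_def)
  have "(\<lambda>i. angle_from a (z i)) \<longlonglongrightarrow> 2 * pi"
  proof (rule order_tendstoI)
    fix t :: real assume "t < 2 * pi"
    have "\<forall>\<^sub>F i in sequentially. angle_from a (z i) < angle_from a \<mu> \<or> t < angle_from a (z i)"
      by (rule eventually_angle_outside[OF a(1) _ lim]) (use zc circle.coord_pos[OF a(1)] \<mu> \<open>t < 2 * pi\<close> in auto)
    with ev show "\<forall>\<^sub>F i in sequentially. t < angle_from a (z i)"
      by eventually_elim (use ge in force)
  next
    fix t :: real assume "2 * pi < t"
    then show "\<forall>\<^sub>F i in sequentially. angle_from a (z i) < t"
      using angle_from_range(2)[of a] by (intro always_eventually allI) (meson less_trans)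
  qed
  then show "range z \<subseteq> Z \<and> (\<lambda>i. angle_from a (z i)) \<longlonglongrightarrow> 2 * pi" using rng by blast
next
  assume *: "range z \<subseteq> Z \<and> (\<lambda>i. angle_from a (z i)) \<longlonglongrightarrow> 2 * pi"
  have zc: "z i \<in> circle - {a}" for i using subsetD[OF conjunct1[OF *] rangeI[of z i]] Z a by blast
  have m: "- a \<in> circle - {a}" using a(1) circle_nonzero[OF a(1)] by auto
  have "z \<longlonglongrightarrow> a"
    by (rule tendsto_of_angle_from[OF a(1), of _ "2 * pi"]) (use * Z in auto)
  moreover have "\<forall>\<^sub>F i in sequentially. angle_from a (- a) < angle_from a (z i)"
    using * angle_from_range(2) by (intro order_tendstoD(1)) auto
  then have "\<forall>\<^sub>F i in sequentially. z i \<in> cyc_closed_interval (- a) a"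
  proof (rule eventually_mono)
    fix i assume "angle_from a (- a) < angle_from a (z i)"
    then show "z i \<in> cyc_closed_interval (- a) a"
      using between_to_iff_angle[OF a(1) m zc] zc[of i] m a(1)
      by (auto simp: cyc_closed_interval_def cyc_le_iff_in_arc in_arc_def)
  qed
  ultimately show "tends_from_below Z z a" unfolding tends_from_below_def using * m by blast
qed

lemma tends_from_above_iff:
  assumes Z: "Z \<subseteq> circle" and a: "a \<in> circle" "a \<notin> Z"
  shows "tends_from_above Z z a \<longleftrightarrow> range z \<subseteq> Z \<and> (\<lambda>i. angle_from a (z i)) \<longlonglongrightarrow> 0"
proof
  assume t: "tends_from_above Z z a"
  then obtain \<nu> where rng: "range z \<subseteq> Z" and lim: "z \<longlonglongrightarrow> a" and \<nu>: "\<nu> \<in> circle - {a}"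
    and ev: "\<forall>\<^sub>F i in sequentially. z i \<in> cyc_closed_interval a \<nu>"
    unfolding tends_from_above_def by blast
  have zc: "z i \<in> circle - {a}" for i using subsetD[OF rng rangeI[of z i]] Z a by blast
  have le: "angle_from a (z i) \<le> angle_from a \<nu>" if "z i \<in> cyc_closed_interval a \<nu>" for i
    using that zc[of i] between_from_iff_angle[OF a(1) zc]
    by (auto simp: cyc_closed_interval_def cyc_le_iff_in_arc in_arc_def)
  have "(\<lambda>i. angle_from a (z i)) \<longlonglongrightarrow> 0"
  proof (rule order_tendstoI)
    fix t :: real assume "0 < t"
    have "\<forall>\<^sub>F i in sequentially. angle_from a (z i) < t \<or> angle_from a \<nu> < angle_from a (z i)"
      by (rule eventually_angle_outside[OF a(1) _ lim]) (use zc angle_from_range \<open>0 < t\<close> in auto)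
    with ev show "\<forall>\<^sub>F i in sequentially. angle_from a (z i) < t"
      by eventually_elim (use le in force)
  next
    fix t :: real assume "t < 0"
    then show "\<forall>\<^sub>F i in sequentially. t < angle_from a (z i)"
      using angle_from_range(1)[of a] by (intro always_eventually allI) (meson less_le_trans)
  qed
  then show "range z \<subseteq> Z \<and> (\<lambda>i. angle_from a (z i)) \<longlonglongrightarrow> 0" using rng by blast
next
  assume *: "range z \<subseteq> Z \<and> (\<lambda>i. angle_from a (z i)) \<longlonglongrightarrow> 0"
  have zc: "z i \<in> circle - {a}" for i using subsetD[OF conjunct1[OF *] rangeI[of z i]] Z a by blast
  have m: "- a \<in> circle - {a}" using a(1) circle_nonzero[OF a(1)] by auto
  have "z \<longlonglongrightarrow> a"
    by (rule tendsto_of_angle_from[OF a(1), of _ 0]) (use * Z in auto)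
  moreover have "\<forall>\<^sub>F i in sequentially. angle_from a (z i) < angle_from a (- a)"
    using * circle.coord_pos[OF a(1), of "- a"] m by (intro order_tendstoD(2)) auto
  then have "\<forall>\<^sub>F i in sequentially. z i \<in> cyc_closed_interval a (- a)"
  proof (rule eventually_mono)
    fix i assume "angle_from a (z i) < angle_from a (- a)"
    then show "z i \<in> cyc_closed_interval a (- a)"
      using between_from_iff_angle[OF a(1) zc] zc[of i] m a(1)
      by (auto simp: cyc_closed_interval_def cyc_le_iff_in_arc in_arc_def)
  qed
  ultimately show "tends_from_above Z z a" unfolding tends_from_above_def using * m by blast
qed

text \<open>All terms lie between \<open>z 0\<close> and \<open>a\<close>: once beyond \<open>a\<close>, an increasing sequence would be confined to
  an arc from some \<open>z i\<close> to \<open>z 0\<close> that does not contain \<open>a\<close>.\<close>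

lemma cyc_increasing_tends_from_below:
  assumes Z: "Z \<subseteq> circle" and a: "a \<in> circle" "a \<notin> Z"
    and z: "range z \<subseteq> Z" "cyc_increasing z" "z \<longlonglongrightarrow> a"
  shows "tends_from_below Z z a"
proof -
  have zc: "z i \<in> circle - {a}" for i using subsetD[OF z(1) rangeI[of z i]] Z a by blast
  let ?A = "angle_from a"
  have arc: "in_arc angle_from (z 0) (z i) (z j)" if ij: "i \<le> j" for i j
  proof (cases "i = j")
    case False
    have "sorted_wrt (\<le>) (map (angle_from (hd (map z [0..<Suc j]))) (map z [0..<Suc j]))"
      using z(2) unfolding cyc_increasing_def cyc_le_def by blast
    moreover have "hd (map z [0..<Suc j]) = z 0" by (simp add: hd_map del: upt_Suc)
    ultimately have "sorted_wrt (\<le>) (map (angle_from (z 0) \<circ> z) [0..<Suc j])" by (simp del: upt_Suc)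
    then have "angle_from (z 0) (z i) \<le> angle_from (z 0) (z j)"
      unfolding sorted_wrt_iff_nth_less using ij False
      by (auto simp del: upt_Suc dest!: spec[of _ i] spec[of _ j])
    then have "cyc_le [z 0, z i, z j]"
      using zc[of i] zc[of j] zc[of 0] angle_from_range circle.coord_self by (auto simp: cyc_le_def)
    then show ?thesis using cyc_le_iff_in_arc by blast
  qed (auto simp: in_arc_def)
  have "in_arc angle_from (z 0) (z i) a" for i
  proof (rule ccontr)
    assume not: "\<not> in_arc angle_from (z 0) (z i) a"
    then have i: "z i \<noteq> z 0" "?A (z i) < ?A (z 0)"
      using between_to_iff_angle[OF a(1) zc zc] circle.coord_inj[OF a(1), of "z i" "z 0"] zc[of i] zc[of 0]
      unfolding in_arc_def by force+
    have A0: "?A (z i) \<le> ?A (z j) \<and> ?A (z j) < ?A (z 0)" if "i \<le> j" for j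
      using arc[OF that] i circle.between_change[of a "z 0" "z i" "z j"] zc[of 0] zc[of i] zc[of j] a(1)
      unfolding in_arc_def cyc3_def by auto
    have "\<forall>\<^sub>F j in sequentially. ?A (z j) < ?A (z i) \<or> ?A (z 0) < ?A (z j)"
      by (rule eventually_angle_outside[OF a(1) _ z(3)])
        (use zc circle.coord_pos[OF a(1)] angle_from_range in auto)
    moreover have "\<forall>\<^sub>F j in sequentially. i \<le> j" by (rule eventually_ge_at_top)
    ultimately have "\<forall>\<^sub>F j in sequentially. False" by eventually_elim (use A0 in force)
    then show False by simp
  qed
  then have "\<forall>\<^sub>F i in sequentially. z i \<in> cyc_closed_interval (z 0) a"
    using zc a(1) by (intro always_eventually allI) (auto simp: cyc_closed_interval_def cyc_le_iff_in_arc)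
  then show ?thesis unfolding tends_from_below_def using z(1,3) zc by blast
qed

lemma cyc_decreasing_tends_from_above:
  assumes Z: "Z \<subseteq> circle" and a: "a \<in> circle" "a \<notin> Z"
    and z: "range z \<subseteq> Z" "cyc_decreasing z" "z \<longlonglongrightarrow> a"
  shows "tends_from_above Z z a"
proof -
  have zc: "z i \<in> circle - {a}" for i using subsetD[OF z(1) rangeI[of z i]] Z a by blast
  let ?A = "angle_from a"
  have arc: "in_arc angle_from (z j) (z i) (z 0)" if ij: "i \<le> j" for i j
  proof (cases "i = 0 \<or> i = j")
    case False
    have "sorted_wrt (\<le>) (map (angle_from (hd (rev (map z [0..<Suc j])))) (rev (map z [0..<Suc j])))"
      using z(2) unfolding cyc_decreasing_def cyc_le_def by blast
    moreover have "hd (rev (map z [0..<Suc j])) = z j" by simp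
    ultimately have "sorted_wrt (\<lambda>x y. y \<le> x) (map (angle_from (z j) \<circ> z) [0..<Suc j])"
      by (simp add: rev_map[symmetric] sorted_wrt_rev del: upt_Suc rev_map)
    then have "angle_from (z j) (z i) \<le> angle_from (z j) (z 0)"
      unfolding sorted_wrt_iff_nth_less using ij False
      by (auto simp del: upt_Suc dest!: spec[of _ 0] spec[of _ i])
    then have "cyc_le [z j, z i, z 0]"
      using zc[of i] zc[of j] zc[of 0] angle_from_range circle.coord_self by (auto simp: cyc_le_def)
    then show ?thesis using cyc_le_iff_in_arc by blast
  qed (auto simp: in_arc_def)
  have "in_arc angle_from a (z i) (z 0)" for i
  proof (rule ccontr)
    assume not: "\<not> in_arc angle_from a (z i) (z 0)"
    then have i: "z i \<noteq> z 0" "?A (z 0) < ?A (z i)"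
      using between_from_iff_angle[OF a(1) zc] circle.coord_inj[OF a(1), of "z i" "z 0"] zc[of i] zc[of 0]
      unfolding in_arc_def by force+
    have A0: "?A (z 0) < ?A (z j) \<and> ?A (z j) \<le> ?A (z i)" if "i \<le> j" for j
      using arc[OF that] i circle.between_change[of a "z j" "z i" "z 0"] zc[of 0] zc[of i] zc[of j] a(1)
      unfolding in_arc_def cyc3_def by auto
    have "\<forall>\<^sub>F j in sequentially. ?A (z j) < ?A (z 0) \<or> ?A (z i) < ?A (z j)"
      by (rule eventually_angle_outside[OF a(1) _ z(3)])
        (use zc circle.coord_pos[OF a(1)] angle_from_range in auto)
    moreover have "\<forall>\<^sub>F j in sequentially. i \<le> j" by (rule eventually_ge_at_top)
    ultimately have "\<forall>\<^sub>F j in sequentially. False" by eventually_elim (use A0 in force)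
    then show False by simp
  qed
  then have "\<forall>\<^sub>F i in sequentially. z i \<in> cyc_closed_interval a (z 0)"
    using zc a(1) by (intro always_eventually allI) (auto simp: cyc_closed_interval_def cyc_le_iff_in_arc)
  then show ?thesis unfolding tends_from_above_def using z(1,3) zc by blast
qed

section \<open>Admissible subsets of the circle\<close>

text \<open>Admissibility in terms of the order: accumulation from one side only happens at points outside
  \<open>Z\<close>, and there from both sides.\<close>

locale accumulating = cyclic_coordinates S g for S :: "'a set" and g +
  fixes Z :: "'a set"
  assumes Z_sub: "Z \<subseteq> S" and infinite_Z: "infinite Z"
    and limit_below: "\<lbrakk>a \<in> S; \<And>u. u \<in> S - {a} \<Longrightarrow> \<exists>z\<in>Z. cyc_between g u z a\<rbrakk> \<Longrightarrow> limit_point S g Z a"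
    and limit_above: "\<lbrakk>a \<in> S; \<And>u. u \<in> S - {a} \<Longrightarrow> \<exists>z\<in>Z. cyc_between g a z u\<rbrakk> \<Longrightarrow> limit_point S g Z a"
begin

text \<open>The supremum of the angles from \<open>z\<close> to the other points of \<open>Z\<close> is attained. Otherwise it would belong
  to a limit point, which is approached from above as well, contrary to being an upper bound. It is
  less than a full turn because \<open>z\<close> itself is not approached from below.\<close>

lemma predecessor_exists:
  assumes z: "z \<in> Z"
  obtains w where "w \<in> Z" "w \<noteq> z" "\<And>x. x \<in> Z \<Longrightarrow> \<not> cyc_between g w x z"
proof -
  have zS: "z \<in> S" using z Z_sub by blast
  have "\<not> limit_point S g Z z" using z by (simp add: limit_point_def)
  then obtain u where u: "u \<in> S - {z}" and gap: "\<And>x. x \<in> Z \<Longrightarrow> \<not> cyc_between g u x z"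
    using limit_below[OF zS] by blast
  let ?k = "g z"
  have to_z: "cyc_between g v x z \<longleftrightarrow> ?k v < ?k x" if "v \<in> S - {z}" "x \<in> S - {z}" for v x
    using between_change[OF zS, of v x z] coord_self[OF zS] coord_pos[OF zS, of v] coord_pos[OF zS, of x]
      zS that by (auto simp: cyc3_def)
  have le: "?k x \<le> ?k u" if "x \<in> Z" "x \<noteq> z" for x
    using gap[OF that(1)] to_z[OF u, of x] that Z_sub by auto
  define s where "s = Sup (?k ` (Z - {z}))"
  have ne: "?k ` (Z - {z}) \<noteq> {}" using infinite_Z finite_subset[of Z "{z}"] by auto
  have bdd: "bdd_above (?k ` (Z - {z}))" using le by (intro bdd_aboveI[of _ "?k u"]) auto
  have upper: "?k x \<le> s" if "x \<in> Z" "x \<noteq> z" for x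
    unfolding s_def using that by (intro cSup_upper bdd) auto
  have su: "s \<le> ?k u" unfolding s_def using le by (intro cSup_least ne) auto
  obtain x0 where x0: "x0 \<in> Z" "x0 \<noteq> z" using ne by auto
  have "0 < s" using upper[OF x0] coord_pos[OF zS, of x0] x0 Z_sub by auto
  moreover have "s < 2 * pi" using su coord_range[OF zS, of u] u by auto
  ultimately obtain c where c: "c \<in> S" "?k c = s" using coord_surj[OF zS, of s] by auto
  have cz: "c \<noteq> z" using c(2) \<open>0 < s\<close> coord_self[OF zS] by auto
  have "c \<in> Z"
  proof (rule ccontr)
    assume "c \<notin> Z"
    have strict: "?k x < s" if "x \<in> Z" "x \<noteq> z" for x
      using upper[OF that] coord_inj[OF zS _ c(1), of x] c(2) \<open>c \<notin> Z\<close> that Z_sub by force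
    have "limit_point S g Z c"
    proof (rule limit_below[OF c(1)])
      fix v assume v: "v \<in> S - {c}"
      have vc: "?k v \<noteq> s" using coord_inj[OF zS _ c(1), of v] c(2) v by auto
      show "\<exists>x\<in>Z. cyc_between g v x c"
      proof (cases "?k v < s")
        case True
        then obtain x where x: "x \<in> Z - {z}" "?k v < ?k x"
          unfolding s_def using less_cSup_iff[OF ne bdd] by auto
        then show ?thesis
          using between_change[OF zS, of v x c] v c strict[of x] Z_sub by (auto simp: cyc3_def)
      next
        case False
        then show ?thesis
          using between_change[OF zS, of v x0 c] v vc c strict[OF x0] x0 Z_sub by (force simp: cyc3_def)
      qed
    qed
    then obtain x where x: "x \<in> Z" "cyc_between g c x z"
      unfolding limit_point_def using zS cz by blast
    then have "x \<noteq> z" using cz by (auto simp: cyc_between_def)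
    then show False using x to_z[of c x] c cz strict[of x] Z_sub by auto
  qed
  then show ?thesis
  proof (rule that)
    show "c \<noteq> z" by (rule cz)
    fix x assume x: "x \<in> Z"
    show "\<not> cyc_between g c x z"
    proof
      assume b: "cyc_between g c x z"
      then have "x \<noteq> z" by (auto simp: cyc_between_def)
      then show False using b to_z[of c x] c cz upper[OF x] x Z_sub by auto
    qed
  qed
qed

lemma accumulating_reflect: "accumulating S (reflect g) Z"
proof -
  interpret r: cyclic_coordinates S "reflect g" by (rule cyclic_coordinates_reflect)
  have lim: "limit_point S (reflect g) Z a \<longleftrightarrow> limit_point S g Z a" for a
    by (rule chord_family.limit_point_reflect[of S g Z "{}"])
      (unfold_locales, use Z_sub in auto)
  have ref: "cyc_between (reflect g) x z y \<longleftrightarrow> cyc_between g y z x" if "x \<in> S" "y \<in> S" "z \<in> Z" for x y z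
    using reflect_between that Z_sub by blast
  show ?thesis
  proof
    fix a assume a: "a \<in> S" and *: "\<And>u. u \<in> S - {a} \<Longrightarrow> \<exists>z\<in>Z. cyc_between (reflect g) u z a"
    have "\<exists>z\<in>Z. cyc_between g a z u" if "u \<in> S - {a}" for u
      using *[OF that] ref[of u a] that a by blast
    then show "limit_point S (reflect g) Z a" unfolding lim by (rule limit_above[OF a])
  next
    fix a assume a: "a \<in> S" and *: "\<And>u. u \<in> S - {a} \<Longrightarrow> \<exists>z\<in>Z. cyc_between (reflect g) a z u"
    have "\<exists>z\<in>Z. cyc_between g u z a" if "u \<in> S - {a}" for u
      using *[OF that] ref[of a u] that a by blast
    then show "limit_point S (reflect g) Z a" unfolding lim by (rule limit_below[OF a])
  qed (use Z_sub infinite_Z in auto)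
qed

lemma successor_exists:
  assumes z: "z \<in> Z"
  obtains w where "w \<in> Z" "w \<noteq> z" "\<And>x. x \<in> Z \<Longrightarrow> \<not> cyc_between g z x w"
proof -
  interpret r: accumulating S "reflect g" Z by (rule accumulating_reflect)
  obtain w where "w \<in> Z" "w \<noteq> z" "\<And>x. x \<in> Z \<Longrightarrow> \<not> cyc_between (reflect g) w x z"
    by (rule r.predecessor_exists[OF z]) blast
  then show ?thesis using that[of w] reflect_between z Z_sub by blast
qed

lemma neighbour_unique:
  assumes z: "z \<in> Z" and w: "w \<in> Z" "w \<noteq> z" "\<And>x. x \<in> Z \<Longrightarrow> \<not> cyc_between g w x z"
    and w': "w' \<in> Z" "w' \<noteq> z" "\<And>x. x \<in> Z \<Longrightarrow> \<not> cyc_between g w' x z"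
  shows "w = w'"
proof -
  have S: "z \<in> S" "w \<in> S" "w' \<in> S" using z w w' Z_sub by auto
  have "\<not> cyc3 (g z w) (g z w') (g z z)" "\<not> cyc3 (g z w') (g z w) (g z z)"
    using w(3)[OF w'(1)] w'(3)[OF w(1)] between_change[OF S(1) S(2,3,1)] between_change[OF S(1) S(3,2,1)]
    by simp_all
  moreover have "g z z = 0" "0 < g z w" "0 < g z w'"
    using coord_self[OF S(1)] coord_pos[OF S(1,2) w(2)] coord_pos[OF S(1,3) w'(2)] by simp_all
  ultimately have "g z w = g z w'" unfolding cyc3_def by linarith
  then show ?thesis using coord_inj[OF S] by simp
qed

end

lemma proper_limit_point_limits:
  assumes Z: "admissible Z" and a: "a \<in> proper_limit_points Z"
  shows "limit_point circle angle_from Z a"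
proof -
  have Zc: "Z \<subseteq> circle" and two: "two_sided_limits Z" using Z by (auto simp: admissible_def)
  have aZ: "a \<notin> Z" and cl: "a \<in> closure Z" using a by (auto simp: proper_limit_points_def)
  have ac: "a \<in> circle" using cl closure_minimal[OF Zc closed_sphere] by blast
  obtain z where "range z \<subseteq> Z" "z \<longlonglongrightarrow> a" using cl unfolding closure_sequential by blast
  then obtain p q where p: "range p \<subseteq> Z" "cyc_increasing p" "p \<longlonglongrightarrow> a"
    and q: "range q \<subseteq> Z" "cyc_decreasing q" "q \<longlonglongrightarrow> a"
    using two ac unfolding two_sided_limits_def by meson
  have P: "(\<lambda>i. angle_from a (p i)) \<longlonglongrightarrow> 2 * pi"
    using cyc_increasing_tends_from_below[OF Zc ac aZ p] tends_from_below_iff[OF Zc ac aZ] by blast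
  have Q: "(\<lambda>i. angle_from a (q i)) \<longlonglongrightarrow> 0"
    using cyc_decreasing_tends_from_above[OF Zc ac aZ q] tends_from_above_iff[OF Zc ac aZ] by blast
  show ?thesis
    unfolding limit_point_def
  proof (intro conjI ballI)
    fix u assume u: "u \<in> circle - {a}"
    have "\<forall>\<^sub>F i in sequentially. angle_from a u < angle_from a (p i)"
      using P angle_from_range(2) by (rule order_tendstoD)
    from eventually_happens'[OF sequentially_bot this] obtain i where i: "angle_from a u < angle_from a (p i)" by blast
    have pi: "p i \<in> Z" using p(1) by blast
    then have "p i \<in> circle - {a}" using Zc aZ by blast
    then show "\<exists>z\<in>Z. cyc_between angle_from u z a" using between_to_iff_angle[OF ac u] i pi by blast
    have "\<forall>\<^sub>F i in sequentially. angle_from a (q i) < angle_from a u"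
      by (rule order_tendstoD(2)[OF Q]) (use circle.coord_pos[OF ac] u in auto)
    from eventually_happens'[OF sequentially_bot this] obtain j where j: "angle_from a (q j) < angle_from a u" by blast
    have qj: "q j \<in> Z" using q(1) by blast
    then have "q j \<in> circle - {a}" using Zc aZ by blast
    then show "\<exists>z\<in>Z. cyc_between angle_from a z u" using between_from_iff_angle[OF ac] j qj by blast
  qed (use ac aZ in auto)
qed

lemma sequence_approaching:
  fixes f :: "'a \<Rightarrow> 'b::metric_space"
  assumes "\<And>e. 0 < e \<Longrightarrow> \<exists>x. P x \<and> dist (f x) l < e"
  obtains x where "\<And>i. P (x i)" "(\<lambda>i. f (x i)) \<longlonglongrightarrow> l"
proof -
  have "\<exists>x. P x \<and> dist (f x) l < inverse (real (Suc i))" for i by (rule assms) simp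
  then obtain x where x: "\<And>i. P (x i)" "\<And>i. dist (f (x i)) l < inverse (real (Suc i))" by metis
  have "(\<lambda>i. dist (f (x i)) l) \<longlonglongrightarrow> 0"
    by (rule tendsto_sandwich[OF _ _ tendsto_const LIMSEQ_inverse_real_of_nat])
      (use x(2) in \<open>auto intro!: always_eventually less_imp_le\<close>)
  then show ?thesis using that[of x] x(1) tendsto_dist_iff by blast
qed

lemma approached_from_below_iff:
  assumes Z: "Z \<subseteq> circle" and a: "a \<in> circle" "a \<notin> Z"
  shows "(\<forall>u\<in>circle - {a}. \<exists>x\<in>Z. cyc_between angle_from u x a \<and> P x) \<longleftrightarrow>
    (\<forall>e>0. \<exists>x\<in>Z. P x \<and> dist (angle_from a x) (2 * pi) < e)"
proof (intro iffI ballI allI impI)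
  fix e :: real assume e: "0 < e" and *: "\<forall>u\<in>circle - {a}. \<exists>x\<in>Z. cyc_between angle_from u x a \<and> P x"
  have "0 \<le> max (2 * pi - e) 1" "max (2 * pi - e) 1 < 2 * pi" using e pi_gt3 by auto
  then obtain u where u: "u \<in> circle" "angle_from a u = max (2 * pi - e) 1"
    by (rule circle.coord_surj[OF a(1)])
  then have u': "u \<in> circle - {a}" using circle.coord_self[OF a(1)] by auto
  then obtain x where x: "x \<in> Z" "cyc_between angle_from u x a" "P x" using * by blast
  then have "max (2 * pi - e) 1 < angle_from a x"
    using between_to_iff_angle[OF a(1) u', of x] u(2) subsetD[OF Z x(1)] a(2) by auto
  then show "\<exists>x\<in>Z. P x \<and> dist (angle_from a x) (2 * pi) < e"
    using x angle_from_range(2)[of a x] by (intro bexI[of _ x]) (auto simp: dist_real_def)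
next
  fix u assume u: "u \<in> circle - {a}" and *: "\<forall>e>0. \<exists>x\<in>Z. P x \<and> dist (angle_from a x) (2 * pi) < e"
  then obtain x where x: "x \<in> Z" "P x" "dist (angle_from a x) (2 * pi) < 2 * pi - angle_from a u"
    using angle_from_range(2)[of a u] by (metis diff_gt_0_iff_gt)
  then have "angle_from a u < angle_from a x" by (auto simp: dist_real_def)
  then show "\<exists>x\<in>Z. cyc_between angle_from u x a \<and> P x"
    using x between_to_iff_angle[OF a(1) u, of x] Z a(2) by blast
qed

lemma approached_from_above_iff:
  assumes Z: "Z \<subseteq> circle" and a: "a \<in> circle" "a \<notin> Z"
  shows "(\<forall>u\<in>circle - {a}. \<exists>x\<in>Z. cyc_between angle_from a x u \<and> P x) \<longleftrightarrow>
    (\<forall>e>0. \<exists>x\<in>Z. P x \<and> dist (angle_from a x) 0 < e)"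
proof (intro iffI ballI allI impI)
  fix e :: real assume e: "0 < e" and *: "\<forall>u\<in>circle - {a}. \<exists>x\<in>Z. cyc_between angle_from a x u \<and> P x"
  have "0 \<le> min e 1" "min e 1 < 2 * pi" using e pi_gt3 by auto
  then obtain u where u: "u \<in> circle" "angle_from a u = min e 1"
    by (rule circle.coord_surj[OF a(1)])
  then have "u \<in> circle - {a}" using circle.coord_self[OF a(1)] e by auto
  then obtain x where x: "x \<in> Z" "cyc_between angle_from a x u" "P x" using * by blast
  then show "\<exists>x\<in>Z. P x \<and> dist (angle_from a x) 0 < e"
    using u(2) by (intro bexI[of _ x]) (auto simp: cyc_between_def)
next
  fix u assume u: "u \<in> circle - {a}" and *: "\<forall>e>0. \<exists>x\<in>Z. P x \<and> dist (angle_from a x) 0 < e"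
  then obtain x where x: "x \<in> Z" "P x" "dist (angle_from a x) 0 < angle_from a u"
    using circle.coord_pos[OF a(1), of u] by blast
  then show "\<exists>x\<in>Z. cyc_between angle_from a x u \<and> P x"
    using circle.coord_pos[OF a(1) subsetD[OF Z x(1)]] a(2) by (intro bexI[of _ x]) (auto simp: cyc_between_def)
qed

lemma proper_limit_pointI:
  assumes Z: "admissible Z" and x: "range x \<subseteq> Z" "x \<longlonglongrightarrow> a" "\<And>i. x i \<noteq> a"
  shows "a \<in> proper_limit_points Z"
proof -
  have "a \<in> closure Z" unfolding closure_sequential using x by blast
  moreover have "a \<notin> Z"
  proof
    assume "a \<in> Z"
    then have "a isolated_in Z" using Z discreteD by (auto simp: admissible_def)
    then obtain T where T: "open T" "T \<inter> Z = {a}" unfolding isolated_in_def by blast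
    then have "\<forall>\<^sub>F i in sequentially. x i \<in> T" using x(2) by (auto intro: topological_tendstoD)
    from eventually_happens'[OF sequentially_bot this] obtain i where "x i \<in> T" by blast
    then show False using T(2) x(1,3) by blast
  qed
  ultimately show ?thesis by (simp add: proper_limit_points_def)
qed

lemma limit_of_angles:
  assumes Z: "admissible Z" and a: "a \<in> circle" and r: "cis r = 1"
    and near: "\<And>e. 0 < e \<Longrightarrow> \<exists>x. (x \<in> Z \<and> x \<noteq> a) \<and> dist (angle_from a x) r < e"
  shows "a \<in> proper_limit_points Z"
proof -
  obtain x where x: "\<And>i. x i \<in> Z \<and> x i \<noteq> a" and lim: "(\<lambda>i. angle_from a (x i)) \<longlonglongrightarrow> r"
    using near by (rule sequence_approaching[of "\<lambda>x. x \<in> Z \<and> x \<noteq> a"]) blast+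
  have rng: "range x \<subseteq> Z" using x by blast
  have "x \<longlonglongrightarrow> a"
    by (rule tendsto_of_angle_from[OF a _ lim r]) (use rng Z in \<open>auto simp: admissible_def\<close>)
  then show ?thesis using proper_limit_pointI[OF Z rng] x by blast
qed

lemma accumulating_circle:
  assumes Z: "admissible Z" shows "accumulating circle angle_from Z"
proof
  show Zc: "Z \<subseteq> circle" and "infinite Z" using Z by (auto simp: admissible_def)
  fix a assume a: "a \<in> circle"
  have Za: "Z - {a} \<subseteq> circle" "a \<notin> Z - {a}" using Zc by auto
  {
    assume *: "\<And>u. u \<in> circle - {a} \<Longrightarrow> \<exists>z\<in>Z. cyc_between angle_from u z a"
    have "\<forall>u\<in>circle - {a}. \<exists>z\<in>Z - {a}. cyc_between angle_from u z a \<and> True"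
      using * by (fastforce simp: cyc_between_def)
    then have "a \<in> proper_limit_points Z"
      unfolding approached_from_below_iff[OF Za(1) a Za(2)]
      by (intro limit_of_angles[OF Z a, of "2 * pi"]) auto
    then show "limit_point circle angle_from Z a" by (rule proper_limit_point_limits[OF Z])
  next
    assume *: "\<And>u. u \<in> circle - {a} \<Longrightarrow> \<exists>z\<in>Z. cyc_between angle_from a z u"
    have "\<forall>u\<in>circle - {a}. \<exists>z\<in>Z - {a}. cyc_between angle_from a z u \<and> True"
      using * circle.coord_self[OF a] by (fastforce simp: cyc_between_def)
    then have "a \<in> proper_limit_points Z"
      unfolding approached_from_above_iff[OF Za(1) a Za(2)]
      by (intro limit_of_angles[OF Z a, of 0]) auto
    then show "limit_point circle angle_from Z a" by (rule proper_limit_point_limits[OF Z])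
  }
qed

lemma proper_limit_points_iff:
  assumes Z: "admissible Z"
  shows "a \<in> proper_limit_points Z \<longleftrightarrow> limit_point circle angle_from Z a"
proof
  assume lim: "limit_point circle angle_from Z a"
  have Zc: "Z \<subseteq> circle" using Z by (auto simp: admissible_def)
  have a: "a \<in> circle" "a \<notin> Z" using lim by (auto simp: limit_point_def)
  have "\<forall>u\<in>circle - {a}. \<exists>z\<in>Z. cyc_between angle_from u z a \<and> z \<noteq> a"
    using lim a(2) unfolding limit_point_def by blast
  then show "a \<in> proper_limit_points Z"
    unfolding approached_from_below_iff[OF Zc a]
    by (intro limit_of_angles[OF Z a(1), of "2 * pi"]) auto
qed (rule proper_limit_point_limits[OF Z])

lemma has_fountain_iff:
  assumes Z: "Z \<subseteq> circle" and a: "a \<in> circle" "a \<notin> Z"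
  shows "has_fountain Z \<D> a \<longleftrightarrow> fountain circle angle_from Z \<D> a"
proof -
  have seq: "(\<exists>x. (\<forall>i. {z, x i} \<in> \<D>) \<and> range x \<subseteq> Z \<and> (\<lambda>i. angle_from a (x i)) \<longlonglongrightarrow> r) \<longleftrightarrow>
      (\<forall>e>0. \<exists>x\<in>Z. {z, x} \<in> \<D> \<and> dist (angle_from a x) r < e)" for z r
  proof (intro iffI allI impI)
    fix e :: real assume e: "0 < e"
      and "\<exists>x. (\<forall>i. {z, x i} \<in> \<D>) \<and> range x \<subseteq> Z \<and> (\<lambda>i. angle_from a (x i)) \<longlonglongrightarrow> r"
    then obtain x where x: "\<And>i. {z, x i} \<in> \<D>" "range x \<subseteq> Z" "(\<lambda>i. angle_from a (x i)) \<longlonglongrightarrow> r" by blast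
    from eventually_happens'[OF sequentially_bot tendstoD[OF x(3) e]]
    obtain i where "dist (angle_from a (x i)) r < e" by blast
    then show "\<exists>x\<in>Z. {z, x} \<in> \<D> \<and> dist (angle_from a x) r < e" using x(1,2) by blast
  next
    assume "\<forall>e>0. \<exists>x\<in>Z. {z, x} \<in> \<D> \<and> dist (angle_from a x) r < e"
    then have "\<exists>x. (x \<in> Z \<and> {z, x} \<in> \<D>) \<and> dist (angle_from a x) r < e" if "0 < e" for e
      using that by blast
    then obtain x where "\<And>i. x i \<in> Z \<and> {z, x i} \<in> \<D>" "(\<lambda>i. angle_from a (x i)) \<longlonglongrightarrow> r"
      by (rule sequence_approaching[of "\<lambda>x. x \<in> Z \<and> {z, x} \<in> \<D>"]) blast+
    then show "\<exists>x. (\<forall>i. {z, x i} \<in> \<D>) \<and> range x \<subseteq> Z \<and> (\<lambda>i. angle_from a (x i)) \<longlonglongrightarrow> r" by blast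
  qed
  show ?thesis
    unfolding has_fountain_def fountain_def right_fountain_at_def left_fountain_at_def
      tends_from_below_iff[OF Z a] tends_from_above_iff[OF Z a] seq
      approached_from_below_iff[OF Z a] approached_from_above_iff[OF Z a] by blast
qed

lemma has_leapfrog_iff:
  assumes Z: "Z \<subseteq> circle" and a: "a \<in> circle" "a \<notin> Z"
  shows "has_leapfrog Z \<D> a \<longleftrightarrow> leapfrog circle angle_from Z \<D> a"
proof -
  let ?A = "angle_from a"
  have "leapfrog circle angle_from Z \<D> a \<longleftrightarrow> (\<forall>v\<in>circle - {a}. \<forall>u\<in>circle - {a}. \<exists>x\<in>Z.
      cyc_between angle_from u x a \<and> (\<exists>y\<in>Z. cyc_between angle_from a y v \<and> {x, y} \<in> \<D>))"
    unfolding leapfrog_def by blast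
  also have "\<dots> \<longleftrightarrow> (\<forall>e>0. \<forall>v\<in>circle - {a}. \<exists>y\<in>Z.
      cyc_between angle_from a y v \<and> (\<exists>x\<in>Z. {x, y} \<in> \<D> \<and> dist (?A x) (2 * pi) < e))"
    unfolding approached_from_below_iff[OF Z a] by blast
  also have "\<dots> \<longleftrightarrow> (\<forall>e>0. \<forall>e'>0. \<exists>y\<in>Z.
      (\<exists>x\<in>Z. {x, y} \<in> \<D> \<and> dist (?A x) (2 * pi) < e) \<and> dist (?A y) 0 < e')"
    unfolding approached_from_above_iff[OF Z a] ..
  also have "\<dots> \<longleftrightarrow> has_leapfrog Z \<D> a"
    unfolding has_leapfrog_def tends_from_below_iff[OF Z a] tends_from_above_iff[OF Z a]
  proof (intro iffI allI impI)
    fix e e' :: real assume e: "0 < e" "0 < e'"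
    assume "\<exists>x y. (\<forall>i. {x i, y i} \<in> \<D>) \<and> (range x \<subseteq> Z \<and> (\<lambda>i. ?A (x i)) \<longlonglongrightarrow> 2 * pi) \<and>
      (range y \<subseteq> Z \<and> (\<lambda>i. ?A (y i)) \<longlonglongrightarrow> 0)"
    then obtain x y where D: "\<And>i. {x i, y i} \<in> \<D>" "range x \<subseteq> Z" "range y \<subseteq> Z"
      and x: "(\<lambda>i. ?A (x i)) \<longlonglongrightarrow> 2 * pi" and y: "(\<lambda>i. ?A (y i)) \<longlonglongrightarrow> 0" by blast
    from eventually_happens'[OF sequentially_bot eventually_conj[OF tendstoD[OF x e(1)] tendstoD[OF y e(2)]]]
    show "\<exists>y\<in>Z. (\<exists>x\<in>Z. {x, y} \<in> \<D> \<and> dist (?A x) (2 * pi) < e) \<and> dist (?A y) 0 < e'"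
      using D by blast
  next
    assume near: "\<forall>e>0. \<forall>e'>0. \<exists>y\<in>Z.
      (\<exists>x\<in>Z. {x, y} \<in> \<D> \<and> dist (?A x) (2 * pi) < e) \<and> dist (?A y) 0 < e'"
    define P where "P p \<longleftrightarrow> fst p \<in> Z \<and> snd p \<in> Z \<and> {fst p, snd p} \<in> \<D>" for p
    have "\<exists>p. P p \<and> dist (?A (fst p), ?A (snd p)) (2 * pi, 0) < e" if e: "0 < e" for e
    proof -
      obtain x y where xy: "x \<in> Z" "y \<in> Z" "{x, y} \<in> \<D>" "dist (?A x) (2 * pi) < e / 2" "dist (?A y) 0 < e / 2"
        using near half_gt_zero[OF e] by meson
      have "sqrt ((dist (?A x) (2 * pi))\<^sup>2 + (dist (?A y) 0)\<^sup>2) < e"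
        by (rule sqrt_sum_squares_half_less[OF xy(4,5)]) simp_all
      then show ?thesis using xy by (intro exI[of _ "(x, y)"]) (auto simp: P_def dist_Pair_Pair)
    qed
    then obtain p where p: "\<And>i. P (p i)" "(\<lambda>i. (?A (fst (p i)), ?A (snd (p i)))) \<longlonglongrightarrow> (2 * pi, 0)"
      by (rule sequence_approaching[of P "\<lambda>p. (?A (fst p), ?A (snd p))"]) blast+
    then show "\<exists>x y. (\<forall>i. {x i, y i} \<in> \<D>) \<and> (range x \<subseteq> Z \<and> (\<lambda>i. ?A (x i)) \<longlonglongrightarrow> 2 * pi) \<and>
      (range y \<subseteq> Z \<and> (\<lambda>i. ?A (y i)) \<longlonglongrightarrow> 0)"
      using tendsto_fst[OF p(2)] tendsto_snd[OF p(2)]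
      by (intro exI[of _ "\<lambda>i. fst (p i)"] exI[of _ "\<lambda>i. snd (p i)"]) (auto simp: P_def)
  qed
  finally show ?thesis by blast
qed

context
  fixes Z :: "complex set"
  assumes adm: "admissible Z"
begin

interpretation accumulating circle angle_from Z
  by (rule accumulating_circle[OF adm])

lemma in_circle: "z \<in> Z \<Longrightarrow> z \<in> circle"
  using Z_sub by blast

lemma cyc_open_interval_Int_empty_iff:
  assumes "w \<in> Z" "z \<in> Z"
  shows "cyc_open_interval w z \<inter> Z = {} \<longleftrightarrow> (\<forall>x\<in>Z. \<not> cyc_between angle_from w x z)"
  using assms in_circle by (auto simp: cyc_open_interval_def cyc_less_iff_between)

lemma pre_equality:
  assumes z: "z \<in> Z" and w: "w \<in> Z" "w \<noteq> z" "\<And>x. x \<in> Z \<Longrightarrow> \<not> cyc_between angle_from w x z"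
  shows "pre Z z = w"
  unfolding pre_def
proof (rule the_equality)
  show "w \<in> Z \<and> w \<noteq> z \<and> cyc_open_interval w z \<inter> Z = {}"
    using w cyc_open_interval_Int_empty_iff[OF w(1) z] by blast
  fix v assume v: "v \<in> Z \<and> v \<noteq> z \<and> cyc_open_interval v z \<inter> Z = {}"
  then have "\<And>x. x \<in> Z \<Longrightarrow> \<not> cyc_between angle_from v x z"
    using cyc_open_interval_Int_empty_iff[of v z] z by blast
  then show "v = w" using neighbour_unique[OF z _ _ _ w] v by blast
qed

lemma pre_properties:
  assumes z: "z \<in> Z"
  shows "pre Z z \<in> Z" "pre Z z \<noteq> z" "x \<in> Z \<Longrightarrow> \<not> cyc_between angle_from (pre Z z) x z"
proof -
  obtain w where "w \<in> Z" "w \<noteq> z" "\<And>x. x \<in> Z \<Longrightarrow> \<not> cyc_between angle_from w x z"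
    by (rule predecessor_exists[OF z]) blast
  then show "pre Z z \<in> Z" "pre Z z \<noteq> z" "x \<in> Z \<Longrightarrow> \<not> cyc_between angle_from (pre Z z) x z"
    using pre_equality[OF z] by auto
qed

lemma suc_equality:
  assumes z: "z \<in> Z" and w: "w \<in> Z" "w \<noteq> z" "\<And>x. x \<in> Z \<Longrightarrow> \<not> cyc_between angle_from z x w"
  shows "suc Z z = w"
  unfolding suc_def
proof (rule the_equality)
  show "w \<in> Z \<and> w \<noteq> z \<and> cyc_open_interval z w \<inter> Z = {}"
    using w cyc_open_interval_Int_empty_iff[OF z w(1)] by blast
  fix v assume v: "v \<in> Z \<and> v \<noteq> z \<and> cyc_open_interval z v \<inter> Z = {}"
  then have nb: "\<And>x. x \<in> Z \<Longrightarrow> \<not> cyc_between angle_from z x v"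
    using cyc_open_interval_Int_empty_iff[of z v] z by blast
  interpret r: accumulating circle "reflect angle_from" Z by (rule accumulating_reflect)
  have ref: "cyc_between (reflect angle_from) p x z \<longleftrightarrow> cyc_between angle_from z x p" if "p \<in> Z" "x \<in> Z" for p x
    using circle.reflect_between that z in_circle by blast
  have "\<And>x. x \<in> Z \<Longrightarrow> \<not> cyc_between (reflect angle_from) v x z" "\<And>x. x \<in> Z \<Longrightarrow> \<not> cyc_between (reflect angle_from) w x z"
    using ref nb w v by blast+
  then show "v = w" using r.neighbour_unique[OF z] v w by blast
qed

lemma suc_properties:
  assumes z: "z \<in> Z"
  shows "suc Z z \<in> Z" "suc Z z \<noteq> z" "x \<in> Z \<Longrightarrow> \<not> cyc_between angle_from z x (suc Z z)"
proof -
  obtain w where "w \<in> Z" "w \<noteq> z" "\<And>x. x \<in> Z \<Longrightarrow> \<not> cyc_between angle_from z x w"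
    by (rule successor_exists[OF z]) blast
  then show "suc Z z \<in> Z" "suc Z z \<noteq> z" "x \<in> Z \<Longrightarrow> \<not> cyc_between angle_from z x (suc Z z)"
    using suc_equality[OF z] by auto
qed

lemma diagonals_iff_chord: "U \<in> diagonals Z \<longleftrightarrow> chord angle_from Z U"
proof -
  have eq: "x1 \<notin> {pre Z x0, x0, suc Z x0} \<longleftrightarrow>
      (\<exists>w\<in>Z. cyc_between angle_from x0 w x1) \<and> (\<exists>w\<in>Z. cyc_between angle_from x1 w x0)"
    if x0: "x0 \<in> Z" and x1: "x1 \<in> Z" for x0 x1
  proof
    assume n: "x1 \<notin> {pre Z x0, x0, suc Z x0}"
    show "(\<exists>w\<in>Z. cyc_between angle_from x0 w x1) \<and> (\<exists>w\<in>Z. cyc_between angle_from x1 w x0)"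
      using pre_equality[OF x0 x1] suc_equality[OF x0 x1] n by blast
  next
    assume b: "(\<exists>w\<in>Z. cyc_between angle_from x0 w x1) \<and> (\<exists>w\<in>Z. cyc_between angle_from x1 w x0)"
    have "x1 \<noteq> x0" using b circle.coord_self[OF in_circle[OF x0]] by (auto simp: cyc_between_def)
    then show "x1 \<notin> {pre Z x0, x0, suc Z x0}"
      using b pre_properties(3)[OF x0] suc_properties(3)[OF x0] by blast
  qed
  show ?thesis unfolding diagonals_def chord_def using eq by blast
qed

text \<open>Measured from \<open>x0\<close>, the predecessor of a point other than \<open>x0\<close> is the next smaller point of \<open>Z\<close>,
  and the predecessor of \<open>x0\<close> is the largest point. So the bounds \<open>x1\<^sup>-\<^sup>-\<close> and \<open>x0\<^sup>-\<^sup>-\<close> leave room for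
  exactly the points \<open>w = x1\<^sup>-\<close> and \<open>w' = x0\<^sup>-\<close>.\<close>

lemma hom_configuration_iff:
  assumes X: "{x0, x1} \<in> diagonals Z" and y: "y0 \<in> Z" "y1 \<in> Z"
  shows "hom_configuration Z x0 x1 y0 y1 \<longleftrightarrow> configuration angle_from Z x0 x1 y0 y1"
proof -
  obtain a b where "{x0, x1} = {a, b}" "a \<in> Z" "b \<in> Z" "\<exists>w\<in>Z. cyc_between angle_from a w b" "\<exists>w\<in>Z. cyc_between angle_from b w a"
    using X unfolding diagonals_iff_chord chord_def by blast
  then have x: "x0 \<in> Z" "x1 \<in> Z" and arcs: "\<exists>w\<in>Z. cyc_between angle_from x0 w x1" "\<exists>w\<in>Z. cyc_between angle_from x1 w x0"
    by (auto simp: doubleton_eq_iff)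
  let ?A = "angle_from x0"
  define p where "p = pre Z x1"
  define pp where "pp = pre Z p"
  define q where "q = pre Z x0"
  define qq where "qq = pre Z q"
  have Zs: "p \<in> Z" "pp \<in> Z" "q \<in> Z" "qq \<in> Z"
    unfolding p_def pp_def q_def qq_def using pre_properties(1) x by blast+
  note c = in_circle[OF x(1)]
  have A0: "?A x0 = 0" by (rule circle.coord_self[OF c])
  have ge: "0 \<le> ?A z" for z by (rule angle_from_range)
  have pos: "0 < ?A z" if "z \<in> Z" "z \<noteq> x0" for z by (rule circle.coord_pos[OF c in_circle[OF that(1)] that(2)])
  have inj: "?A z = ?A z' \<longleftrightarrow> z = z'" if "z \<in> Z" "z' \<in> Z" for z z'
    by (rule circle.coord_inj[OF c in_circle[OF that(1)] in_circle[OF that(2)]])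
  have btw: "cyc_between angle_from u v w \<longleftrightarrow> cyc3 (?A u) (?A v) (?A w)" if "u \<in> Z" "v \<in> Z" "w \<in> Z" for u v w
    using circle.between_change[OF c] that in_circle by blast
  have gap: "\<not> cyc3 (?A (pre Z z)) (?A x) (?A z)" if "z \<in> Z" "x \<in> Z" for z x
    using pre_properties(1)[OF that(1)] pre_properties(3)[OF that] btw that by blast
  have pre_lt: "?A (pre Z z) < ?A z" and pre_max: "x \<in> Z \<Longrightarrow> ?A x < ?A z \<Longrightarrow> ?A x \<le> ?A (pre Z z)"
    if z: "z \<in> Z" "z \<noteq> x0" for z x
  proof -
    have "?A (pre Z z) \<noteq> ?A z" using inj pre_properties(1,2)[OF z(1)] z(1) by blast
    then show lt: "?A (pre Z z) < ?A z"
      using gap[OF z(1) x(1)] pos[OF z] A0 unfolding cyc3_def by linarith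
    show "?A x \<le> ?A (pre Z z)" if "x \<in> Z" "?A x < ?A z"
      using gap[OF z(1) that(1)] lt that(2) unfolding cyc3_def by linarith
  qed
  have q_max: "?A x \<le> ?A q" if "x \<in> Z" for x
    using gap[OF x(1) that] A0 ge[of x] pos[OF Zs(3)] pre_properties(2)[OF x(1)] unfolding q_def[symmetric] cyc3_def
    by fastforce
  obtain v where v: "v \<in> Z" "0 < ?A v" "?A v < ?A x1" using arcs(1) by (auto simp: cyc_between_def)
  obtain v' where v': "v' \<in> Z" "?A x1 < ?A v'"
  proof -
    obtain v' where v': "v' \<in> Z" "cyc_between angle_from x1 v' x0" using arcs(2) by blast
    have "?A x1 < ?A v'"
      using btw[OF x(2) v'(1) x(1)] v'(2) A0 ge[of x1] ge[of v'] by (auto simp: cyc3_def)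
    then show ?thesis using that v'(1) by blast
  qed
  have x10: "x1 \<noteq> x0" using v A0 by auto
  have p_pos: "0 < ?A p" using pre_max[OF x(2) x10 v(1,3)] v(2) unfolding p_def by simp
  have p0: "p \<noteq> x0" using p_pos A0 by auto
  have q0: "q \<noteq> x0" unfolding q_def by (rule pre_properties(2)[OF x(1)])
  have p_lt: "?A p < ?A x1" unfolding p_def by (rule pre_lt[OF x(2) x10])
  have pp_lt: "?A pp < ?A p" unfolding pp_def by (rule pre_lt[OF Zs(1) p0])
  have qq_lt: "?A qq < ?A q" unfolding qq_def by (rule pre_lt[OF Zs(3) q0])
  have x1q: "?A x1 < ?A q" using q_max[OF v'(1)] v'(2) by simp
  have x1qq: "?A x1 \<le> ?A qq" unfolding qq_def by (rule pre_max[OF Zs(3) q0 x(2) x1q])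
  have "hom_configuration Z x0 x1 y0 y1 \<longleftrightarrow>
      ?A y0 \<le> ?A pp \<and> ?A x1 \<le> ?A y1 \<and> ?A y1 \<le> ?A qq"
  proof -
    have "x0 \<in> circle" "y0 \<in> circle" "pp \<in> circle" "x1 \<in> circle" "y1 \<in> circle" "qq \<in> circle"
      using x y Zs in_circle by blast+
    then show ?thesis
      unfolding hom_configuration_def cyc_le_def p_def[symmetric] pp_def[symmetric] q_def[symmetric] qq_def[symmetric]
      using A0 ge p_lt pp_lt by auto
  qed
  also have "\<dots> \<longleftrightarrow> configuration angle_from Z x0 x1 y0 y1"
  proof
    assume *: "?A y0 \<le> ?A pp \<and> ?A x1 \<le> ?A y1 \<and> ?A y1 \<le> ?A qq"
    show "configuration angle_from Z x0 x1 y0 y1"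
      unfolding configuration_def
      by (intro bexI[OF _ Zs(1)] bexI[OF _ Zs(3)]) (use * p_lt pp_lt qq_lt in auto)
  next
    assume "configuration angle_from Z x0 x1 y0 y1"
    then obtain w w' where w: "w \<in> Z" "w' \<in> Z" "?A y0 < ?A w" "?A w < ?A x1" "?A x1 \<le> ?A y1" "?A y1 < ?A w'"
      unfolding configuration_def by blast
    have "?A w \<le> ?A p" unfolding p_def by (rule pre_max[OF x(2) x10 w(1,4)])
    then have "?A y0 \<le> ?A pp" unfolding pp_def by (intro pre_max[OF Zs(1) p0 y(1)]) (use w in simp)
    moreover have "?A y1 \<le> ?A qq"
      unfolding qq_def by (intro pre_max[OF Zs(3) q0 y(2)]) (use w q_max[OF w(2)] in simp)
    ultimately show "?A y0 \<le> ?A pp \<and> ?A x1 \<le> ?A y1 \<and> ?A y1 \<le> ?A qq" using w by simp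
  qed
  finally show ?thesis .
qed

lemma diagonal_ends: "{x, y} \<in> diagonals Z \<Longrightarrow> x \<in> Z \<and> y \<in> Z"
  unfolding diagonals_def by (auto simp: doubleton_eq_iff)

lemma finitely_dominated_above_iff:
  assumes D: "\<D> \<subseteq> diagonals Z"
  shows "finitely_dominated_above Z \<D> \<longleftrightarrow> dominated angle_from Z \<D>"
proof -
  have key: "(\<exists>F. finite F \<and> F \<subseteq> \<D> \<and> (\<forall>x0 x1. {x0, x1} \<in> \<D> \<longrightarrow> hom_configuration Z x0 x1 y0 y1 \<longrightarrow>
      (\<exists>s0 s1. {s0, s1} \<in> F \<and> cyc_le [x0, s0, y0] \<and> cyc_le [x1, s1, y1]))) \<longleftrightarrow>
    (\<exists>F. finite F \<and> F \<subseteq> \<D> \<and> (\<forall>x0 x1. {x0, x1} \<in> \<D> \<longrightarrow> configuration angle_from Z x0 x1 y0 y1 \<longrightarrow>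
      (\<exists>s0 s1. {s0, s1} \<in> F \<and> in_arc angle_from x0 s0 y0 \<and> in_arc angle_from x1 s1 y1)))"
    if Y: "{y0, y1} \<in> diagonals Z" for y0 y1
  proof -
    have "hom_configuration Z x0 x1 y0 y1 \<longleftrightarrow> configuration angle_from Z x0 x1 y0 y1" if "{x0, x1} \<in> \<D>" for x0 x1
      using hom_configuration_iff diagonal_ends[OF Y] that D by blast
    moreover have "cyc_le [x0, s0, y0] \<and> cyc_le [x1, s1, y1] \<longleftrightarrow> in_arc angle_from x0 s0 y0 \<and> in_arc angle_from x1 s1 y1"
      if "{x0, x1} \<in> \<D>" "{s0, s1} \<in> \<D>" for x0 x1 s0 s1
      using that D diagonal_ends Y in_circle cyc_le_iff_in_arc by (meson subsetD)
    ultimately show ?thesis by (intro ex_cong1) (meson subsetD)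
  qed
  show ?thesis
    unfolding finitely_dominated_above_def dominated_def diagonals_iff_chord[symmetric]
    by (intro all_cong1 imp_cong refl) (rule key)
qed

lemma finitely_dominated_below_iff:
  assumes D: "\<D> \<subseteq> diagonals Z"
  shows "finitely_dominated_below Z \<D> \<longleftrightarrow> dominated (reflect angle_from) Z \<D>"
proof -
  have chord: "chord (reflect angle_from) Z U \<longleftrightarrow> U \<in> diagonals Z" for U
  proof -
    have "cyc_between (reflect angle_from) x w y \<longleftrightarrow> cyc_between angle_from y w x" if "x \<in> Z" "y \<in> Z" "w \<in> Z" for x y w
      using circle.reflect_between that in_circle by blast
    then show ?thesis unfolding diagonals_iff_chord chord_def by blast
  qed
  have key: "(\<exists>F. finite F \<and> F \<subseteq> \<D> \<and> (\<forall>x0 x1. {x0, x1} \<in> \<D> \<longrightarrow> hom_configuration Z y0 y1 x0 x1 \<longrightarrow>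
      (\<exists>s0 s1. {s0, s1} \<in> F \<and> cyc_le [y0, s0, x0] \<and> cyc_le [y1, s1, x1]))) \<longleftrightarrow>
    (\<exists>F. finite F \<and> F \<subseteq> \<D> \<and> (\<forall>x0 x1. {x0, x1} \<in> \<D> \<longrightarrow> configuration (reflect angle_from) Z x0 x1 y0 y1 \<longrightarrow>
      (\<exists>s0 s1. {s0, s1} \<in> F \<and> in_arc (reflect angle_from) x0 s0 y0 \<and> in_arc (reflect angle_from) x1 s1 y1)))"
    if Y: "{y0, y1} \<in> diagonals Z" for y0 y1
  proof -
    have ends: "x \<in> Z" "y \<in> Z" "x \<in> circle" "y \<in> circle" if "{x, y} \<in> \<D>" for x y
      using diagonal_ends that D in_circle by blast+
    have yc: "y0 \<in> circle" "y1 \<in> circle" using diagonal_ends[OF Y] in_circle by blast+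
    have "hom_configuration Z y0 y1 x0 x1 \<longleftrightarrow> configuration (reflect angle_from) Z x0 x1 y0 y1"
      if X: "{x0, x1} \<in> \<D>" for x0 x1
      using hom_configuration_iff[OF Y ends(1,2)[OF X]]
        circle.configuration_reflect[OF Z_sub ends(3,4)[OF X] yc] by blast
    moreover have "cyc_le [y0, s0, x0] \<and> cyc_le [y1, s1, x1] \<longleftrightarrow>
        in_arc (reflect angle_from) x0 s0 y0 \<and> in_arc (reflect angle_from) x1 s1 y1"
      if X: "{x0, x1} \<in> \<D>" and S: "{s0, s1} \<in> \<D>" for x0 x1 s0 s1
      unfolding cyc_le_iff_in_arc circle.reflect_in_arc[OF ends(3)[OF X] ends(3)[OF S] yc(1)]
        circle.reflect_in_arc[OF ends(4)[OF X] ends(4)[OF S] yc(2)]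
      using ends(3,4)[OF X] ends(3,4)[OF S] yc by blast
    ultimately show ?thesis by (intro ex_cong1) (meson subsetD)
  qed
  show ?thesis
    unfolding finitely_dominated_below_def dominated_def chord
    by (intro all_cong1 imp_cong refl) (rule key)
qed

lemma cross_iff_crossing_diagonals:
  assumes "U \<in> diagonals Z" "V \<in> diagonals Z"
  shows "cross U V \<longleftrightarrow> crossing angle_from U V"
proof (rule cross_iff_crossing)
  have "W \<subseteq> circle" if "W \<in> diagonals Z" for W
    using that in_circle unfolding diagonals_def by blast
  then show "U \<subseteq> circle" "V \<subseteq> circle" using assms by blast+
qed

lemma cross_commute:
  assumes U: "U \<in> diagonals Z" and V: "V \<in> diagonals Z" and c: "cross U V"
  shows "cross V U"
proof -
  obtain x0 x1 y0 y1 where xy: "U = {x0, x1}" "V = {y0, y1}"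
    and b: "cyc_between angle_from x0 y0 x1" "cyc_between angle_from x1 y1 x0"
    using c unfolding cross_iff_crossing_diagonals[OF U V] crossing_def by blast
  have S: "x0 \<in> circle" "x1 \<in> circle" "y0 \<in> circle" "y1 \<in> circle"
    using diagonal_ends[of x0 x1] diagonal_ends[of y0 y1] U V xy in_circle by auto
  have "cyc_between angle_from y0 x1 y1" "cyc_between angle_from y1 x0 y0"
    using b circle.between_change[OF S(1) S(1,3,2)] circle.between_change[OF S(1) S(2,4,1)]
      circle.between_change[OF S(1) S(3,2,4)] circle.between_change[OF S(1) S(4,1,3)]
      circle.coord_self[OF S(1)] circle.coord_pos[OF S(1,3)] angle_from_range(1)[of x0 y0] angle_from_range(1)[of x0 x1]
      angle_from_range(1)[of x0 y1]
    by (auto simp: cyc3_def)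
  moreover have "U = {x1, x0}" using xy by auto
  ultimately show ?thesis
    unfolding cross_iff_crossing_diagonals[OF V U] crossing_def using xy(2) by blast
qed

lemma not_cross_self: assumes U: "U \<in> diagonals Z" shows "\<not> cross U U"
proof
  assume "cross U U"
  then obtain x0 x1 y0 y1 where xy: "U = {x0, x1}" "U = {y0, y1}" and b: "cyc_between angle_from x0 y0 x1"
    unfolding cross_iff_crossing_diagonals[OF U U] crossing_def by blast
  have "x0 \<in> circle" using diagonal_ends[of x0 x1] U xy(1) in_circle by simp
  then show False
    using b xy circle.coord_self[of x0] by (auto simp: cyc_between_def doubleton_eq_iff)
qed

lemma maximal_noncrossing_iff:
  assumes D: "\<D> \<subseteq> diagonals Z"
  shows "maximal_noncrossing Z \<D> \<longleftrightarrow> {U \<in> diagonals Z. \<forall>V\<in>\<D>. \<not> cross V U} = \<D>"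
proof
  assume max: "maximal_noncrossing Z \<D>"
  show "{U \<in> diagonals Z. \<forall>V\<in>\<D>. \<not> cross V U} = \<D>"
  proof (intro equalityI subsetI)
    fix U assume U: "U \<in> {U \<in> diagonals Z. \<forall>V\<in>\<D>. \<not> cross V U}"
    have "noncrossing (insert U \<D>)"
      unfolding noncrossing_def
    proof (intro ballI)
      fix V W assume V: "V \<in> insert U \<D>" and W: "W \<in> insert U \<D>"
      have diag: "U \<in> diagonals Z" "V \<in> diagonals Z" "W \<in> diagonals Z" using U V W D by auto
      have to_U: "\<not> cross V' U" if "V' \<in> insert U \<D>" for V'
        using that U not_cross_self[OF diag(1)] by auto
      show "\<not> cross V W"
      proof (cases "V = U")
        case True
        then show ?thesis using to_U[OF W] cross_commute[OF diag(1,3)] by blast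
      next
        case False
        then show ?thesis
          using V W to_U[OF V] max unfolding maximal_noncrossing_def noncrossing_def by blast
      qed
    qed
    moreover have "insert U \<D> \<subseteq> diagonals Z" using U D by blast
    ultimately have "insert U \<D> = \<D>" using max unfolding maximal_noncrossing_def by blast
    then show "U \<in> \<D>" by blast
  qed (use max D in \<open>auto simp: maximal_noncrossing_def noncrossing_def\<close>)
next
  assume eq: "{U \<in> diagonals Z. \<forall>V\<in>\<D>. \<not> cross V U} = \<D>"
  have "\<D>' = \<D>" if "\<D>' \<subseteq> diagonals Z" "noncrossing \<D>'" "\<D> \<subseteq> \<D>'" for \<D>'
  proof -
    have "\<D>' \<subseteq> {U \<in> diagonals Z. \<forall>V\<in>\<D>. \<not> cross V U}" using that unfolding noncrossing_def by blast
    then show ?thesis using eq that(3) by blast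
  qed
  moreover have "noncrossing \<D>" unfolding noncrossing_def using eq by blast
  ultimately show "maximal_noncrossing Z \<D>" unfolding maximal_noncrossing_def using D by blast
qed

text \<open>Reversing the orientation exchanges the two domination conditions and keeps fountains, leapfrogs
  and limit points.\<close>

lemma finitely_dominated_iff_fountains_and_leapfrogs:
  assumes D: "\<D> \<subseteq> diagonals Z" and max: "maximal_noncrossing Z \<D>"
  shows "finitely_dominated_above Z \<D> \<and> finitely_dominated_below Z \<D> \<longleftrightarrow>
    (\<forall>a\<in>proper_limit_points Z. has_fountain Z \<D> a \<or> has_leapfrog Z \<D> a)"
proof -
  have eq: "{U \<in> diagonals Z. \<forall>V\<in>\<D>. \<not> cross V U} = \<D>" using maximal_noncrossing_iff[OF D] max by blast
  have fam: "chord_family circle angle_from Z \<D>"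
  proof
    show "Z \<subseteq> circle" by (rule Z_sub)
    show "chord angle_from Z U" if "U \<in> \<D>" for U using that D diagonals_iff_chord by blast
    show "\<not> crossing angle_from U V" if U: "U \<in> \<D>" and V: "V \<in> \<D>" for U V
    proof -
      have "\<not> cross U V" using eq U V by blast
      then show ?thesis using cross_iff_crossing_diagonals D U V by blast
    qed
  qed
  interpret fam: chord_family circle angle_from Z \<D> by (rule fam)
  interpret r: chord_family circle "reflect angle_from" Z \<D> by (rule fam.chord_family_reflect)
  interpret ra: accumulating circle "reflect angle_from" Z by (rule accumulating_reflect)
  have fl: "(\<forall>a\<in>proper_limit_points Z. has_fountain Z \<D> a \<or> has_leapfrog Z \<D> a) \<longleftrightarrow>
      (\<forall>a. limit_point circle angle_from Z a \<longrightarrow>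
        fountain circle angle_from Z \<D> a \<or> leapfrog circle angle_from Z \<D> a)"
  proof -
    have "has_fountain Z \<D> a \<or> has_leapfrog Z \<D> a \<longleftrightarrow>
        fountain circle angle_from Z \<D> a \<or> leapfrog circle angle_from Z \<D> a"
      if "limit_point circle angle_from Z a" for a
      using that has_fountain_iff[OF Z_sub] has_leapfrog_iff[OF Z_sub] by (auto simp: limit_point_def)
    then show ?thesis using proper_limit_points_iff[OF adm] by blast
  qed
  show ?thesis
    unfolding finitely_dominated_above_iff[OF D] finitely_dominated_below_iff[OF D] fl
  proof
    assume dom: "dominated angle_from Z \<D> \<and> dominated (reflect angle_from) Z \<D>"
    show "\<forall>a. limit_point circle angle_from Z a \<longrightarrow>
        fountain circle angle_from Z \<D> a \<or> leapfrog circle angle_from Z \<D> a"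
    proof (intro allI impI)
      fix a assume a: "limit_point circle angle_from Z a"
      interpret at: chord_family_at_limit circle angle_from Z \<D> a
        by unfold_locales (rule a)
      show "fountain circle angle_from Z \<D> a \<or> leapfrog circle angle_from Z \<D> a"
      proof (rule at.fountain_or_leapfrog_of_dominated)
        fix U assume U: "chord angle_from Z U" "\<And>V. V \<in> \<D> \<Longrightarrow> \<not> crossing angle_from V U"
        then have "U \<in> diagonals Z" using diagonals_iff_chord by blast
        then have "U \<in> {U \<in> diagonals Z. \<forall>V\<in>\<D>. \<not> cross V U}"
          using U(2) cross_iff_crossing_diagonals D by blast
        then show "U \<in> \<D>" using eq by blast
      qed (use dom in auto)
    qed
  next
    assume *: "\<forall>a. limit_point circle angle_from Z a \<longrightarrow>
        fountain circle angle_from Z \<D> a \<or> leapfrog circle angle_from Z \<D> a"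
    have "dominated angle_from Z \<D>"
      by (rule fam.dominated_of_fountains_and_leapfrogs[OF limit_below limit_above]) (use * in auto)
    moreover have "dominated (reflect angle_from) Z \<D>"
    proof (rule r.dominated_of_fountains_and_leapfrogs[OF ra.limit_below ra.limit_above])
      fix a assume "limit_point circle (reflect angle_from) Z a"
      then have a: "limit_point circle angle_from Z a" using fam.limit_point_reflect by blast
      then have ac: "a \<in> circle" by (simp add: limit_point_def)
      show "fountain circle (reflect angle_from) Z \<D> a \<or> leapfrog circle (reflect angle_from) Z \<D> a"
        using * a fam.fountain_reflect[OF ac] fam.leapfrog_reflect[OF ac] by blast
    qed auto
    ultimately show "dominated angle_from Z \<D> \<and> dominated (reflect angle_from) Z \<D>" by blast
  qed
qed

end

section \<open>Cluster tilting subcategories\<close>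

theorem theorem0p5:
  fixes k :: "('k, 'x) ring_scheme" and Z :: "complex set"
    and C :: "('k, 'o, 'm, 'y) tricat_scheme" and E :: "complex set \<Rightarrow> 'o"
    and \<D> :: "complex set set"
  assumes "admissible Z"
    and "algebraically_closed k"
    and "igusa_todorov_category k Z C E"
    and "\<D> \<subseteq> diagonals Z"
  shows "cluster_tilting C (add_closure C (E ` \<D>)) \<longleftrightarrow>
    maximal_noncrossing Z \<D> \<and>
    (\<forall>a\<in>proper_limit_points Z. has_fountain Z \<D> a \<or> has_leapfrog Z \<D> a)"
proof -
  interpret igusa_todorov_category k Z C E by fact
  have "cluster_tilting C (add_closure C (E ` \<D>)) \<longleftrightarrow>
      maximal_noncrossing Z \<D> \<and> finitely_dominated_above Z \<D> \<and> finitely_dominated_below Z \<D>"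
    unfolding cluster_tilting_def weakly_cluster_tilting_iff[OF assms(4)]
      precovering_iff[OF assms(4)] preenveloping_iff[OF assms(4)]
      maximal_noncrossing_iff[OF assms(1,4)] by blast
  then show ?thesis
    using finitely_dominated_iff_fountains_and_leapfrogs[OF assms(1,4)] by blast
qed

end
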